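(* Let $p$ be a prime, let $G$ be a finite $p$-group such that $|G| \ge p^3$ and $|G:G'| = p^2$, and let $H$ be a maximal subgroup of $G$. Then: (a) $G/H'$ is of maximal class, and $d(H) \le p$. (b) If $d(H) < p-1$, then $|\Phi(H):H'| \le p$, hence $|H:H'|$ equals either $p^{d(H)+1}$ or $p^{d(H)}$. (c) If $d(H) = p$, then $G/H' \cong C_p \wr C_p$, and $H/H'$ is elementary abelian of order $p^p$. (d) If $|\gamma_3(G):\gamma_4(G)| = p$, then $|\gamma_4(G):\gamma_5(G)| = p$, and all maximal subgroups $H$ of $G$, save one, satisfy $H' = \gamma_3(G)$. (e) If $|\gamma_3(G):\gamma_4(G)| = p^2$, then $H' \neq \gamma_3(G)$ and $H' \not\le \gamma_4(G)$. If $K$ is another maximal subgroup, then $H' \not\le K'$, and in particular $H' \neq K'$. (f) If $G$ contains a 2-generator maximal subgroup $H$, then either $H$ is metacyclic, or $G$ contains at most one maximal subgroup $K \neq H$ such that $|K:K'| \ge p^{p+1}$. (g) If $\gamma_3(G) \neq 1$, then $G^p \le \gamma_3(G)$.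
   Context: For a group $X$: $X'$ is the commutator subgroup, $d(X)$ is the minimal number of generators, $\Phi(X)$ is the Frattini subgroup, $X^p$ is the subgroup generated by all $p$-th powers of elements of $X$, and $\gamma_i(X)$ is the $i$-th term of the lower central series ($\gamma_1(X)=X$, $\gamma_2(X)=X'$, $\gamma_{i+1}(X)=[\gamma_i(X),X]$). A group of order $p^n \ge p^3$ is said to be of maximal class if its nilpotency class is $n-1$. $C_p$ denotes the cyclic group of order $p$, and $C_p \wr C_p$ is the (regular) wreath product of two groups of order $p$, of order $p^{p+1}$.
   Formalization: In (d), |γ_4(G):γ_5(G)| = p is claimed only when γ_4(G) ≠ 1 (otherwise the index is 1), and (g) is claimed only for odd p (for p = 2 it always fails, as G' ≤ G^2). The dihedral group of order 16 refutes both clauses as printed. *)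

theory Defs
  imports "HOL-Algebra.Algebra"
begin

text \<open>
  Subgroups are sets, and a subgroup \<open>H\<close> of \<open>G\<close>, regarded as a group in its own right, is
  \<open>G\<lparr>carrier := H\<rparr>\<close>. The commutator subgroup \<open>H'\<close> is the library's \<open>derived G H\<close>.
\<close>

definition maximal_subgroup :: "'a set \<Rightarrow> ('a, 'b) monoid_scheme \<Rightarrow> bool" where
  "maximal_subgroup M G \<longleftrightarrow> subgroup M G \<and> M \<noteq> carrier G \<and>
     (\<forall>K. subgroup K G \<and> M \<subseteq> K \<longrightarrow> K = M \<or> K = carrier G)"

text \<open>The intersection with the carrier settles the case in which there are no maximal subgroups.\<close>

definition frattini :: "('a, 'b) monoid_scheme \<Rightarrow> 'a set" where
  "frattini G = carrier G \<inter> \<Inter> {M. maximal_subgroup M G}"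

text \<open>Only meaningful for finitely generated groups.\<close>

definition min_gens :: "('a, 'b) monoid_scheme \<Rightarrow> nat" where
  "min_gens G = (LEAST n. \<exists>S. S \<subseteq> carrier G \<and> finite S \<and> card S = n \<and> generate G S = carrier G)"

text \<open>The index \<open>|A : B|\<close> for subgroups \<open>B \<subseteq> A\<close> of \<open>G\<close>.\<close>

definition sub_index :: "('a, 'b) monoid_scheme \<Rightarrow> 'a set \<Rightarrow> 'a set \<Rightarrow> nat" where
  "sub_index G A B = card (rcosets\<^bsub>G\<lparr>carrier := A\<rparr>\<^esub> B)"

definition power_subgroup :: "('a, 'b) monoid_scheme \<Rightarrow> nat \<Rightarrow> 'a set" where
  "power_subgroup G k = generate G {x [^]\<^bsub>G\<^esub> k | x. x \<in> carrier G}"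

text \<open>The commutator convention \<open>a b a\<inverse> b\<inverse>\<close> is the one used in the definition of \<open>derived\<close>.\<close>

definition commutator_subgroup :: "('a, 'b) monoid_scheme \<Rightarrow> 'a set \<Rightarrow> 'a set \<Rightarrow> 'a set" where
  "commutator_subgroup G A B =
     generate G {a \<otimes>\<^bsub>G\<^esub> b \<otimes>\<^bsub>G\<^esub> inv\<^bsub>G\<^esub> a \<otimes>\<^bsub>G\<^esub> inv\<^bsub>G\<^esub> b | a b. a \<in> A \<and> b \<in> B}"

text \<open>Indexing starts at 1; the value at 0 is a dummy.\<close>

fun lower_central :: "('a, 'b) monoid_scheme \<Rightarrow> nat \<Rightarrow> 'a set" where
  "lower_central G 0 = carrier G"
| "lower_central G (Suc 0) = carrier G"
| "lower_central G (Suc (Suc i)) =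
     commutator_subgroup G (lower_central G (Suc i)) (carrier G)"

lemma lower_central_2: "lower_central G 2 = derived G (carrier G)"
proof -
  have "{a \<otimes>\<^bsub>G\<^esub> b \<otimes>\<^bsub>G\<^esub> inv\<^bsub>G\<^esub> a \<otimes>\<^bsub>G\<^esub> inv\<^bsub>G\<^esub> b | a b. a \<in> carrier G \<and> b \<in> carrier G}
      = derived_set G (carrier G)"
    by blast
  then show ?thesis
    by (simp add: numeral_2_eq_2 commutator_subgroup_def derived_def)
qed

definition has_nilpotency_class :: "('a, 'b) monoid_scheme \<Rightarrow> nat \<Rightarrow> bool" where
  "has_nilpotency_class G c \<longleftrightarrow>
     lower_central G (Suc c) = {\<one>\<^bsub>G\<^esub>} \<and> (\<forall>j<c. lower_central G (Suc j) \<noteq> {\<one>\<^bsub>G\<^esub>})"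

definition maximal_class :: "nat \<Rightarrow> ('a, 'b) monoid_scheme \<Rightarrow> bool" where
  "maximal_class p G \<longleftrightarrow>
     group G \<and> (\<exists>n\<ge>3. order G = p ^ n \<and> has_nilpotency_class G (n - 1))"

definition elementary_abelian :: "nat \<Rightarrow> ('a, 'b) monoid_scheme \<Rightarrow> bool" where
  "elementary_abelian p G \<longleftrightarrow>
     comm_group G \<and> (\<forall>x\<in>carrier G. x [^]\<^bsub>G\<^esub> p = \<one>\<^bsub>G\<^esub>)"

definition metacyclic :: "('a, 'b) monoid_scheme \<Rightarrow> bool" where
  "metacyclic G \<longleftrightarrow>
     (\<exists>N. N \<lhd> G \<and> cyclic_group (subgroup_generated G N) \<and> cyclic_group (G Mod N))"

text \<open>
  The regular wreath product of \<open>A\<close> by \<open>B\<close>: the semidirect product of the base group of all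
  functions \<open>B \<rightarrow> A\<close> with \<open>B\<close>, where \<open>b \<in> B\<close> acts by \<open>(b \<cdot> g) x = g (x b)\<close>.
\<close>

definition regular_wreath ::
    "('a, 'c) monoid_scheme \<Rightarrow> ('b, 'd) monoid_scheme \<Rightarrow> (('b \<Rightarrow> 'a) \<times> 'b) monoid" where
  "regular_wreath A B =
     \<lparr> carrier = (carrier B \<rightarrow>\<^sub>E carrier A) \<times> carrier B,
       monoid.mult = (\<lambda>(f, b) (g, c).
         (\<lambda>x\<in>carrier B. f x \<otimes>\<^bsub>A\<^esub> g (x \<otimes>\<^bsub>B\<^esub> b), b \<otimes>\<^bsub>B\<^esub> c)),
       one = (\<lambda>x\<in>carrier B. \<one>\<^bsub>A\<^esub>, \<one>\<^bsub>B\<^esub>) \<rparr>"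

lemma group_regular_wreath:
  assumes "group A" "group B"
  shows "group (regular_wreath A B)"
proof -
  interpret A: group A by fact
  interpret B: group B by fact
  show ?thesis
  proof (rule groupI, goal_cases)
    case (1 x y)
    then show ?case
      by (auto simp: regular_wreath_def PiE_iff)
  next
    case 2
    then show ?case
      by (auto simp: regular_wreath_def)
  next
    case (3 x y z)
    then show ?case
      by (auto simp: regular_wreath_def PiE_iff A.m_assoc B.m_assoc intro!: restrict_ext)
  next
    case (4 x)
    then obtain f b where x: "x = (f, b)" "f \<in> carrier B \<rightarrow>\<^sub>E carrier A" "b \<in> carrier B"
      by (auto simp: regular_wreath_def)
    have "(\<lambda>y\<in>carrier B. (\<lambda>y\<in>carrier B. \<one>\<^bsub>A\<^esub>) y \<otimes>\<^bsub>A\<^esub> f (y \<otimes>\<^bsub>B\<^esub> \<one>\<^bsub>B\<^esub>)) = f"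
      using x by (auto simp: fun_eq_iff PiE_iff extensional_def)
    with x show ?case
      by (simp add: regular_wreath_def)
  next
    case (5 x)
    then obtain f b where x: "x = (f, b)" "f \<in> carrier B \<rightarrow>\<^sub>E carrier A" "b \<in> carrier B"
      by (auto simp: regular_wreath_def)
    define g where "g = (\<lambda>y\<in>carrier B. inv\<^bsub>A\<^esub> f (y \<otimes>\<^bsub>B\<^esub> inv\<^bsub>B\<^esub> b))"
    have "(g, inv\<^bsub>B\<^esub> b) \<in> carrier (regular_wreath A B)"
      using x by (auto simp: g_def regular_wreath_def PiE_iff)
    moreover have "(g, inv\<^bsub>B\<^esub> b) \<otimes>\<^bsub>regular_wreath A B\<^esub> x = \<one>\<^bsub>regular_wreath A B\<^esub>"
      using x by (auto simp: g_def regular_wreath_def PiE_iff intro!: restrict_ext)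
    ultimately show ?case
      by blast
  qed
qed

lemma order_regular_wreath_integer_mod_group:
  assumes "p > 0"
  shows "order (regular_wreath (integer_mod_group p) (integer_mod_group p)) = p ^ (p + 1)"
  using assms
  by (simp add: order_def regular_wreath_def carrier_integer_mod_group card_cartesian_product card_PiE)

end

theory Submission
  imports "HOL-Computational_Algebra.Polynomial" Defs
begin

text \<open>
  Let \<open>\<gamma>\<^sub>i\<close> be the lower central series and \<open>A = H/H'\<close>. An element \<open>g \<notin> H\<close> acts on \<open>A\<close>; put
  \<open>t = g - 1\<close>. As \<open>|A : t A| = |H : G'| = p\<close> and \<open>t\<close> is nilpotent, the only \<open>t\<close>-invariant subgroups of \<open>A\<close>
  are the \<open>A\<^sub>i = t\<^sup>i A\<close>, and \<open>A\<^sub>i\<close> is \<open>\<gamma>\<^sub>i\<^sub>+\<^sub>1\<close> of \<open>G/H'\<close>. From \<open>(1 + t)\<^sup>p = 1\<close> one gets \<open>t N = 0\<close> for the norm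
  \<open>N = t\<^sup>p\<^sup>-\<^sup>1 + p (1 + t v)\<close>. Comparing \<open>p A = A\<^sub>d\<close>, where \<open>d = d(H)\<close>, with \<open>t\<^sup>p\<^sup>-\<^sup>1 A\<close> modulo the kernel of \<open>t\<close>,
  which has order \<open>p\<close>, gives (a), (b) and (c); in (c) the element \<open>g\<^sup>p\<close> is a norm, so the extension splits.

  With \<open>G' = \<langle>d\<rangle> \<gamma>\<^sub>3\<close> the map \<open>x \<mapsto> [d, x]\<close> is a homomorphism onto \<open>\<gamma>\<^sub>3/\<gamma>\<^sub>4\<close>, and \<open>K' \<gamma>\<^sub>4/\<gamma>\<^sub>4\<close> is the image of the
  maximal subgroup \<open>K\<close>; two maximal subgroups together give everything. This yields (d) and (e). If \<open>[d, x]\<close>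
  is not in \<open>\<gamma>\<^sub>4\<close>, then \<open>x\<^sup>p\<close>, which commutes with \<open>x\<close>, cannot generate \<open>G'\<close> modulo \<open>\<gamma>\<^sub>3\<close>; this yields (g).

  For (f) it remains to treat \<open>|\<gamma>\<^sub>3 : \<gamma>\<^sub>4| = p\<^sup>2\<close> with \<open>p\<close> odd. If \<open>|K : K'| > p\<^sup>p\<close>, then \<open>x\<^sup>p\<close> lies in \<open>K' \<gamma>\<^sub>4\<close> for all
  \<open>x\<close> in \<open>G'\<close> or outside \<open>K\<close>. For two such subgroups \<open>K\<close> and \<open>L\<close> different from \<open>H\<close> the \<open>p\<close>-th powers of
  elements of \<open>H\<close> lie in \<open>K' \<gamma>\<^sub>4 \<inter> L' \<gamma>\<^sub>4 = \<gamma>\<^sub>4\<close>, so \<open>H/H' \<gamma>\<^sub>4\<close> is elementary abelian of order \<open>p\<^sup>3\<close>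
  and \<open>H\<close> needs three generators.
\<close>

section \<open>Commutators modulo a normal subgroup\<close>

text \<open>The estimates for (a) to (c) rest on one fact: the kernel of \<open>t\<close> on A has
  order p and meets every nonzero invariant subgroup, so every nonzero A_i contains it. The norm
  maps A into this kernel, the deepest nonzero layer of the chain. In every higher layer it is
  negligible, and t^(p-1) a agrees there with p a up to sign and the factor 1 + t v. That factor
  need not be inverted: t v lowers every element by a layer, so it can be cancelled on whole
  invariant subgroups.

  In the commutator half the obstacle is to pass from statements modulo \<open>\<gamma> 4\<close> to
  exact ones, such as from K' \<open>\<gamma> 4\<close> = \<open>\<gamma> 3\<close> to K' =
  \<open>\<gamma> 3\<close>. The tool is: N \<le> M [N, G] implies N \<le> M, for M normal. It is
  derived from nontrivial centers of quotients alone.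

  Oddness of p enters twice: p divides p(p-1)/2, which settles p-th powers of elements centralizing
  G' modulo \<open>\<gamma> 4\<close>, and p + 1 \<ge> 4, which places
  \<open>\<gamma> (Suc p)\<close> inside \<open>\<gamma> 4\<close>. In (f) the prime 2 is excluded
  separately, since a group generated by two involutions whose product is an involution is
  abelian.\<close>

definition commutator :: "('a, 'b) monoid_scheme \<Rightarrow> 'a \<Rightarrow> 'a \<Rightarrow> 'a" where
  "commutator G x y = x \<otimes>\<^bsub>G\<^esub> y \<otimes>\<^bsub>G\<^esub> inv\<^bsub>G\<^esub> x \<otimes>\<^bsub>G\<^esub> inv\<^bsub>G\<^esub> y"

context group
begin

lemma inv_l_cancel: "x \<in> carrier G \<Longrightarrow> y \<in> carrier G \<Longrightarrow> inv x \<otimes> (x \<otimes> y) = y"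
  by (simp add: m_assoc[symmetric])

lemma inv_r_cancel: "x \<in> carrier G \<Longrightarrow> y \<in> carrier G \<Longrightarrow> x \<otimes> (inv x \<otimes> y) = y"
  by (simp add: m_assoc[symmetric])

lemmas word_simps = m_assoc inv_mult_group inv_l_cancel inv_r_cancel

lemma commutator_closed [simp, intro]:
  "x \<in> carrier G \<Longrightarrow> y \<in> carrier G \<Longrightarrow> commutator G x y \<in> carrier G"
  by (simp add: commutator_def)

lemma commutator_eq_one_iff:
  assumes "x \<in> carrier G" "y \<in> carrier G"
  shows "commutator G x y = \<one> \<longleftrightarrow> x \<otimes> y = y \<otimes> x"
proof -
  have "commutator G x y = (x \<otimes> y) \<otimes> inv (y \<otimes> x)"
    using assms by (simp add: commutator_def word_simps)
  then show ?thesis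
    using assms by (metis inv_solve_right l_one m_closed one_closed)
qed

lemma inv_commutator:
  "x \<in> carrier G \<Longrightarrow> y \<in> carrier G \<Longrightarrow> inv (commutator G x y) = commutator G y x"
  by (simp add: commutator_def word_simps)

lemma conj_eq_commutator_mult:
  "x \<in> carrier G \<Longrightarrow> y \<in> carrier G \<Longrightarrow> x \<otimes> y \<otimes> inv x = commutator G x y \<otimes> y"
  by (simp add: commutator_def word_simps)

lemma conj_commutator:
  assumes "g \<in> carrier G" "x \<in> carrier G" "y \<in> carrier G"
  shows "g \<otimes> commutator G x y \<otimes> inv g = commutator G (g \<otimes> x \<otimes> inv g) (g \<otimes> y \<otimes> inv g)"
  using assms by (simp add: commutator_def word_simps)

lemma commutator_subgroup_eq:
  "commutator_subgroup G A B = generate G {commutator G a b | a b. a \<in> A \<and> b \<in> B}"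
  by (simp add: commutator_subgroup_def commutator_def)

lemma derived_eq_commutator_subgroup: "derived G H = commutator_subgroup G H H"
proof -
  have "derived_set G H = {a \<otimes> b \<otimes> inv a \<otimes> inv b | a b. a \<in> H \<and> b \<in> H}"
    by blast
  then show ?thesis
    unfolding derived_def commutator_subgroup_def by simp
qed

lemma commutator_in_commutator_subgroup:
  "a \<in> A \<Longrightarrow> b \<in> B \<Longrightarrow> commutator G a b \<in> commutator_subgroup G A B"
  unfolding commutator_subgroup_eq by (rule generate.incl) blast

lemma commutator_in_derived:
  "a \<in> H \<Longrightarrow> b \<in> H \<Longrightarrow> commutator G a b \<in> derived G H"
  unfolding derived_eq_commutator_subgroup by (rule commutator_in_commutator_subgroup)

lemma commutator_subgroup_leI:
  assumes "subgroup N G" "\<And>a b. a \<in> A \<Longrightarrow> b \<in> B \<Longrightarrow> commutator G a b \<in> N"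
  shows "commutator_subgroup G A B \<subseteq> N"
  unfolding commutator_subgroup_eq
  by (rule generate_subgroup_incl[OF _ assms(1)]) (use assms(2) in blast)

lemma commutator_subgroup_normal:
  assumes "A \<lhd> G" "B \<lhd> G"
  shows "commutator_subgroup G A B \<lhd> G"
  unfolding commutator_subgroup_eq
proof (rule normal_generateI)
  show "{commutator G a b |a b. a \<in> A \<and> b \<in> B} \<subseteq> carrier G"
    using assms normal_imp_subgroup subgroup.mem_carrier by fastforce
next
  fix h g assume "h \<in> {commutator G a b |a b. a \<in> A \<and> b \<in> B}" and g: "g \<in> carrier G"
  then obtain a b where h: "h = commutator G a b" "a \<in> A" "b \<in> B" by blast
  then have "a \<in> carrier G" "b \<in> carrier G"
    using assms normal_imp_subgroup subgroup.mem_carrier by fastforce+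
  then have "g \<otimes> h \<otimes> inv g = commutator G (g \<otimes> a \<otimes> inv g) (g \<otimes> b \<otimes> inv g)"
    using g h by (simp add: conj_commutator)
  then show "g \<otimes> h \<otimes> inv g \<in> {commutator G a b |a b. a \<in> A \<and> b \<in> B}"
    using h g assms normal.inv_op_closed2 by fastforce
qed

lemma commutator_in_normal:
  assumes "N \<lhd> G" "x \<in> N" "y \<in> carrier G"
  shows "commutator G x y \<in> N" "commutator G y x \<in> N"
proof -
  interpret N: normal N G by fact
  have x: "x \<in> carrier G" using assms by auto
  have *: "commutator G y x = (y \<otimes> x \<otimes> inv y) \<otimes> inv x"
    using x assms by (simp add: commutator_def word_simps)
  show yx: "commutator G y x \<in> N"
    unfolding * using assms N.inv_op_closed2 N.m_closed N.m_inv_closed by blast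
  show "commutator G x y \<in> N"
    using N.m_inv_closed[OF yx] x assms by (simp add: inv_commutator)
qed

lemma normalI_commutator:
  assumes "subgroup K G" "\<And>g k. g \<in> carrier G \<Longrightarrow> k \<in> K \<Longrightarrow> commutator G g k \<in> K"
  shows "K \<lhd> G"
proof (rule normal_invI[OF assms(1)])
  fix g k assume "g \<in> carrier G" "k \<in> K"
  then show "g \<otimes> k \<otimes> inv g \<in> K"
    using assms by (metis conj_eq_commutator_mult subgroup.m_closed subgroup.mem_carrier)
qed

text \<open>Hides cosets: later arguments see only a surjection with known kernel, so that
  membership in N becomes an equation in the quotient.\<close>

lemma normal_quotientE:
  assumes "N \<lhd> G"
  obtains Q h where "Q = G Mod N" "h = (\<lambda>x. N #> x)" "group_hom G Q h" "h ` carrier G = carrier Q"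
    "\<And>x. x \<in> carrier G \<Longrightarrow> h x = \<one>\<^bsub>Q\<^esub> \<longleftrightarrow> x \<in> N"
proof -
  interpret N: normal N G by fact
  have "group_hom G (G Mod N) (\<lambda>x. N #> x)"
    unfolding group_hom_def group_hom_axioms_def
    using N.factorgroup_is_group N.r_coset_hom_Mod by auto
  moreover have "(\<lambda>x. N #> x) ` carrier G = carrier (G Mod N)"
    by (auto simp: carrier_FactGroup)
  moreover have "N #> x = N \<longleftrightarrow> x \<in> N" if "x \<in> carrier G" for x
    using that N.subgroup_axioms by (metis coset_join1 coset_join2 subgroup.subset)
  ultimately show thesis
    using that by auto
qed

end

context group_hom
begin

lemma hom_commutator:
  assumes "x \<in> carrier G" "y \<in> carrier G"
  shows "h (commutator G x y) = commutator H (h x) (h y)"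
  using assms by (simp add: commutator_def)

lemma commutator_subgroup_img:
  assumes "A \<subseteq> carrier G" "B \<subseteq> carrier G"
  shows "commutator_subgroup H (h ` A) (h ` B) = h ` commutator_subgroup G A B"
proof -
  have "{commutator H a b | a b. a \<in> h ` A \<and> b \<in> h ` B} = h ` {commutator G a b | a b. a \<in> A \<and> b \<in> B}"
    using assms by (auto simp: hom_commutator subset_iff image_iff) (metis hom_commutator)+
  moreover have "{commutator G a b | a b. a \<in> A \<and> b \<in> B} \<subseteq> carrier G"
    using assms by auto
  ultimately show ?thesis
    by (simp add: H.commutator_subgroup_eq G.commutator_subgroup_eq generate_img)
qed

end

context group
begin

lemma commutator_mod_iff:
  assumes "N \<lhd> G" and hom: "group_hom G Q h"
    and ker: "\<And>x. x \<in> carrier G \<Longrightarrow> h x = \<one>\<^bsub>Q\<^esub> \<longleftrightarrow> x \<in> N"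
    and "x \<in> carrier G" "y \<in> carrier G"
  shows "commutator G x y \<in> N \<longleftrightarrow> h x \<otimes>\<^bsub>Q\<^esub> h y = h y \<otimes>\<^bsub>Q\<^esub> h x"
proof -
  interpret h: group_hom G Q h by fact
  have "commutator G x y \<in> N \<longleftrightarrow> commutator Q (h x) (h y) = \<one>\<^bsub>Q\<^esub>"
    using assms ker[of "commutator G x y"] by (simp add: h.hom_commutator)
  also have "\<dots> \<longleftrightarrow> h x \<otimes>\<^bsub>Q\<^esub> h y = h y \<otimes>\<^bsub>Q\<^esub> h x"
    using assms by (simp add: h.H.commutator_eq_one_iff)
  finally show ?thesis .
qed

text \<open>The preimage in G of the centralizer of AN/N in G/N. Its being a subgroup replaces
  inductions over generated elements.\<close>

definition centralizer_mod :: "'a set \<Rightarrow> 'a set \<Rightarrow> 'a set" where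
  "centralizer_mod N A = {x \<in> carrier G. \<forall>a\<in>A. commutator G x a \<in> N}"

lemma centralizer_mod_subgroup:
  assumes "N \<lhd> G" "A \<subseteq> carrier G"
  shows "subgroup (centralizer_mod N A) G"
proof -
  obtain Q :: "'a set monoid" and h where "group_hom G Q h" and ker: "\<And>x. x \<in> carrier G \<Longrightarrow> h x = \<one>\<^bsub>Q\<^esub> \<longleftrightarrow> x \<in> N"
    by (rule normal_quotientE[OF assms(1)]) (rule that)
  interpret h: group_hom G Q h by fact
  note iff = commutator_mod_iff[OF assms(1) \<open>group_hom G Q h\<close> ker]
  have cen: "centralizer_mod N A = {x \<in> carrier G. \<forall>a\<in>A. h x \<otimes>\<^bsub>Q\<^esub> h a = h a \<otimes>\<^bsub>Q\<^esub> h x}"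
    using assms(2) iff by (auto simp: centralizer_mod_def)
  show ?thesis
  proof (rule subgroupI)
    show "centralizer_mod N A \<subseteq> carrier G" by (auto simp: centralizer_mod_def)
    show "centralizer_mod N A \<noteq> {}"
      using assms(2) unfolding cen by (auto simp: subset_iff intro!: exI[of _ \<one>])
  next
    fix x y assume xy: "x \<in> centralizer_mod N A" "y \<in> centralizer_mod N A"
    have "h (x \<otimes> y) \<otimes>\<^bsub>Q\<^esub> h a = h a \<otimes>\<^bsub>Q\<^esub> h (x \<otimes> y)" if "a \<in> A" for a
    proof -
      have "h x \<in> carrier Q" "h y \<in> carrier Q" "h a \<in> carrier Q"
        "h x \<otimes>\<^bsub>Q\<^esub> h a = h a \<otimes>\<^bsub>Q\<^esub> h x" "h y \<otimes>\<^bsub>Q\<^esub> h a = h a \<otimes>\<^bsub>Q\<^esub> h y" "x \<in> carrier G" "y \<in> carrier G"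
        using xy that assms(2) unfolding cen by (simp_all add: subset_iff)
      then show ?thesis by (metis h.H.m_assoc h.hom_mult)
    qed
    then show "x \<otimes> y \<in> centralizer_mod N A"
      using xy unfolding cen by blast
  next
    fix x assume x: "x \<in> centralizer_mod N A"
    have "h (inv x) \<otimes>\<^bsub>Q\<^esub> h a = h a \<otimes>\<^bsub>Q\<^esub> h (inv x)" if "a \<in> A" for a
    proof -
      have c: "h x \<in> carrier Q" "h a \<in> carrier Q" "h x \<otimes>\<^bsub>Q\<^esub> h a = h a \<otimes>\<^bsub>Q\<^esub> h x" "x \<in> carrier G"
        using x that assms(2) unfolding cen by (simp_all add: subset_iff)
      then have "h a = inv\<^bsub>Q\<^esub> h x \<otimes>\<^bsub>Q\<^esub> (h a \<otimes>\<^bsub>Q\<^esub> h x)"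
        by (metis h.H.inv_l_cancel)
      then have "h a \<otimes>\<^bsub>Q\<^esub> inv\<^bsub>Q\<^esub> h x = inv\<^bsub>Q\<^esub> h x \<otimes>\<^bsub>Q\<^esub> h a"
        using c by (metis h.H.inv_closed h.H.inv_solve_right' h.H.m_assoc h.H.m_closed)
      then show ?thesis using c by simp
    qed
    then show "inv x \<in> centralizer_mod N A"
      using x unfolding cen by blast
  qed
qed

text \<open>Two applications of the centralizer: S, hence \<open>generate G S\<close>, centralizes T
  modulo N; then T, hence \<open>generate G T\<close>, centralizes \<open>generate G S\<close>. This
  reduces all later commutator computations to generators.\<close>

lemma commutator_generate_mem:
  assumes N: "N \<lhd> G" and S: "S \<subseteq> carrier G" and T: "T \<subseteq> carrier G"
    and ST: "\<And>s t. s \<in> S \<Longrightarrow> t \<in> T \<Longrightarrow> commutator G s t \<in> N"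
    and x: "x \<in> generate G S" and y: "y \<in> generate G T"
  shows "commutator G x y \<in> N"
proof -
  have sub: "subgroup N G" using N by (rule normal_imp_subgroup)
  have sym: "commutator G a b \<in> N \<Longrightarrow> a \<in> carrier G \<Longrightarrow> b \<in> carrier G \<Longrightarrow> commutator G b a \<in> N" for a b
    using subgroup.m_inv_closed[OF sub] by (metis inv_commutator)
  have xs: "generate G S \<subseteq> centralizer_mod N T"
    by (rule generate_subgroup_incl[OF _ centralizer_mod_subgroup[OF N T]])
       (use S ST in \<open>auto simp: centralizer_mod_def\<close>)
  have ys: "generate G T \<subseteq> centralizer_mod N (generate G S)"
  proof (rule generate_subgroup_incl[OF _ centralizer_mod_subgroup[OF N generate_incl[OF S]]], rule subsetI)
    fix t assume "t \<in> T"
    then show "t \<in> centralizer_mod N (generate G S)"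
      using xs T sym generate_incl[OF S] by (auto simp: centralizer_mod_def subset_iff)
  qed
  have "commutator G y x \<in> N"
    using x y ys by (auto simp: centralizer_mod_def)
  then show ?thesis
    using sym x y generate_incl[OF S] generate_incl[OF T] by blast
qed

lemma derived_generate_le:
  assumes "N \<lhd> G" "S \<subseteq> carrier G" "\<And>s t. s \<in> S \<Longrightarrow> t \<in> S \<Longrightarrow> commutator G s t \<in> N"
  shows "derived G (generate G S) \<subseteq> N"
  unfolding derived_eq_commutator_subgroup
  by (rule commutator_subgroup_leI[OF normal_imp_subgroup[OF assms(1)]])
     (rule commutator_generate_mem[OF assms(1,2,2,3)])

text \<open>The identity [e, xy] = [e, x] x [e, y] x^-1 holds always; \<open>cen\<close> makes the
  conjugation by x invisible in the quotient.\<close>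

lemma commutator_mult_mod_central:
  assumes N: "N \<lhd> G" and e: "e \<in> carrier G"
    and hom: "group_hom G Q h" and ker: "\<And>x. x \<in> carrier G \<Longrightarrow> h x = \<one>\<^bsub>Q\<^esub> \<longleftrightarrow> x \<in> N"
    and x: "x \<in> carrier G" and y: "y \<in> carrier G"
    and cen: "commutator G (commutator G e y) x \<in> N"
  shows "h (commutator G e (x \<otimes> y)) = h (commutator G e x) \<otimes>\<^bsub>Q\<^esub> h (commutator G e y)"
proof -
  interpret h: group_hom G Q h by fact
  have "commutator G e (x \<otimes> y) = commutator G e x \<otimes> (x \<otimes> commutator G e y \<otimes> inv x)"
    using e x y by (simp add: commutator_def word_simps)
  moreover have "h x \<otimes>\<^bsub>Q\<^esub> h (commutator G e y) = h (commutator G e y) \<otimes>\<^bsub>Q\<^esub> h x"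
    using commutator_mod_iff[OF N hom ker, of "commutator G e y" x] cen e x y by auto
  ultimately show ?thesis
    using e x y by (simp add: h.H.m_assoc)
qed

text \<open>Modulo \<open>N\<close>, the map \<open>x \<mapsto> [e, x]\<close> is a homomorphism with commutative image, so it kills commutators.\<close>

lemma commutator_derived_mem:
  assumes N: "N \<lhd> G" and e: "e \<in> carrier G"
    and cen: "\<And>x y. x \<in> carrier G \<Longrightarrow> y \<in> carrier G \<Longrightarrow> commutator G (commutator G e x) y \<in> N"
    and z: "z \<in> derived G (carrier G)"
  shows "commutator G e z \<in> N"
proof -
  obtain Q :: "'a set monoid" and h where hom: "group_hom G Q h" and ker: "\<And>x. x \<in> carrier G \<Longrightarrow> h x = \<one>\<^bsub>Q\<^esub> \<longleftrightarrow> x \<in> N"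
    by (rule normal_quotientE[OF N]) (rule that)
  interpret h: group_hom G Q h by fact
  have mult: "h (commutator G e (x \<otimes> y)) = h (commutator G e x) \<otimes>\<^bsub>Q\<^esub> h (commutator G e y)"
    if "x \<in> carrier G" "y \<in> carrier G" for x y
    by (rule commutator_mult_mod_central[OF N e hom ker]) (use that cen in auto)
  have swap: "h (commutator G e x) \<otimes>\<^bsub>Q\<^esub> h (commutator G e y) = h (commutator G e y) \<otimes>\<^bsub>Q\<^esub> h (commutator G e x)"
    if "x \<in> carrier G" "y \<in> carrier G" for x y
    using commutator_mod_iff[OF N hom ker, of "commutator G e x" "commutator G e y"] cen e that by auto
  have gen: "commutator G e (commutator G x y) \<in> N" if x: "x \<in> carrier G" and y: "y \<in> carrier G" for x y
  proof -
    let ?c = "commutator G x y"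
    \<comment> \<open>Since [x, y] (y x) = x y, and x y and y x have the same image, the factor
      contributed by [x, y] must be trivial.\<close>
    have "h (commutator G e (?c \<otimes> (y \<otimes> x))) = h (commutator G e ?c) \<otimes>\<^bsub>Q\<^esub> h (commutator G e (y \<otimes> x))"
      using mult x y by simp
    moreover have "?c \<otimes> (y \<otimes> x) = x \<otimes> y"
      using x y by (simp add: commutator_def word_simps)
    moreover have "h (commutator G e (x \<otimes> y)) = h (commutator G e (y \<otimes> x))"
      using mult[OF x y] mult[OF y x] swap[OF x y] by simp
    ultimately have "h (commutator G e ?c) \<otimes>\<^bsub>Q\<^esub> h (commutator G e (y \<otimes> x)) = h (commutator G e (y \<otimes> x))"
      by simp
    then have "h (commutator G e ?c) = \<one>\<^bsub>Q\<^esub>"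
      using e x y h.H.r_cancel_one[of "h (commutator G e (y \<otimes> x))" "h (commutator G e ?c)"] by simp
    then show ?thesis using ker e x y by auto
  qed
  have *: "commutator G z e \<in> N"
  proof -
    have "derived G (carrier G) \<subseteq> centralizer_mod N {e}"
      unfolding derived_eq_commutator_subgroup
    proof (rule commutator_subgroup_leI[OF centralizer_mod_subgroup[OF N]])
      fix a b assume ab: "a \<in> carrier G" "b \<in> carrier G"
      have "inv (commutator G e (commutator G a b)) \<in> N"
        by (rule subgroup.m_inv_closed[OF normal_imp_subgroup[OF N] gen[OF ab]])
      then show "commutator G a b \<in> centralizer_mod N {e}"
        using ab e by (simp add: centralizer_mod_def inv_commutator)
    qed (use e in auto)
    then show ?thesis using z by (auto simp: centralizer_mod_def)
  qed
  have "z \<in> carrier G" using z derived_in_carrier by blast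
  then show ?thesis
    using subgroup.m_inv_closed[OF normal_imp_subgroup[OF N] *] e by (simp add: inv_commutator)
qed

section \<open>The lower central series\<close>

lemma lower_central_Suc:
  "i \<ge> 1 \<Longrightarrow> lower_central G (Suc i) = commutator_subgroup G (lower_central G i) (carrier G)"
  by (cases i) auto

lemma lower_central_normal: "lower_central G i \<lhd> G"
proof (induction i)
  case (Suc i)
  then show ?case
    by (cases "i \<ge> 1") (auto simp: lower_central_Suc not_le commutator_subgroup_normal normal_self)
qed (auto simp: normal_self)

lemma lower_central_subgroup: "subgroup (lower_central G i) G"
  by (rule normal_imp_subgroup[OF lower_central_normal])

lemma lower_central_subset: "lower_central G i \<subseteq> carrier G"
  by (rule subgroup.subset[OF lower_central_subgroup])

lemma lower_central_Suc_subset: "lower_central G (Suc i) \<subseteq> lower_central G i"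
proof (cases "i \<ge> 1")
  case True
  show ?thesis
    unfolding lower_central_Suc[OF True]
    by (rule commutator_subgroup_leI[OF lower_central_subgroup])
       (rule commutator_in_normal[OF lower_central_normal])
next
  case False
  then have "i = 0" by simp
  then show ?thesis by simp
qed

lemma lower_central_antimono: "i \<le> j \<Longrightarrow> lower_central G j \<subseteq> lower_central G i"
  by (induction j rule: dec_induct) (use lower_central_Suc_subset in blast)+

lemma commutator_in_lower_central:
  assumes "x \<in> lower_central G i" "y \<in> carrier G" "i \<ge> 1"
  shows "commutator G x y \<in> lower_central G (Suc i)" "commutator G y x \<in> lower_central G (Suc i)"
proof -
  show 1: "commutator G x y \<in> lower_central G (Suc i)"
    using assms by (simp add: lower_central_Suc commutator_in_commutator_subgroup)
  have "x \<in> carrier G" using assms(1) lower_central_subset by blast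
  then show "commutator G y x \<in> lower_central G (Suc i)"
    using subgroup.m_inv_closed[OF lower_central_subgroup 1] assms by (simp add: inv_commutator)
qed

text \<open>The case [\<open>\<gamma>\<close> i, \<open>\<gamma>\<close> 2] \<le>
  \<open>\<gamma>\<close> (i + 2) of the general inclusion. Modulo the right-hand side all [x, a]
  are central, so the previous homomorphism argument replaces the three subgroups lemma.\<close>

lemma commutator_derived_in_lower_central:
  assumes x: "x \<in> lower_central G i" and z: "z \<in> derived G (carrier G)" and i: "i \<ge> 1"
  shows "commutator G x z \<in> lower_central G (i + 2)"
proof (rule commutator_derived_mem[OF lower_central_normal _ _ z])
  show "x \<in> carrier G" using x lower_central_subset by blast
  fix a b assume "a \<in> carrier G" "b \<in> carrier G"
  then show "commutator G (commutator G x a) b \<in> lower_central G (i + 2)"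
    using commutator_in_lower_central[OF commutator_in_lower_central(1)[OF x]] i by simp
qed

end

lemma (in group_hom) lower_central_img:
  assumes "h ` carrier G = carrier H"
  shows "lower_central H i = h ` lower_central G i"
proof (induction i)
  case (Suc i)
  then show ?case
    using assms commutator_subgroup_img[of "lower_central G i" "carrier G"]
    by (cases "i \<ge> 1") (auto simp: H.lower_central_Suc G.lower_central_Suc not_le G.lower_central_subset)
qed (use assms in auto)

section \<open>Finite p-groups\<close>

lemma (in normal) conj_pow_mem:
  "h \<in> H \<Longrightarrow> x \<in> carrier G \<Longrightarrow> x [^] (i::int) \<otimes> h \<otimes> inv (x [^] i) \<in> H"
  by (rule inv_op_closed2) auto

lemma (in group) generate_insert_normal:
  assumes M: "M \<lhd> G" and x: "x \<in> carrier G"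
  shows "generate G (insert x M) = {m \<otimes> x [^] (i::int) | m i. m \<in> M}"
proof
  interpret M: normal M G by fact
  let ?S = "{m \<otimes> x [^] (i::int) | m i. m \<in> M}"
  have subS: "subgroup ?S G"
  proof (rule subgroupI)
    show "?S \<subseteq> carrier G" using x by auto
    show "?S \<noteq> {}" using M.one_closed by blast
  next
    fix a assume "a \<in> ?S"
    then obtain m i where a: "a = m \<otimes> x [^] (i::int)" "m \<in> M" by blast
    have "inv a = (x [^] (-i) \<otimes> inv m \<otimes> inv (x [^] (-i))) \<otimes> x [^] (-i)"
      using a x by (simp add: word_simps int_pow_neg)
    then show "inv a \<in> ?S"
      using M.conj_pow_mem[OF M.m_inv_closed[OF a(2)] x, of "-i"] by blast
  next
    fix a b assume "a \<in> ?S" "b \<in> ?S"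
    then obtain m i m' j where a: "a = m \<otimes> x [^] (i::int)" "m \<in> M"
      and b: "b = m' \<otimes> x [^] (j::int)" "m' \<in> M" by blast
    have "a \<otimes> b = (m \<otimes> (x [^] i \<otimes> m' \<otimes> inv (x [^] i))) \<otimes> (x [^] i \<otimes> x [^] j)"
      using a b x by (simp add: word_simps)
    also have "x [^] i \<otimes> x [^] j = x [^] (i + j)" using x by (simp add: int_pow_mult)
    finally show "a \<otimes> b \<in> ?S"
      using M.conj_pow_mem[OF b(2) x, of i] a by blast
  qed
  have "insert x M \<subseteq> ?S"
  proof
    fix y assume "y \<in> insert x M"
    then show "y \<in> ?S"
    proof
      assume "y = x"
      then have "y = \<one> \<otimes> x [^] (1::int)" using x by simp
      then show ?thesis using M.one_closed by blast
    next
      assume "y \<in> M"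
      then have "y = y \<otimes> x [^] (0::int)" by simp
      then show ?thesis using \<open>y \<in> M\<close> by blast
    qed
  qed
  then show "generate G (insert x M) \<subseteq> ?S"
    by (rule generate_subgroup_incl[OF _ subS])
  have sub: "subgroup (generate G (insert x M)) G"
    using x M.subset by (intro generate_is_subgroup) auto
  show "?S \<subseteq> generate G (insert x M)"
  proof clarify
    fix m i assume "m \<in> M"
    then show "m \<otimes> x [^] (i::int) \<in> generate G (insert x M)"
      by (intro subgroup.m_closed[OF sub] subgroup_int_pow_closed[OF sub] generate.incl) auto
  qed
qed

text \<open>Because x^p lies in M, exponents can be reduced modulo p; this gives the bound on the
  index of M and, later, normal forms b q^i with a natural exponent.\<close>

lemma (in group) generate_insert_power:
  assumes M: "M \<lhd> G" and x: "x \<in> carrier G" and xp: "x [^] (p::nat) \<in> M" and p: "p > 0"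
  shows "generate G (insert x M) = (\<lambda>(m, i). m \<otimes> x [^] (i::nat)) ` (M \<times> {..<p})"
proof
  interpret M: normal M G by fact
  show "generate G (insert x M) \<subseteq> (\<lambda>(m, i). m \<otimes> x [^] (i::nat)) ` (M \<times> {..<p})"
  proof
    fix a assume "a \<in> generate G (insert x M)"
    then obtain m i where a: "a = m \<otimes> x [^] (i::int)" "m \<in> M"
      unfolding generate_insert_normal[OF M x] by blast
    define k where "k = nat (i mod int p)"
    have "i = int p * (i div int p) + int k" using p by (simp add: k_def)
    then have "x [^] i = (x [^] p) [^] (i div int p) \<otimes> x [^] k"
      using x by (metis int_pow_int int_pow_mult int_pow_pow)
    moreover have "m \<otimes> (x [^] p) [^] (i div int p) \<in> M"
      using xp a subgroup_int_pow_closed[OF M.subgroup_axioms xp] by blast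
    moreover have "k < p" using p by (simp add: k_def nat_less_iff)
    ultimately show "a \<in> (\<lambda>(m, i). m \<otimes> x [^] (i::nat)) ` (M \<times> {..<p})"
      using a x by (intro image_eqI[of _ _ "(m \<otimes> (x [^] p) [^] (i div int p), k)"]) (auto simp: m_assoc)
  qed
  show "(\<lambda>(m, i). m \<otimes> x [^] (i::nat)) ` (M \<times> {..<p}) \<subseteq> generate G (insert x M)"
    unfolding generate_insert_normal[OF M x] by (auto simp: int_pow_int[symmetric])
qed

lemma (in group) card_generate_insert_le:
  assumes "M \<lhd> G" "x \<in> carrier G" "x [^] (p::nat) \<in> M" "p > 0" "finite M"
  shows "card (generate G (insert x M)) \<le> p * card M"
proof -
  have "card (generate G (insert x M)) \<le> card (M \<times> {..<p})"
    unfolding generate_insert_power[OF assms(1-4)] using assms(5) by (intro card_image_le) auto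
  then show ?thesis by (simp add: card_cartesian_product mult.commute)
qed

lemma (in group) sub_index_mult_card:
  assumes "subgroup A G" "subgroup B G" "B \<subseteq> A"
  shows "sub_index G A B * card B = card A"
proof -
  interpret A: group "G\<lparr>carrier := A\<rparr>" by (rule subgroup_imp_group[OF assms(1)])
  have "subgroup B (G\<lparr>carrier := A\<rparr>)" by (rule subgroup_incl[OF assms(2,1,3)])
  from A.lagrange[OF this] show ?thesis by (simp add: sub_index_def order_def)
qed

text \<open>Each fibre of h on K is a translate of N. All order computations in quotients go through
  this counting form of the isomorphism theorem.\<close>

lemma (in group) card_hom_image:
  assumes hom: "group_hom G Q h" and K: "subgroup K G" and "finite K"
    and ker: "\<And>x. x \<in> carrier G \<Longrightarrow> h x = \<one>\<^bsub>Q\<^esub> \<longleftrightarrow> x \<in> N" and N: "N \<subseteq> K"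
  shows "card (h ` K) * card N = card K"
proof -
  interpret h: group_hom G Q h by fact
  interpret K: subgroup K G by fact
  have fib: "card {y \<in> K. h y = h x} = card N" if x: "x \<in> K" for x
  proof (rule bij_betw_same_card)
    have a: "y \<otimes> inv x \<in> N" if "y \<in> K" "h y = h x" for y
      using that x ker[of "y \<otimes> inv x"] by simp
    have b: "y \<otimes> x \<in> K" "h (y \<otimes> x) = h x" "y \<in> carrier G" if "y \<in> N" for y
      using that x N ker[of y] by auto
    show "bij_betw (\<lambda>y. y \<otimes> inv x) {y \<in> K. h y = h x} N"
      by (rule bij_betw_byWitness[where f' = "\<lambda>y. y \<otimes> x"])
         (use x a b in \<open>auto simp: word_simps\<close>)
  qed
  have "card K = (\<Sum>z\<in>h ` K. card {y \<in> K. h y = z})"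
    using sum.image_gen[OF assms(3), of "\<lambda>_. 1::nat" h] by simp
  also have "\<dots> = (\<Sum>z\<in>h ` K. card N)"
    by (rule sum.cong) (use fib in auto)
  finally show ?thesis by simp
qed

section \<open>Orders and central elements in p-groups\<close>

locale p_group = group +
  fixes p :: nat
  assumes prime: "Factorial_Ring.prime p" and order_pow: "\<exists>n. order G = p ^ n"
begin

lemma p_gt_1: "p > 1"
  using prime by (rule prime_gt_1_nat)

lemma p_pos: "p > 0"
  using p_gt_1 by simp

lemma finite_carrier: "finite (carrier G)"
  using order_pow order_gt_0_iff_finite p_gt_1 by (metis less_trans power_eq_0_iff zero_less_one not_gr_zero less_numeral_extra(3))

lemma finite_subset: "K \<subseteq> carrier G \<Longrightarrow> finite K"
  using finite_carrier by (rule rev_finite_subset)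

lemma subgroup_finite: "subgroup K G \<Longrightarrow> finite K"
  using finite_subset subgroup.subset by blast

lemma card_subgroup_pos: "subgroup K G \<Longrightarrow> card K > 0"
  using subgroup.finite_imp_card_positive finite_carrier by blast

lemma card_subgroup: "subgroup K G \<Longrightarrow> \<exists>k. card K = p ^ k"
proof -
  assume "subgroup K G"
  then have "card K dvd order G" by (metis dvd_triv_right lagrange)
  then show ?thesis using order_pow prime divides_primepow_nat by metis
qed

lemma power_lt_mult_le: "p ^ i < p ^ j \<Longrightarrow> p * p ^ i \<le> p ^ j"
  using p_gt_1 by (metis Suc_leI power_Suc power_increasing power_strict_increasing_iff less_imp_le_nat)

lemma card_psubset:
  assumes "subgroup A G" "subgroup B G" "A \<subset> B"
  shows "p * card A \<le> card B"
  using card_subgroup[OF assms(1)] card_subgroup[OF assms(2)]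
    psubset_card_mono[OF subgroup_finite[OF assms(2)] assms(3)] power_lt_mult_le by metis

lemma subgroup_p_group: "subgroup K G \<Longrightarrow> p_group (G\<lparr>carrier := K\<rparr>) p"
  using card_subgroup subgroup_imp_group prime
  by (auto simp: p_group_def p_group_axioms_def order_def)

lemma quotient_p_group:
  assumes "N \<lhd> G"
  shows "p_group (G Mod N) p"
proof -
  have "order (G Mod N) * card N = order G"
    using lagrange[OF normal_imp_subgroup[OF assms]] by (simp add: order_def FactGroup_def)
  then have "order (G Mod N) dvd order G" by (metis dvd_triv_left)
  then have "\<exists>k. order (G Mod N) = p ^ k"
    using order_pow prime divides_primepow_nat by metis
  then show ?thesis
    using normal.factorgroup_is_group[OF assms] prime by (auto simp: p_group_def p_group_axioms_def)
qed

text \<open>Class equation: without a central element other than 1, every conjugacy class except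
  that of 1 has size divisible by p, and so does the group, which is impossible for the remaining
  summand 1.\<close>

lemma center_nontrivial:
  assumes "carrier G \<noteq> {\<one>}"
  shows "\<exists>z\<in>carrier G. z \<noteq> \<one> \<and> (\<forall>g\<in>carrier G. commutator G z g = \<one>)"
proof (rule ccontr)
  assume non: "\<not> ?thesis"
  define \<phi> where "\<phi> = (\<lambda>g. (\<lambda>h \<in> carrier G. g \<otimes> h \<otimes> (inv g)))"
  interpret act: group_action G "carrier G" \<phi>
    unfolding \<phi>_def by (rule action_by_conjugation)
  let ?O = "orbits G (carrier G) \<phi>"
  have finO: "finite ?O"
    using finite_carrier act.orbits_coverture by (metis finite_UnionD)
  have orb: "orbit G \<phi> x = (\<lambda>g. g \<otimes> x \<otimes> inv g) ` carrier G" if "x \<in> carrier G" for x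
    using that by (auto simp: orbit_def \<phi>_def)
  have one: "orbit G \<phi> \<one> = {\<one>}"
    using orb[OF one_closed] by auto
  have one_in: "{\<one>} \<in> ?O"
    unfolding orbits_def using one by (auto intro!: exI[of _ \<one>])
  have dvd: "p dvd card o'" if o': "o' \<in> ?O - {{\<one>}}" for o'
  proof -
    obtain x where x: "x \<in> carrier G" "o' = orbit G \<phi> x"
      using o' by (auto simp: orbits_def)
    have "x \<noteq> \<one>" using x o' one by auto
    then obtain g where g: "g \<in> carrier G" "commutator G x g \<noteq> \<one>" using non x by blast
    then have "g \<otimes> x \<noteq> x \<otimes> g" using commutator_eq_one_iff x by metis
    then have ne: "g \<otimes> x \<otimes> inv g \<noteq> x" using g x by (metis inv_solve_right m_closed)
    have "x \<in> o'" "g \<otimes> x \<otimes> inv g \<in> o'"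
      using x g orb[OF x(1)] by (auto intro!: image_eqI[of _ _ \<one>])
    moreover have "finite o'" using x orb finite_carrier by simp
    ultimately have "card o' \<noteq> 1" using ne by (metis card_1_singletonE singletonD)
    moreover have "card o' dvd order G"
      using act.orbit_stabilizer_theorem[OF x(1)] x by (metis dvd_triv_left)
    then obtain k where "card o' = p ^ k"
      using order_pow prime divides_primepow_nat by metis
    ultimately show ?thesis by (cases k) auto
  qed
  have "card (carrier G) = (\<Sum>o'\<in>?O. card o')"
    using act.disjoint_sum[OF finite_carrier, of "\<lambda>_. 1::nat"] by simp
  also have "\<dots> = 1 + (\<Sum>o'\<in>?O - {{\<one>}}. card o')"
    using sum.remove[OF finO one_in, of card] by simp
  finally have eq: "card (carrier G) = 1 + (\<Sum>o'\<in>?O - {{\<one>}}. card o')" .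
  have "p dvd (\<Sum>o'\<in>?O - {{\<one>}}. card o')" by (rule dvd_sum) (rule dvd)
  moreover have "p dvd card (carrier G)"
  proof -
    obtain n where n: "order G = p ^ n" using order_pow by blast
    have "n \<noteq> 0" using n assms order_one_triv_iff by auto
    then show ?thesis using n by (simp add: order_def dvd_power)
  qed
  ultimately have "p dvd 1" using eq by (metis dvd_add_left_iff)
  then show False using p_gt_1 by simp
qed

lemma center_mod_nontrivial:
  assumes M: "M \<lhd> G" and ne: "M \<noteq> carrier G"
  shows "\<exists>x\<in>carrier G - M. \<forall>g\<in>carrier G. commutator G x g \<in> M"
proof -
  obtain Q :: "'a set monoid" and h where Q: "Q = G Mod M" and hom: "group_hom G Q h"
    and surj: "h ` carrier G = carrier Q"
    and ker: "\<And>x. x \<in> carrier G \<Longrightarrow> h x = \<one>\<^bsub>Q\<^esub> \<longleftrightarrow> x \<in> M"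
    by (rule normal_quotientE[OF M]) (rule that)
  interpret h: group_hom G Q h by fact
  interpret Q: p_group Q p unfolding Q by (rule quotient_p_group[OF M])
  obtain y where "y \<in> carrier G" "y \<notin> M"
    using ne normal_imp_subgroup[OF M] subgroup.subset by blast
  then have "h y \<in> carrier Q" "h y \<noteq> \<one>\<^bsub>Q\<^esub>" using ker by auto
  then obtain z where z: "z \<in> carrier Q" "z \<noteq> \<one>\<^bsub>Q\<^esub>" "\<forall>g\<in>carrier Q. commutator Q z g = \<one>\<^bsub>Q\<^esub>"
    using Q.center_nontrivial by blast
  then obtain x where x: "x \<in> carrier G" "z = h x" using surj by (metis imageE)
  then have "x \<notin> M" using z ker by blast
  moreover have "commutator G x g \<in> M" if g: "g \<in> carrier G" for g
  proof -
    have "h (commutator G x g) = \<one>\<^bsub>Q\<^esub>" using z x g by (simp add: h.hom_commutator)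
    then show ?thesis using ker x g by simp
  qed
  ultimately show ?thesis using x by blast
qed

lemma generate_insert_central_normal:
  assumes M: "M \<lhd> G" and x: "x \<in> carrier G" and cen: "\<And>g. g \<in> carrier G \<Longrightarrow> commutator G x g \<in> M"
  shows "generate G (insert x M) \<lhd> G"
proof -
  interpret M: normal M G by fact
  have S: "insert x M \<subseteq> carrier G" using x M.subset by auto
  have inc: "M \<subseteq> generate G (insert x M)" by (auto intro: generate.incl)
  show ?thesis
  proof (rule normalI_commutator[OF generate_is_subgroup[OF S]])
    fix g k assume g: "g \<in> carrier G" and k: "k \<in> generate G (insert x M)"
    have "commutator G k g \<in> M"
    proof (rule commutator_generate_mem[OF M S subset_refl _ k])
      fix s t assume "s \<in> insert x M" "t \<in> carrier G"
      then show "commutator G s t \<in> M"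
        using cen[of t] commutator_in_normal(1)[OF M, of s t] by blast
    qed (use g in \<open>auto intro: generate.incl\<close>)
    then have "inv (commutator G k g) \<in> M" by (rule M.m_inv_closed)
    then show "commutator G g k \<in> generate G (insert x M)"
      using inc g k generate_incl[OF S] by (auto simp: inv_commutator subset_iff)
  qed
qed

text \<open>The substitute for nilpotency: a normal subgroup not containing \<open>N\<close> which is maximal with
  this property contains \<open>[N, G]\<close>.\<close>

lemma central_step:
  assumes M0: "M0 \<lhd> G" and N: "N \<subseteq> carrier G" "\<not> N \<subseteq> M0"
  obtains M where "M \<lhd> G" "M0 \<subseteq> M" "\<not> N \<subseteq> M"
    "\<And>x g. x \<in> N \<Longrightarrow> g \<in> carrier G \<Longrightarrow> commutator G x g \<in> M"
proof -
  let ?P = "\<lambda>M. M \<lhd> G \<and> M0 \<subseteq> M \<and> \<not> N \<subseteq> M"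
  have bound: "\<forall>M. ?P M \<longrightarrow> card M < card (carrier G) + 1"
    using finite_carrier normal_imp_subgroup subgroup.subset
    by (metis card_mono less_add_one order_le_less_trans)
  obtain M where PM: "?P M" and max: "\<And>M'. ?P M' \<Longrightarrow> card M' \<le> card M"
    using ex_has_greatest_nat[of ?P M0 card "card (carrier G) + 1"] M0 N bound by auto
  have M: "M \<lhd> G" and subM: "subgroup M G" using PM normal_imp_subgroup by blast+
  have "M \<noteq> carrier G" using PM N by blast
  then obtain x where x: "x \<in> carrier G" "x \<notin> M" and cen: "\<And>g. g \<in> carrier G \<Longrightarrow> commutator G x g \<in> M"
    using center_mod_nontrivial[OF M] by blast
  let ?K = "generate G (insert x M)"
  have S: "insert x M \<subseteq> carrier G" using x subgroup.subset[OF subM] by auto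
  have K: "?K \<lhd> G" by (rule generate_insert_central_normal[OF M x(1) cen])
  have "M \<subset> ?K" using x by (auto intro: generate.incl)
  then have "card M < card ?K"
    by (rule psubset_card_mono[OF subgroup_finite[OF normal_imp_subgroup[OF K]]])
  then have "\<not> ?P ?K" using max by fastforce
  \<comment> \<open>M was maximal among the normal subgroups over \<open>M0\<close> not containing
    N, so adjoining the element x, central modulo M, already captures N. Thus N is central modulo
    M.\<close>
  then have NK: "N \<subseteq> ?K" using K PM \<open>M \<subset> ?K\<close> by blast
  show thesis
  proof (rule that[OF M])
    fix y g assume "y \<in> N" "g \<in> carrier G"
    then have "y \<in> ?K" "g \<in> generate G (carrier G)" using NK by (auto intro: generate.incl)
    then show "commutator G y g \<in> M"
    proof (rule commutator_generate_mem[OF M S subset_refl, rotated])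
      fix s t assume "s \<in> insert x M" "t \<in> carrier G"
      then show "commutator G s t \<in> M"
        using cen[of t] commutator_in_normal(1)[OF M, of s t] by blast
    qed
  qed (use PM in auto)
qed

text \<open>Otherwise some normal M over \<open>M0\<close> contains [N, G] but not N, and then M
  contains the generated group, hence N. This is the form in which nilpotency is used: [N, G]
  consists of non-generators of N.\<close>

lemma le_normal_if_commutator_le:
  assumes M0: "M0 \<lhd> G" and N: "N \<subseteq> carrier G" "N \<subseteq> generate G (M0 \<union> commutator_subgroup G N (carrier G))"
  shows "N \<subseteq> M0"
proof (rule ccontr)
  assume "\<not> N \<subseteq> M0"
  from central_step[OF M0 N(1) this] obtain M where M: "M \<lhd> G" "M0 \<subseteq> M" "\<not> N \<subseteq> M"
    and "\<And>x g. x \<in> N \<Longrightarrow> g \<in> carrier G \<Longrightarrow> commutator G x g \<in> M" by blast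
  then have "commutator_subgroup G N (carrier G) \<subseteq> M"
    using commutator_subgroup_leI normal_imp_subgroup by blast
  then have "generate G (M0 \<union> commutator_subgroup G N (carrier G)) \<subseteq> M"
    using M normal_imp_subgroup by (intro generate_subgroup_incl) auto
  then show False using M N by blast
qed

section \<open>Maximal subgroups are normal of index p\<close>

lemma maximal_subgroup_generate:
  assumes "maximal_subgroup H G" "x \<in> carrier G" "x \<notin> H"
  shows "generate G (insert x H) = carrier G"
proof -
  have "subgroup H G" using assms by (simp add: maximal_subgroup_def)
  then have "subgroup (generate G (insert x H)) G"
    using assms subgroup.subset by (intro generate_is_subgroup) auto
  moreover have "H \<subseteq> generate G (insert x H)" "x \<in> generate G (insert x H)"
    by (auto intro: generate.incl)
  ultimately show ?thesis using assms by (auto simp: maximal_subgroup_def)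
qed

text \<open>Let M be a largest normal subgroup of G inside H and x central modulo M but outside M.
  By maximality of M, x is not in H, so G is generated by x and H; and x normalizes H since [x, H]
  \<le> M \<le> H.\<close>

lemma maximal_subgroup_normal:
  assumes max: "maximal_subgroup H G"
  shows "H \<lhd> G"
proof -
  have H: "subgroup H G" "H \<noteq> carrier G" using max by (auto simp: maximal_subgroup_def)
  interpret H: subgroup H G by (rule H)
  let ?P = "\<lambda>M. M \<lhd> G \<and> M \<subseteq> H"
  have "?P {\<one>}" using one_is_normal H.one_closed by auto
  moreover have "\<forall>M. ?P M \<longrightarrow> card M < card H + 1"
    using card_mono[OF subgroup_finite[OF H(1)]] by (metis less_add_one order_le_less_trans)
  ultimately obtain M where M: "M \<lhd> G" "M \<subseteq> H" and maxM: "\<And>M'. ?P M' \<Longrightarrow> card M' \<le> card M"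
    using ex_has_greatest_nat[of ?P "{\<one>}" card "card H + 1"] by auto
  have "M \<noteq> carrier G" using M H H.subset by blast
  then obtain x where x: "x \<in> carrier G" "x \<notin> M" and cen: "\<And>g. g \<in> carrier G \<Longrightarrow> commutator G x g \<in> M"
    using center_mod_nontrivial[OF M(1)] by blast
  have K: "generate G (insert x M) \<lhd> G"
    by (rule generate_insert_central_normal[OF M(1) x(1) cen])
  have "M \<subset> generate G (insert x M)" using x by (auto intro: generate.incl)
  then have "card M < card (generate G (insert x M))"
    by (rule psubset_card_mono[OF subgroup_finite[OF normal_imp_subgroup[OF K]]])
  then have "\<not> generate G (insert x M) \<subseteq> H" using maxM K by fastforce
  then have xH: "x \<notin> H" using generate_subgroup_incl[OF _ H(1), of "insert x M"] M by blast
  have conj: "g \<otimes> k \<otimes> inv g \<in> H" if "g \<in> generate G (insert x H)" "k \<in> H" for g k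
    using that
  proof (induction g arbitrary: k rule: generate.induct)
    case (incl g)
    show ?case
    proof (cases "g = x")
      case True
      then show ?thesis using x incl cen[of k] M conj_eq_commutator_mult[of x k] by auto
    qed (use incl in auto)
  next
    case (inv g)
    show ?case
    proof (cases "g = x")
      case True
      have "inv x \<in> centralizer_mod M (carrier G)"
        using subgroup.m_inv_closed[OF centralizer_mod_subgroup[OF M(1)], of "carrier G" x] x cen
        by (auto simp: centralizer_mod_def)
      then have "commutator G (inv x) k \<in> M" using inv by (auto simp: centralizer_mod_def)
      then show ?thesis using True x inv M conj_eq_commutator_mult[of "inv x" k] by auto
    qed (use inv in auto)
  next
    case (eng g1 g2)
    have car: "g1 \<in> carrier G" "g2 \<in> carrier G"
      using eng.hyps generate_in_carrier[of "insert x H"] x H.subset by auto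
    have "g1 \<otimes> g2 \<otimes> k \<otimes> inv (g1 \<otimes> g2) = g1 \<otimes> (g2 \<otimes> k \<otimes> inv g2) \<otimes> inv g1"
      using car eng.prems by (simp add: word_simps)
    then show ?case using eng by simp
  qed auto
  show ?thesis
    using conj maximal_subgroup_generate[OF max x(1) xH] by (intro normal_invI[OF H(1)]) auto
qed

text \<open>G is generated by H and an element central modulo H, so G/H is abelian.\<close>

lemma maximal_subgroup_derived_le:
  assumes max: "maximal_subgroup H G"
  shows "derived G (carrier G) \<subseteq> H"
proof -
  have H: "H \<lhd> G" "H \<noteq> carrier G" "H \<subseteq> carrier G"
    using maximal_subgroup_normal[OF max] max by (auto simp: maximal_subgroup_def subgroup.subset)
  obtain x where x: "x \<in> carrier G" "x \<notin> H" and cen: "\<And>g. g \<in> carrier G \<Longrightarrow> commutator G x g \<in> H"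
    using center_mod_nontrivial[OF H(1,2)] by blast
  have "derived G (generate G (insert x H)) \<subseteq> H"
  proof (rule derived_generate_le[OF H(1)])
    show "insert x H \<subseteq> carrier G" using x H by auto
  next
    fix s t assume "s \<in> insert x H" "t \<in> insert x H"
    then show "commutator G s t \<in> H"
      using cen H commutator_in_normal[OF H(1)] x by blast
  qed
  then show ?thesis using maximal_subgroup_generate[OF max x] by simp
qed

text \<open>Bezout for i and the group order: x is a power of x^i.\<close>

lemma mem_if_power_mem:
  assumes K: "subgroup K G" and x: "x \<in> carrier G" and i: "x [^] i \<in> K" and cop: "coprime i (int p)"
  shows "x \<in> K"
proof -
  obtain n where n: "order G = p ^ n" using order_pow by blast
  have "coprime i (int p ^ n)" using cop by simp
  then obtain u v where uv: "u * i + v * int p ^ n = 1"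
    using bezout_int[of i "int p ^ n"] by (auto simp: coprime_iff_gcd_eq_1)
  have o: "x [^] int (p ^ n) = \<one>"
    using pow_order_eq_1[OF x] n by (simp only: int_pow_int)
  have "x = x [^] (i * u + int (p ^ n) * v)"
    using uv x by (simp add: mult.commute)
  also have "\<dots> = (x [^] i) [^] u \<otimes> (x [^] int (p ^ n)) [^] v"
    using x by (simp add: int_pow_mult int_pow_pow)
  also have "\<dots> \<in> K" using o subgroup_int_pow_closed[OF K i] x by simp
  finally show ?thesis .
qed

text \<open>Writing x = m x^(p i) gives x^(1 - p i) in M, and 1 - p i is prime to p. In effect x^p
  is a non-generator of the group generated by x and M.\<close>

lemma mem_if_mem_generate_power:
  assumes M: "M \<lhd> G" and x: "x \<in> carrier G" and gen: "x \<in> generate G (insert (x [^] p) M)"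
  shows "x \<in> M"
proof -
  have H: "subgroup M G" using M by (rule normal_imp_subgroup)
  obtain m i where m: "m \<in> M" "x = m \<otimes> (x [^] p) [^] (i::int)"
    using generate_insert_normal[OF M, of "x [^] p"] x gen by auto
  have "m = x [^] (1 - int p * i)"
  proof -
    have "x [^] (1::int) = m \<otimes> x [^] (int p * i)"
      using m x by (simp add: int_pow_int[symmetric] int_pow_pow)
    then have "m = x [^] (1::int) \<otimes> inv (x [^] (int p * i))"
      using m x subgroup.mem_carrier[OF H] by (metis int_pow_closed inv_solve_right)
    then show ?thesis using x by (simp add: int_pow_diff)
  qed
  moreover have "coprime (1 - int p * i) (int p)"
  proof (rule coprimeI)
    fix d assume "d dvd 1 - int p * i" "d dvd int p"
    then have "d dvd (1 - int p * i) + int p * i" by (intro dvd_add) auto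
    then show "is_unit d" by simp
  qed
  ultimately show ?thesis using mem_if_power_mem[OF H x] m by metis
qed

lemma maximal_subgroup_power_mem:
  assumes max: "maximal_subgroup H G" and x: "x \<in> carrier G"
  shows "x [^] p \<in> H"
proof (rule ccontr)
  assume non: "x [^] p \<notin> H"
  have H: "subgroup H G" using max by (auto simp: maximal_subgroup_def)
  have "x \<in> generate G (insert (x [^] p) H)"
    using maximal_subgroup_generate[OF max _ non] x by simp
  then have "x \<in> H" by (rule mem_if_mem_generate_power[OF maximal_subgroup_normal[OF max] x])
  then show False
    using non subgroup_int_pow_closed[OF H, of x "int p"] by (simp add: int_pow_int)
qed

lemma maximal_subgroup_card:
  assumes max: "maximal_subgroup H G"
  shows "p * card H = card (carrier G)"
proof (rule antisym)
  have H: "H \<lhd> G" "subgroup H G" "H \<subset> carrier G"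
    using maximal_subgroup_normal[OF max] max subgroup.subset by (auto simp: maximal_subgroup_def)
  show "p * card H \<le> card (carrier G)" by (rule card_psubset[OF H(2) subgroup_self H(3)])
  obtain x where x: "x \<in> carrier G" "x \<notin> H" using H by blast
  show "card (carrier G) \<le> p * card H"
    using card_generate_insert_le[OF H(1) x(1) maximal_subgroup_power_mem[OF max x(1)] p_pos subgroup_finite[OF H(2)]]
      maximal_subgroup_generate[OF max x] by simp
qed

text \<open>There is no room for a subgroup strictly between K and B, since strict inclusions
  multiply orders by at least p.\<close>

lemma index_p_generate:
  assumes K: "subgroup K G" and B: "subgroup B G" and "K \<subseteq> B" "card B \<le> p * card K" "x \<in> B" "x \<notin> K"
  shows "generate G (insert x K) = B"
proof -
  have S: "insert x K \<subseteq> carrier G" using assms subgroup.subset by blast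
  have le: "generate G (insert x K) \<subseteq> B" using assms by (intro generate_subgroup_incl) auto
  have "K \<subset> generate G (insert x K)" using assms by (auto intro: generate.incl)
  then have "p * card K \<le> card (generate G (insert x K))"
    by (rule card_psubset[OF K generate_is_subgroup[OF S]])
  then show ?thesis
    using le assms subgroup_finite[OF B] by (intro card_subset_eq) (auto intro: antisym card_mono)
qed

lemma maximal_subgroupI:
  assumes K: "subgroup K G" and "p * card K = card (carrier G)"
  shows "maximal_subgroup K G"
  unfolding maximal_subgroup_def
proof (intro conjI allI impI)
  show "K \<noteq> carrier G" using assms p_gt_1 card_subgroup_pos[OF K] by auto
  fix L assume L: "subgroup L G \<and> K \<subseteq> L"
  show "L = K \<or> L = carrier G"
  proof (rule disjCI)
    assume "L \<noteq> carrier G"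
    show "L = K"
    proof (rule ccontr)
      assume "L \<noteq> K"
      then have "p * card K \<le> card L" using L card_psubset K by blast
      then show False
        using L \<open>L \<noteq> carrier G\<close> assms finite_carrier psubset_card_mono[of "carrier G" L] subgroup.subset[of L G] by fastforce
    qed
  qed
qed (rule K)

end

section \<open>Generating sets of p-groups\<close>

context p_group
begin

lemma normalI_derived_le:
  assumes "subgroup K G" "derived G (carrier G) \<subseteq> K"
  shows "K \<lhd> G"
proof (rule normalI_commutator[OF assms(1)])
  fix g k assume "g \<in> carrier G" "k \<in> K"
  then show "commutator G g k \<in> K"
    using assms commutator_in_derived[of g "carrier G" k] subgroup.mem_carrier[OF assms(1)] by blast
qed

lemma maximal_subgroup_exists:
  assumes K: "subgroup K G" "K \<noteq> carrier G"
  obtains M where "maximal_subgroup M G" "K \<subseteq> M"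
proof -
  let ?P = "\<lambda>M. subgroup M G \<and> K \<subseteq> M \<and> M \<noteq> carrier G"
  have "\<forall>M. ?P M \<longrightarrow> card M < card (carrier G) + 1"
    by (metis card_mono finite_carrier less_add_one order_le_less_trans subgroup.subset)
  then obtain M where M: "?P M" and max: "\<And>M'. ?P M' \<Longrightarrow> card M' \<le> card M"
    using ex_has_greatest_nat[of ?P K card "card (carrier G) + 1"] K by auto
  have "L = M \<or> L = carrier G" if L: "subgroup L G" "M \<subseteq> L" for L
  proof (rule disjCI)
    assume "L \<noteq> carrier G"
    then have "card L \<le> card M" using M L by (intro max) auto
    then show "L = M" using L card_seteq[OF subgroup_finite[OF L(1)] L(2)] by simp
  qed
  then have "maximal_subgroup M G" using M by (simp add: maximal_subgroup_def)
  then show thesis using M that by simp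
qed

end

text \<open>The remaining property of the Frattini subgroup, to lie in every maximal subgroup, is assumed
  of \<open>N\<close> only where it is needed.\<close>

locale p_group_frattini = p_group +
  fixes N
  assumes subgroup_N: "subgroup N G" and derived_le: "derived G (carrier G) \<subseteq> N"
    and power_mem: "\<And>x. x \<in> carrier G \<Longrightarrow> x [^] p \<in> N"
begin

lemma card_generate_insert:
  assumes M: "subgroup M G" "N \<subseteq> M" and x: "x \<in> carrier G" "x \<notin> M"
  shows "card (generate G (insert x M)) = p * card M"
proof (rule antisym)
  have "M \<lhd> G" using M derived_le by (intro normalI_derived_le) auto
  then show "card (generate G (insert x M)) \<le> p * card M"
    using M x power_mem p_pos subgroup_finite by (intro card_generate_insert_le) auto
  have "subgroup (generate G (insert x M)) G"
    using M x subgroup.subset by (intro generate_is_subgroup) auto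
  then show "p * card M \<le> card (generate G (insert x M))"
    using M x by (intro card_psubset) (auto intro: generate.incl)
qed

lemma card_generate_union_le:
  assumes "finite S" "S \<subseteq> carrier G"
  shows "card (generate G (S \<union> N)) \<le> p ^ card S * card N"
  using assms
proof (induction S rule: finite_induct)
  case empty
  have "generate G N \<subseteq> N" using subgroup_N by (intro generate_subgroup_incl) auto
  then show ?case using card_mono[OF subgroup_finite[OF subgroup_N]] by simp
next
  case (insert x S)
  let ?M = "generate G (S \<union> N)"
  have SN: "S \<union> N \<subseteq> carrier G" using insert subgroup.subset[OF subgroup_N] by auto
  have M: "subgroup ?M G" "N \<subseteq> ?M"
    using generate_is_subgroup[OF SN] by (auto intro: generate.incl)
  have x: "insert x ?M \<subseteq> carrier G" using insert.prems generate_incl[OF SN] by auto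
  have "generate G (insert x S \<union> N) \<subseteq> generate G (insert x ?M)"
    by (rule mono_generate) (auto intro: generate.incl)
  then have "card (generate G (insert x S \<union> N)) \<le> card (generate G (insert x ?M))"
    using finite_subset[OF generate_incl[OF x]] by (rule card_mono[rotated])
  also have "\<dots> \<le> p * card ?M"
  proof (cases "x \<in> ?M")
    case True
    then have "generate G (insert x ?M) \<subseteq> ?M" using M by (intro generate_subgroup_incl) auto
    then have "card (generate G (insert x ?M)) \<le> card ?M"
      by (rule card_mono[OF subgroup_finite[OF M(1)]])
    also have "\<dots> \<le> p * card ?M" using p_pos by simp
    finally show ?thesis .
  next
    case False
    then show ?thesis using card_generate_insert[OF M] insert.prems by simp
  qed
  also have "\<dots> \<le> p * (p ^ card S * card N)"
    using insert by (intro mult_le_mono) auto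
  finally show ?case using insert by simp
qed

lemma generating_set_exists:
  assumes "subgroup L G" "N \<subseteq> L" "p ^ k * card L = card (carrier G)"
  shows "\<exists>S. finite S \<and> S \<subseteq> carrier G \<and> card S \<le> k \<and> generate G (S \<union> L) = carrier G"
  using assms
proof (induction k arbitrary: L)
  case 0
  then have "L = carrier G"
    using subgroup.subset finite_carrier by (intro card_subset_eq) auto
  then have "generate G ({} \<union> L) = carrier G"
    using generate_incl[of L] by (auto intro: generate.incl)
  then show ?case by (intro exI[of _ "{}"]) simp
next
  case (Suc k)
  have "card L \<noteq> card (carrier G)"
  proof
    assume "card L = card (carrier G)"
    then have "p ^ Suc k = 1" using Suc.prems card_subgroup_pos[OF Suc.prems(1)] by simp
    then show False using p_gt_1 by simp
  qed
  then have "L \<noteq> carrier G" by auto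
  then obtain x where x: "x \<in> carrier G" "x \<notin> L"
    using subgroup.subset[OF Suc.prems(1)] by blast
  let ?L = "generate G (insert x L)"
  have xL: "insert x L \<subseteq> carrier G" using x subgroup.subset[OF Suc.prems(1)] by auto
  have "N \<subseteq> ?L" using Suc.prems by (auto intro: generate.incl)
  moreover have "p ^ k * card ?L = card (carrier G)"
    using card_generate_insert[OF Suc.prems(1,2) x] Suc.prems by (simp add: mult_ac)
  ultimately obtain S where S: "finite S" "S \<subseteq> carrier G" "card S \<le> k" "generate G (S \<union> ?L) = carrier G"
    using Suc.IH[OF generate_is_subgroup[OF xL]] by blast
  have xSL: "insert x S \<union> L \<subseteq> carrier G" using xL S by auto
  have "?L \<subseteq> generate G (insert x S \<union> L)" by (rule mono_generate) auto
  then have "generate G (S \<union> ?L) \<subseteq> generate G (insert x S \<union> L)"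
    by (intro generate_subgroup_incl[OF _ generate_is_subgroup[OF xSL]]) (auto intro: generate.incl)
  then have "generate G (insert x S \<union> L) = carrier G"
    using S generate_incl[OF xSL] by auto
  then show ?case using S x by (intro exI[of _ "insert x S"]) (auto simp: card_insert_if)
qed

lemma generate_eq_carrier:
  assumes frat: "\<And>M. maximal_subgroup M G \<Longrightarrow> N \<subseteq> M"
    and S: "S \<subseteq> carrier G" "generate G (S \<union> N) = carrier G"
  shows "generate G S = carrier G"
proof (rule ccontr)
  assume "generate G S \<noteq> carrier G"
  then obtain M where M: "maximal_subgroup M G" "generate G S \<subseteq> M"
    using maximal_subgroup_exists[OF generate_is_subgroup[OF S(1)]] by blast
  have "subgroup M G" "M \<noteq> carrier G" using M by (auto simp: maximal_subgroup_def)
  moreover have "S \<union> N \<subseteq> M" using M frat by (auto intro: generate.incl)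
  ultimately have "generate G (S \<union> N) \<subseteq> M" by (intro generate_subgroup_incl)
  then show False using S \<open>subgroup M G\<close> \<open>M \<noteq> carrier G\<close> subgroup.subset by blast
qed

text \<open>Modulo N every further generator multiplies the order by at most p. This half of the
  Burnside basis theorem is what the lower bound on generators in (f) rests on.\<close>

lemma card_le_min_gens:
  "card (carrier G) \<le> p ^ min_gens G * card N"
proof -
  have "\<exists>n S. S \<subseteq> carrier G \<and> finite S \<and> card S = n \<and> generate G S = carrier G"
    using finite_carrier generate_incl[of "carrier G"] by (auto intro!: exI[of _ "carrier G"] generate.incl)
  then have "\<exists>S. S \<subseteq> carrier G \<and> finite S \<and> card S = min_gens G \<and> generate G S = carrier G"
    unfolding min_gens_def by (rule LeastI_ex)
  then obtain S where S: "S \<subseteq> carrier G" "finite S" "card S = min_gens G" "generate G S = carrier G"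
    by blast
  have "carrier G \<subseteq> generate G (S \<union> N)" using S(4) mono_generate[of S "S \<union> N"] by auto
  moreover have "finite (generate G (S \<union> N))"
    using S subgroup.subset[OF subgroup_N] by (intro finite_subset generate_incl) auto
  ultimately have "card (carrier G) \<le> card (generate G (S \<union> N))" by (rule card_mono[rotated])
  then show ?thesis using card_generate_union_le[OF S(2,1)] S(3) by simp
qed

text \<open>Burnside basis theorem: a basis of the elementary abelian quotient by N lifts to a
  generating set, because N consists of non-generators.\<close>

lemma min_gens_card:
  assumes frat: "\<And>M. maximal_subgroup M G \<Longrightarrow> N \<subseteq> M"
  shows "p ^ min_gens G * card N = card (carrier G)"
proof -
  obtain a b where ab: "card (carrier G) = p ^ a" "card N = p ^ b"
    using card_subgroup subgroup_self subgroup_N by metis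
  have "p ^ b \<le> p ^ a"
    using ab card_mono[OF finite_carrier subgroup.subset[OF subgroup_N]] by simp
  then have "b \<le> a" using p_gt_1 by simp
  define k where "k = a - b"
  have k: "p ^ k * card N = card (carrier G)" using ab \<open>b \<le> a\<close> by (simp add: k_def power_add[symmetric])
  obtain S where S: "finite S" "S \<subseteq> carrier G" "card S \<le> k" "generate G (S \<union> N) = carrier G"
    using generating_set_exists[OF subgroup_N _ k] by blast
  have "generate G S = carrier G" by (rule generate_eq_carrier[OF frat S(2,4)])
  then have "min_gens G \<le> card S" unfolding min_gens_def using S by (intro Least_le) blast
  then have le: "min_gens G \<le> k" using S by simp
  have "p ^ k \<le> p ^ min_gens G"
    using card_le_min_gens k card_subgroup_pos[OF subgroup_N] by (metis mult_le_cancel2)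
  then have "k \<le> min_gens G" using p_gt_1 by simp
  then show ?thesis using le k by simp
qed

text \<open>For x outside N take M over N maximal with x not in M. Adjoining any y outside M brings
  in x and multiplies the order by p, just as adjoining x does; so both adjunctions give the same
  group, which is therefore all of G, and M is a maximal subgroup missing x.\<close>

lemma frattini_le: "frattini G \<subseteq> N"
proof (rule ccontr)
  assume "\<not> frattini G \<subseteq> N"
  then obtain x where x: "x \<in> frattini G" "x \<notin> N" by blast
  have xG: "x \<in> carrier G" using x by (simp add: frattini_def)
  let ?P = "\<lambda>M. subgroup M G \<and> N \<subseteq> M \<and> x \<notin> M"
  have "\<forall>M. ?P M \<longrightarrow> card M < card (carrier G) + 1"
    by (metis card_mono finite_carrier less_add_one order_le_less_trans subgroup.subset)
  then obtain M where PM: "?P M" and max: "\<And>M'. ?P M' \<Longrightarrow> card M' \<le> card M"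
    using ex_has_greatest_nat[of ?P N card "card (carrier G) + 1"] x subgroup_N by auto
  then have M: "subgroup M G" "N \<subseteq> M" "x \<notin> M" by auto
  have "y \<in> generate G (insert x M)" if y: "y \<in> carrier G" for y
  proof (cases "y \<in> M")
    case True
    then show ?thesis by (auto intro: generate.incl)
  next
    case False
    let ?Y = "generate G (insert y M)" and ?X = "generate G (insert x M)"
    have sub: "insert y M \<subseteq> carrier G" using M y subgroup.subset by auto
    have cY: "card ?Y = p * card M" by (rule card_generate_insert[OF M(1,2) y False])
    have Y: "subgroup ?Y G" "M \<subseteq> ?Y" using generate_is_subgroup[OF sub] by (auto intro: generate.incl)
    have "x \<in> ?Y"
    proof (rule ccontr)
      assume "x \<notin> ?Y"
      then have "card ?Y \<le> card M" using Y M by (intro max) auto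
      then show False using cY p_gt_1 card_subgroup_pos[OF M(1)] by simp
    qed
    then have "?X \<subseteq> ?Y" using Y by (intro generate_subgroup_incl) auto
    moreover have "card ?X = card ?Y" using cY card_generate_insert[OF M(1,2) xG M(3)] by simp
    ultimately have "?X = ?Y" using card_subset_eq[OF subgroup_finite[OF Y(1)]] by blast
    then show ?thesis by (auto intro: generate.incl)
  qed
  moreover have "generate G (insert x M) \<subseteq> carrier G"
    using xG subgroup.subset[OF M(1)] by (intro generate_incl) auto
  ultimately have "generate G (insert x M) = carrier G" by blast
  then have "p * card M = card (carrier G)" using card_generate_insert[OF M(1,2) xG M(3)] by simp
  then have "maximal_subgroup M G" by (rule maximal_subgroupI[OF M(1)])
  then show False using x M by (auto simp: frattini_def)
qed

end

section \<open>Abelian p-groups with a unipotent operator\<close>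

text \<open>The inner binomial coefficients are divisible by p, and the coefficient of X is exactly
  p. Hence the cofactor of p X has constant term 1, which is what makes it cancellable for nilpotent
  t.\<close>

lemma prime_power_linear_poly:
  assumes p: "Factorial_Ring.prime (p::nat)"
  shows "\<exists>v. [:1, 1:] ^ p = (1 :: int poly) + Polynomial.monom 1 p + Polynomial.smult (int p) ([:0, 1:] * (1 + [:0, 1:] * v))"
proof -
  have p1: "p > 1" using p by (rule prime_gt_1_nat)
  \<comment> \<open>The shift by 2 comes from the two factors X in front of v: the terms with k = 0,
    1 and p are split off.\<close>
  define v :: "int poly" where "v = (\<Sum>k\<in>{2..<p}. Polynomial.monom (int ((p choose k) div p)) (k - 2))"
  have cv: "Polynomial.coeff v i = (if i + 2 < p then int ((p choose (i + 2)) div p) else 0)" for i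
  proof -
    have "Polynomial.coeff v i = (\<Sum>k\<in>{2..<p}. if k = i + 2 then int ((p choose k) div p) else 0)"
      unfolding v_def Polynomial.coeff_sum by (rule sum.cong) auto
    also have "\<dots> = (if i + 2 < p then int ((p choose (i + 2)) div p) else 0)"
      by (simp add: sum.delta)
    finally show ?thesis .
  qed
  have "Polynomial.coeff ([:1, 1:] ^ p :: int poly) i =
    Polynomial.coeff (1 + Polynomial.monom 1 p + Polynomial.smult (int p) ([:0, 1:] * (1 + [:0, 1:] * v))) i" for i
  proof -
    have l: "Polynomial.coeff ([:1, 1:] ^ p :: int poly) i = int (p choose i)"
    proof (cases "i \<le> p")
      case True
      then show ?thesis using coeff_linear_poly_power[of i p 1 "1::int"] by simp
    next
      case False
      then have "Polynomial.degree ([:1, 1:] ^ p :: int poly) < i"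
        using degree_power_le[of "[:1, 1:] :: int poly" p] by simp
      then show ?thesis using False by (simp add: coeff_eq_0 binomial_eq_0)
    qed
    consider "i = 0" | "i = 1" | j where "i = j + 2" "i < p" | "i = p" "i \<ge> 2" | "i > p"
      using p1 by (metis One_nat_def Suc_1 add_2_eq_Suc' less_2_cases_iff le_Suc_ex linorder_neqE_nat not_less add.commute)
    then show ?thesis
    proof cases
      case (3 j)
      have "p dvd (p choose i)" using 3 p by (intro dvd_choose_prime) auto
      then have "int p * int ((p choose i) div p) = int (p choose i)"
        by (metis dvd_mult_div_cancel of_nat_mult)
      then show ?thesis using 3 l cv[of j] by (simp add: coeff_pCons numeral_2_eq_2)
    next
      case 4
      then obtain j where "i = Suc (Suc j)" by (metis add_2_eq_Suc le_Suc_ex)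
      then show ?thesis using 4 l cv[of j] by (simp add: coeff_pCons)
    next
      case 5
      then obtain j where "i = Suc (Suc j)" using p1 by (metis add_2_eq_Suc le_Suc_ex Suc_1 Suc_leI less_trans)
      then show ?thesis using 5 l cv[of j] by (simp add: coeff_pCons)
    qed (use l p1 in \<open>simp_all add: coeff_pCons\<close>)
  qed
  then show ?thesis by (intro exI[of _ v] poly_eqI)
qed

text \<open>The \<open>\<int>[X]\<close>-module structure in which \<open>X\<close> acts as \<open>t\<close>.\<close>

definition poly_act :: "('a, 'b) monoid_scheme \<Rightarrow> ('a \<Rightarrow> 'a) \<Rightarrow> int poly \<Rightarrow> 'a \<Rightarrow> 'a" where
  "poly_act G t f a = fold_coeffs (\<lambda>c y. a [^]\<^bsub>G\<^esub> c \<otimes>\<^bsub>G\<^esub> t y) f \<one>\<^bsub>G\<^esub>"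

locale comm_group_endo = comm_group G for G (structure) +
  fixes t assumes endo: "t \<in> hom G G"
begin

lemma t_closed [simp, intro]: "a \<in> carrier G \<Longrightarrow> t a \<in> carrier G"
  using endo by (rule hom_in_carrier)

lemma t_hom: "group_hom G G t"
  using endo by (simp add: group_hom_def group_hom_axioms_def)

lemma t_mult [simp]: "a \<in> carrier G \<Longrightarrow> b \<in> carrier G \<Longrightarrow> t (a \<otimes> b) = t a \<otimes> t b"
  using endo by (rule hom_mult)

lemma t_one [simp]: "t \<one> = \<one>"
  using endo by (simp add: hom_one)

lemma t_inv: "a \<in> carrier G \<Longrightarrow> t (inv a) = inv t a"
  using group_hom.hom_inv[OF t_hom] by simp

lemma t_int_pow: "a \<in> carrier G \<Longrightarrow> t (a [^] (k::int)) = t a [^] k"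
  using group_hom.hom_int_pow[OF t_hom] by simp

abbreviation "act \<equiv> poly_act G t"

lemma act_0 [simp]: "act 0 a = \<one>"
  by (simp add: poly_act_def)

lemma act_pCons [simp]: "a \<in> carrier G \<Longrightarrow> act (pCons c f) a = a [^] c \<otimes> t (act f a)"
  by (cases "c = 0 \<and> f = 0") (auto simp: poly_act_def)

lemma act_closed [simp, intro]: "a \<in> carrier G \<Longrightarrow> act f a \<in> carrier G"
  by (induction f) auto

lemma act_1 [simp]: "a \<in> carrier G \<Longrightarrow> act 1 a = a"
  by (simp add: one_pCons)

lemma act_add: "a \<in> carrier G \<Longrightarrow> act (f + g) a = act f a \<otimes> act g a"
  by (induction f g rule: poly_induct2) (simp_all add: int_pow_mult m_ac)

lemma act_smult: "a \<in> carrier G \<Longrightarrow> act (Polynomial.smult c f) a = act f a [^] c"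
  by (induction f) (simp_all add: int_pow_distrib int_pow_pow t_int_pow mult.commute)

lemma act_uminus: "a \<in> carrier G \<Longrightarrow> act (- f) a = inv act f a"
  by (induction f) (simp_all add: int_pow_neg inv_mult t_inv)

lemma act_mult: "a \<in> carrier G \<Longrightarrow> act (f * g) a = act f (act g a)"
  by (induction f) (simp_all add: act_add act_smult)

lemma act_hom: "a \<in> carrier G \<Longrightarrow> b \<in> carrier G \<Longrightarrow> act f (a \<otimes> b) = act f a \<otimes> act f b"
  by (induction f) (simp_all add: int_pow_distrib m_ac)

lemma act_int_pow: "a \<in> carrier G \<Longrightarrow> act f (a [^] (c::int)) = act f a [^] c"
  by (induction f) (simp_all add: int_pow_distrib int_pow_pow t_int_pow mult.commute)

lemma t_funpow_closed [simp, intro]: "a \<in> carrier G \<Longrightarrow> (t ^^ k) a \<in> carrier G"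
  by (induction k) auto

lemma act_monom: "a \<in> carrier G \<Longrightarrow> act (Polynomial.monom 1 k) a = (t ^^ k) a"
  by (induction k) (simp_all add: monom_0 monom_Suc)

lemma act_invariant:
  assumes B: "subgroup B G" "t ` B \<subseteq> B" and b: "b \<in> B"
  shows "act f b \<in> B"
proof (induction f)
  case (pCons c f)
  then show ?case
    using B b subgroup.mem_carrier[OF B(1) b] subgroup_int_pow_closed[OF B(1) b]
    by (auto intro!: subgroup.m_closed[OF B(1)])
qed (use subgroup.one_closed[OF B(1)] in auto)

section \<open>The chain of images of the powers of t\<close>

definition filt :: "nat \<Rightarrow> 'a set" where "filt i = (t ^^ i) ` carrier G"

lemma filt_0: "filt 0 = carrier G"
  by (simp add: filt_def)

lemma filt_Suc: "filt (Suc i) = t ` filt i"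
  by (simp add: filt_def image_comp comp_def)

lemma filt_add: "filt (i + k) = (t ^^ k) ` filt i"
  by (simp add: filt_def image_comp funpow_add[symmetric] add.commute)

lemma filt_subgroup: "subgroup (filt i) G"
  by (induction i) (simp_all add: filt_0 filt_Suc subgroup_self group_hom.subgroup_img_is_subgroup[OF t_hom])

lemma filt_subset: "filt i \<subseteq> carrier G"
  by (rule subgroup.subset[OF filt_subgroup])

lemma filt_Suc_le: "filt (Suc i) \<subseteq> filt i"
proof
  fix x assume "x \<in> filt (Suc i)"
  then obtain a where "a \<in> carrier G" "x = (t ^^ i) (t a)"
    by (auto simp: filt_def funpow_swap1)
  then show "x \<in> filt i" by (auto simp: filt_def)
qed

lemma filt_antimono: "i \<le> j \<Longrightarrow> filt j \<subseteq> filt i"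
  by (induction j rule: dec_induct) (use filt_Suc_le in blast)+

lemma filt_invariant: "t ` filt i \<subseteq> filt i"
  using filt_Suc_le filt_Suc by simp

end

text \<open>Here G is the abelian group A of the overview, written multiplicatively.
  \<open>index\<close> is |A : t A| = p, and \<open>unipotent\<close> says that g^p acts trivially,
  since g acts as 1 + t.\<close>

locale cyclic_operator = comm_group_endo G t + p_group G p for G (structure) and t and p +
  assumes index: "p * card (t ` carrier G) = card (carrier G)"
    and unipotent: "\<And>a. a \<in> carrier G \<Longrightarrow> poly_act G t ([:1, 1:] ^ p) a = a"
begin

definition v :: "int poly" where
  "v = (SOME v. [:1, 1:] ^ p = (1 :: int poly) + Polynomial.monom 1 p + Polynomial.smult (int p) ([:0, 1:] * (1 + [:0, 1:] * v)))"

text \<open>The factor of p in the norm. It is 1 modulo X, so \<open>act w\<close> preserves the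
  layers of the chain; no inverse is constructed.\<close>

definition w :: "int poly" where "w = 1 + [:0, 1:] * v"

text \<open>The norm of \<open>s = 1 + t\<close>.\<close>

definition nrm :: "int poly" where
  "nrm = (\<Sum>j<p. [:1, 1:] ^ j)"

lemma unipotent_poly: "[:1, 1:] ^ p = (1 :: int poly) + Polynomial.monom 1 p + Polynomial.smult (int p) ([:0, 1:] * w)"
  unfolding w_def v_def by (rule someI_ex[OF prime_power_linear_poly[OF prime]])

lemma X_nrm: "[:0, 1:] * nrm = [:1, 1:] ^ p - 1"
proof -
  have "[:1, 1:] - 1 = ([:0, 1:] :: int poly)" by (simp add: one_pCons)
  then show ?thesis using power_diff_1_eq[of "[:1, 1:] :: int poly" p] by (simp add: nrm_def)
qed

lemma nrm_eq: "nrm = Polynomial.monom 1 (p - 1) + Polynomial.smult (int p) w"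
proof -
  have "[:0, 1:] * nrm = [:0, 1:] * (Polynomial.monom 1 (p - 1) + Polynomial.smult (int p) w)"
    unfolding X_nrm unipotent_poly using p_pos
    by (cases p) (simp_all add: monom_Suc algebra_simps)
  then show ?thesis by (subst (asm) mult_cancel_left) simp
qed

lemma act_nrm: "a \<in> carrier G \<Longrightarrow> act nrm a = (t ^^ (p - 1)) a \<otimes> act w a [^] int p"
  by (simp add: nrm_eq act_add act_monom act_smult)

text \<open>The geometric sum telescopes: X times \<open>nrm\<close> is (1 + X)^p - 1, which acts as
  zero.\<close>

lemma t_act_nrm: 
  assumes "a \<in> carrier G"
  shows "t (act nrm a) = \<one>"
proof -
  have "t (act nrm a) = act ([:0, 1:] * nrm) a"
    using assms by (simp add: act_mult)
  also have "\<dots> = act ([:1, 1:] ^ p + - 1) a"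
    unfolding X_nrm by simp
  also have "\<dots> = act ([:1, 1:] ^ p) a \<otimes> inv a"
    using assms by (simp only: act_add act_uminus act_1)
  finally show ?thesis using assms unipotent by simp
qed

lemma act_w: "a \<in> carrier G \<Longrightarrow> act w a = a \<otimes> t (act v a)"
  by (simp add: w_def act_add act_mult)

lemma t_funpow_p:
  assumes "a \<in> carrier G"
  shows "(t ^^ p) a = inv (t (act w a) [^] int p)"
proof -
  have "t (act nrm a) = (t ^^ p) a \<otimes> t (act w a) [^] int p"
    using assms p_pos by (simp add: act_nrm t_int_pow) (metis Suc_pred funpow.simps(2) o_apply)
  then have "(t ^^ p) a \<otimes> t (act w a) [^] int p = \<one>" using t_act_nrm[OF assms] by simp
  then show ?thesis using assms by (intro inv_equality[symmetric]) auto
qed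

text \<open>This is p A in additive notation.\<close>

definition pow_set :: "'a set" where "pow_set = (\<lambda>a. a [^] int p) ` carrier G"

lemma pow_set_subgroup: "subgroup pow_set G"
proof -
  have "group_hom G G (\<lambda>a. a [^] int p)"
    by (simp add: group_hom_def group_hom_axioms_def hom_def int_pow_distrib)
  from group_hom.img_is_subgroup[OF this] show ?thesis by (simp add: pow_set_def)
qed

lemma pow_set_invariant: "t ` pow_set \<subseteq> pow_set"
  by (auto simp: pow_set_def t_int_pow)

lemma filt_p_le_pow_set: "filt p \<subseteq> pow_set"
proof
  fix x assume "x \<in> filt p"
  then obtain a where "a \<in> carrier G" "x = (t ^^ p) a" by (auto simp: filt_def)
  then have "x = inv (t (act w a)) [^] int p" "inv (t (act w a)) \<in> carrier G"
    by (simp_all add: t_funpow_p int_pow_inv)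
  then show "x \<in> pow_set" by (auto simp: pow_set_def)
qed

text \<open>From t^p = -p t w, every p further applications of t yield one more factor p. With the
  exponent of G this makes t nilpotent.\<close>

lemma t_funpow_eq_power:
  assumes "a \<in> carrier G"
  shows "\<exists>b\<in>carrier G. (t ^^ (p * j)) a = b [^] (int p ^ j)"
  using assms
proof (induction j arbitrary: a)
  case 0
  then show ?case by auto
next
  case (Suc j)
  define c where "c = inv (t (act w a))"
  have c: "c \<in> carrier G" using Suc.prems by (simp add: c_def)
  have "(t ^^ p) a = c [^] int p"
    using Suc.prems by (simp add: t_funpow_p c_def int_pow_inv)
  moreover have "(t ^^ (p * j + p)) a = (t ^^ (p * j)) ((t ^^ p) a)"
    by (simp only: funpow_add o_apply)
  ultimately have "(t ^^ (p * Suc j)) a = (t ^^ (p * j)) (c [^] int p)"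
    by (simp only: mult_Suc_right add.commute)
  also have "\<dots> = ((t ^^ (p * j)) c) [^] int p"
    using act_int_pow[OF c, of "Polynomial.monom 1 (p * j)" "int p"] c by (simp add: act_monom)
  finally have "(t ^^ (p * Suc j)) a = ((t ^^ (p * j)) c) [^] int p" .
  moreover obtain b where "b \<in> carrier G" "(t ^^ (p * j)) c = b [^] (int p ^ j)"
    using Suc.IH[OF c] by blast
  ultimately show ?case by (auto simp: int_pow_pow mult.commute)
qed

lemma filt_trivial: "\<exists>k. filt k = {\<one>}"
proof -
  obtain n where n: "Coset.order G = p ^ n" using order_pow by blast
  have "x = \<one>" if x: "x \<in> filt (p * n)" for x
  proof -
    obtain a where "a \<in> carrier G" "x = (t ^^ (p * n)) a" using x by (auto simp: filt_def)
    then obtain b where "b \<in> carrier G" "x = b [^] (int p ^ n)"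
      using t_funpow_eq_power[of a n] by auto
    then show ?thesis using pow_order_eq_1[of b] n int_pow_int[of G b "p ^ n"] by simp
  qed
  then show ?thesis using subgroup.one_closed[OF filt_subgroup] by blast
qed

definition kern :: "'a set" where "kern = {a \<in> carrier G. t a = \<one>}"

lemma kern_subgroup: "subgroup kern G"
  using group_hom.subgroup_kernel[OF t_hom] by (simp add: kern_def kernel_def)

lemma card_kern: "card kern = p"
proof -
  have "card (t ` carrier G) * card kern = card (carrier G)"
    by (rule card_hom_image[OF t_hom subgroup_self finite_carrier]) (auto simp: kern_def)
  then have "card (t ` carrier G) * card kern = card (t ` carrier G) * p"
    using index by (simp add: mult.commute)
  moreover have "card (t ` carrier G) > 0"
    using finite_carrier by (auto simp: card_gt_0_iff)
  ultimately show ?thesis by simp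
qed

text \<open>The last nontrivial member of the chain lies in the kernel of t, so
  \<open>filt i\<close> meets the kernel nontrivially; a group of order p has no proper nontrivial
  subgroup.\<close>

lemma kern_le_filt:
  assumes "filt i \<noteq> {\<one>}"
  shows "kern \<subseteq> filt i"
proof (rule ccontr)
  assume non: "\<not> kern \<subseteq> filt i"
  define k where "k = (LEAST k. filt k = {\<one>})"
  have k: "filt k = {\<one>}" unfolding k_def by (rule LeastI_ex[OF filt_trivial])
  have one: "\<one> \<in> filt j" for j by (rule subgroup.one_closed[OF filt_subgroup])
  have "i < k"
  proof (rule ccontr)
    assume "\<not> i < k"
    then have "filt i \<subseteq> {\<one>}" using k filt_antimono[of k i] by simp
    then show False using assms one by blast
  qed
  then obtain j where j: "k = Suc j" "i \<le> j" by (cases k) auto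
  have "filt j \<noteq> {\<one>}" using not_less_Least[of j "\<lambda>k. filt k = {\<one>}"] j by (simp add: k_def[symmetric])
  then obtain x where x: "x \<in> filt j" "x \<noteq> \<one>" using one by blast
  then have "t x \<in> filt k" using j filt_Suc by simp
  then have xk: "x \<in> kern \<inter> filt i" using k x filt_antimono[OF j(2)] filt_subset[of j] by (auto simp: kern_def)
  have sub: "subgroup (kern \<inter> filt i) G"
    by (rule subgroups_Inter_pair[OF kern_subgroup filt_subgroup])
  have "kern \<inter> filt i \<subset> kern" using non by blast
  then have "p * card (kern \<inter> filt i) \<le> p" using card_psubset[OF sub kern_subgroup] card_kern by simp
  then have "card (kern \<inter> filt i) \<le> 1" using p_pos by simp
  then have "kern \<inter> filt i \<subseteq> {\<one>}"
    using subgroup.one_closed[OF sub] subgroup_finite[OF sub] xk by (metis card_le_Suc0_iff_eq One_nat_def singletonI subsetI)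
  then show False using xk x by blast
qed

lemma card_filt_Suc:
  assumes "filt i \<noteq> {\<one>}"
  shows "p * card (filt (Suc i)) = card (filt i)"
proof -
  have "card (t ` filt i) * card kern = card (filt i)"
    by (rule card_hom_image[OF t_hom filt_subgroup subgroup_finite[OF filt_subgroup] _ kern_le_filt[OF assms]])
       (auto simp: kern_def)
  then show ?thesis by (simp add: card_kern filt_Suc mult.commute)
qed

text \<open>The exponent of |A|. It turns out to be also the number of steps in which the chain
  reaches the trivial group.\<close>

definition len :: nat where "len = (THE m. card (carrier G) = p ^ m)"

lemma card_carrier: "card (carrier G) = p ^ len"
proof -
  obtain n where n: "card (carrier G) = p ^ n" using order_pow by (auto simp: Coset.order_def)
  then have "len = n" unfolding len_def using p_gt_1 by (intro the_equality) auto
  then show ?thesis using n by simp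
qed

lemma card_filt: "i \<le> len \<Longrightarrow> card (filt i) = p ^ (len - i)"
proof (induction i)
  case (Suc i)
  then have c: "card (filt i) = p ^ (len - i)" by simp
  have "card (filt i) \<noteq> 1" using c Suc.prems p_gt_1 by simp
  then have "filt i \<noteq> {\<one>}" by auto
  then have "p * card (filt (Suc i)) = p * p ^ (len - Suc i)"
    using card_filt_Suc[of i] c Suc.prems by (metis Suc_diff_Suc Suc_le_lessD power_Suc)
  then show ?case using p_pos by simp
qed (simp add: filt_0 card_carrier)

lemma filt_nontrivial:
  assumes "i < len"
  shows "filt i \<noteq> {\<one>}"
proof
  assume "filt i = {\<one>}"
  then have "p ^ (len - i) = 1" using card_filt[of i] assms by simp
  then show False using p_gt_1 assms by simp
qed

lemma filt_len: "len \<le> i \<Longrightarrow> filt i = {\<one>}"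
proof -
  assume "len \<le> i"
  have "card (filt len) = 1" using card_filt[of len] by simp
  then have "filt len = {\<one>}"
    using subgroup.one_closed[OF filt_subgroup] by (metis card_1_singletonE singletonD)
  then show ?thesis
    using filt_antimono[OF \<open>len \<le> i\<close>] subgroup.one_closed[OF filt_subgroup, of i] by auto
qed

lemma filt_Suc_strict: "i < len \<Longrightarrow> \<not> filt i \<subseteq> filt (Suc i)"
proof
  assume "i < len" "filt i \<subseteq> filt (Suc i)"
  then have "card (filt i) = card (filt (Suc i))" using filt_Suc_le by (metis subset_antisym)
  then show False
    using card_filt_Suc[OF filt_nontrivial[OF \<open>i < len\<close>]] p_gt_1 card_subgroup_pos[OF filt_subgroup, of i] by simp
qed

text \<open>An element b of B outside \<open>filt (Suc i)\<close> generates \<open>filt i\<close>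
  modulo \<open>filt (Suc i)\<close>, because the index is p. Applying powers of t to this
  decomposition pushes the error term down the chain until it vanishes.\<close>

lemma uniserial_step:
  assumes B: "subgroup B G" "t ` B \<subseteq> B" and le: "B \<subseteq> filt i" and nle: "\<not> B \<subseteq> filt (Suc i)"
  shows "B = filt i"
proof -
  have Bk: "(t ^^ k) b \<in> B" if "b \<in> B" for k b
    using that B(2) by (induction k) auto
  obtain b where b: "b \<in> B" "b \<notin> filt (Suc i)" using nle by blast
  have bG: "b \<in> carrier G" using b le filt_subset by blast
  have "b \<noteq> \<one>" using b subgroup.one_closed[OF filt_subgroup] by auto
  then have ne: "filt i \<noteq> {\<one>}" using b le by blast
  have gen: "generate G (insert b (filt (Suc i))) = filt i"
    by (rule index_p_generate[OF filt_subgroup filt_subgroup filt_Suc_le])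
       (use card_filt_Suc[OF ne] b le in auto)
  have 1: "\<exists>b'\<in>B. \<exists>c\<in>filt (Suc i). a = b' \<otimes> c" if a: "a \<in> filt i" for a
  proof -
    obtain c j where cj: "a = c \<otimes> b [^] (j::int)" "c \<in> filt (Suc i)"
      using a unfolding gen[symmetric] generate_insert_normal[OF subgroup_imp_normal[OF filt_subgroup] bG]
      by blast
    then have "a = b [^] j \<otimes> c" using bG filt_subset by (simp add: m_comm subset_iff)
    then show ?thesis using cj subgroup_int_pow_closed[OF B(1) b(1)] by blast
  qed
  \<comment> \<open>The error in \<open>filt (i + k)\<close> is t^k of some element of
    \<open>filt i\<close>; decomposing that element once more costs only t^k b2, which stays in
    B.\<close>
  have "\<forall>a\<in>filt i. \<exists>b'\<in>B. \<exists>c\<in>filt (i + k). a = b' \<otimes> c" for k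
  proof (induction k)
    case 0
    show ?case
    proof
      fix a assume "a \<in> filt i"
      then have "a = \<one> \<otimes> a" "a \<in> filt (i + 0)" using filt_subset[of i] by (auto simp: subset_iff)
      then show "\<exists>b'\<in>B. \<exists>c\<in>filt (i + 0). a = b' \<otimes> c" using subgroup.one_closed[OF B(1)] by blast
    qed
  next
    case (Suc k)
    show ?case
    proof
      fix a assume "a \<in> filt i"
      then obtain b1 c1 where 2: "b1 \<in> B" "c1 \<in> filt (i + k)" "a = b1 \<otimes> c1" using Suc.IH by blast
      then obtain a2 where a2: "a2 \<in> filt i" "c1 = (t ^^ k) a2" by (auto simp: filt_add)
      obtain b2 c2 where 3: "b2 \<in> B" "c2 \<in> filt (Suc i)" "a2 = b2 \<otimes> c2" using 1[OF a2(1)] by blast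
      have car: "b1 \<in> carrier G" "b2 \<in> carrier G" "c2 \<in> carrier G"
        using 2 3 filt_subset subgroup.subset[OF B(1)] by auto
      have "(t ^^ k) (b2 \<otimes> c2) = (t ^^ k) b2 \<otimes> (t ^^ k) c2"
        using act_hom[OF car(2,3), of "Polynomial.monom 1 k"] car by (simp add: act_monom)
      then have "a = (b1 \<otimes> (t ^^ k) b2) \<otimes> (t ^^ k) c2" using 2 3 a2 car by (simp add: m_assoc)
      moreover have "b1 \<otimes> (t ^^ k) b2 \<in> B" using 2 3 Bk subgroup.m_closed[OF B(1)] by blast
      moreover have "(t ^^ k) c2 \<in> filt (i + Suc k)" using 3 filt_add[of "Suc i" k] by auto
      ultimately show "\<exists>b'\<in>B. \<exists>c\<in>filt (i + Suc k). a = b' \<otimes> c" by blast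
    qed
  qed
  from this[of len] have "filt i \<subseteq> B"
    using filt_len[of "i + len"] subgroup.mem_carrier[OF B(1)] by auto
  then show ?thesis using le by blast
qed

lemma uniserial:
  assumes B: "subgroup B G" "t ` B \<subseteq> B"
  shows "\<exists>i\<le>len. B = filt i"
proof -
  have B0: "B \<subseteq> filt 0" using subgroup.subset[OF B(1)] by (simp add: filt_0)
  obtain i where i: "i \<le> len" "B \<subseteq> filt i" and max: "\<And>j. j \<le> len \<and> B \<subseteq> filt j \<Longrightarrow> j \<le> i"
    using ex_has_greatest_nat[of "\<lambda>j. j \<le> len \<and> B \<subseteq> filt j" 0 id "len + 1"] B0 by auto
  show ?thesis
  proof (cases "i = len")
    case True
    then have "B \<subseteq> {\<one>}" using i filt_len by auto
    then have "B = filt len" using subgroup.one_closed[OF B(1)] filt_len by auto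
    then show ?thesis by blast
  next
    case False
    then have "\<not> B \<subseteq> filt (Suc i)" using max[of "Suc i"] i by auto
    then show ?thesis using uniserial_step[OF B i(2)] i by blast
  qed
qed

text \<open>This cancels w. Since b = w b - t v b additively, B \<le> \<open>filt i\<close> places t
  v b in \<open>filt (Suc i)\<close>, and so b too, as long as i < j.\<close>

lemma le_filt_if_act_w_le:
  assumes B: "subgroup B G" "t ` B \<subseteq> B" and wB: "\<And>b. b \<in> B \<Longrightarrow> act w b \<in> filt j"
  shows "B \<subseteq> filt j"
proof -
  have "i \<le> j \<Longrightarrow> B \<subseteq> filt i" for i
  proof (induction i)
    case 0
    then show ?case using subgroup.subset[OF B(1)] by (simp add: filt_0)
  next
    case (Suc i)
    show ?case
    proof
      fix b assume b: "b \<in> B"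
      then have bG: "b \<in> carrier G" using subgroup.subset[OF B(1)] by blast
      have "t (act v b) \<in> filt (Suc i)"
        using act_invariant[OF B b, of v] Suc by (auto simp: filt_Suc)
      moreover have "act w b \<in> filt (Suc i)" using wB[OF b] filt_antimono[OF Suc.prems] by blast
      moreover have "b = act w b \<otimes> inv (t (act v b))" using bG by (simp add: act_w m_assoc)
      ultimately show "b \<in> filt (Suc i)"
        by (metis subgroup.m_closed[OF filt_subgroup] subgroup.m_inv_closed[OF filt_subgroup])
    qed
  qed
  then show ?thesis by simp
qed

text \<open>On t A one has w (p t a) = -t^p a, which lies in \<open>filt p\<close>; then w is
  cancelled on the invariant subgroup of all p t a.\<close>

lemma pow_filt_1:
  assumes "a \<in> filt 1"
  shows "a [^] int p \<in> filt p"
proof -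
  let ?B = "(\<lambda>a. a [^] int p) ` filt 1"
  have "group_hom G G (\<lambda>a. a [^] int p)"
    by (simp add: group_hom_def group_hom_axioms_def hom_def int_pow_distrib)
  then have sub: "subgroup ?B G" by (rule group_hom.subgroup_img_is_subgroup[OF _ filt_subgroup])
  have inv: "t ` ?B \<subseteq> ?B" using filt_invariant[of 1] filt_subset[of 1] by (auto simp: t_int_pow subset_iff image_iff)
  have "?B \<subseteq> filt p"
  proof (rule le_filt_if_act_w_le[OF sub inv])
    fix b assume "b \<in> ?B"
    then obtain a where a: "a \<in> carrier G" "b = t a [^] int p" by (auto simp: filt_def)
    have "act w b = t (act w a) [^] int p"
    proof -
      have "act (w * [:0, 1:]) a = act ([:0, 1:] * w) a" by (simp add: mult.commute)
      then have "act w (t a) = t (act w a)" using a by (simp only: act_mult) simp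
      then show ?thesis using a by (simp add: act_int_pow)
    qed
    then have "inv (act w b) = (t ^^ p) a" using a by (simp add: t_funpow_p)
    then have "inv (act w b) \<in> filt p" using a by (auto simp: filt_def)
    then show "act w b \<in> filt p"
      using subgroup.m_inv_closed[OF filt_subgroup] a by (metis act_closed int_pow_closed inv_inv t_closed)
  qed
  then show ?thesis using assms by blast
qed

lemma kern_eq_filt: "kern = filt (len - 1)"
proof -
  have "card (carrier G) \<noteq> 1"
    using index p_gt_1 by (metis nat_mult_eq_1_iff nat_neq_iff)
  then have "len > 0" using card_carrier by (cases len) auto
  then have "kern \<subseteq> filt (len - 1)" "card (filt (len - 1)) = p"
    using kern_le_filt[OF filt_nontrivial] card_filt[of "len - 1"] by auto
  then show ?thesis using card_kern subgroup_finite[OF filt_subgroup] by (metis card_subset_eq)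
qed

lemma kern_le_filt_p: "p < len \<Longrightarrow> kern \<subseteq> filt p"
  by (rule kern_le_filt[OF filt_nontrivial])

text \<open>Any element outside t A works: an invariant subgroup containing it is not inside
  \<open>filt 1\<close>, so it is everything. It becomes the cyclic module generator in the wreath
  product isomorphism.\<close>

lemma generator:
  obtains a where "a \<in> carrier G"
    "\<And>B. subgroup B G \<Longrightarrow> t ` B \<subseteq> B \<Longrightarrow> a \<in> B \<Longrightarrow> B = carrier G"
proof -
  have "card (carrier G) \<noteq> 1"
    using index p_gt_1 by (metis nat_mult_eq_1_iff nat_neq_iff)
  then have "0 < len" using card_carrier by (cases len) auto
  then obtain a where a: "a \<in> filt 0" "a \<notin> filt (Suc 0)" using filt_Suc_strict by blast
  show thesis
  proof (rule that[of a])
    show "a \<in> carrier G" using a by (simp add: filt_0)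
    fix B assume "subgroup B G" "t ` B \<subseteq> B" "a \<in> B"
    then show "B = carrier G"
      using uniserial_step[of B 0] a subgroup.subset[of B G] by (auto simp: filt_0)
  qed
qed

section \<open>The rank d of A/pA: bounds for (a), (b) and (c)\<close>

context
  fixes d assumes d: "p ^ d * card pow_set = card (carrier G)"
begin

text \<open>The invariant subgroup p A is a member of the chain, and its index p^d determines which
  one.\<close>

lemma pow_set_eq_filt: "pow_set = filt d" and d_le_len: "d \<le> len"
proof -
  obtain i where i: "i \<le> len" "pow_set = filt i" using uniserial[OF pow_set_subgroup pow_set_invariant] by blast
  have "p ^ d * p ^ (len - i) = p ^ len" using d i card_filt[OF i(1)] card_carrier by simp
  then have "d + (len - i) = len" using p_gt_1 by (simp add: power_add[symmetric])
  then have "d = i" using i by simp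
  then show "pow_set = filt d" "d \<le> len" using i by auto
qed

text \<open>From t^p A \<le> p A = \<open>filt d\<close>, a value d > p would give
  \<open>filt p\<close> \<le> \<open>filt (Suc p)\<close>, although the chain still descends
  strictly there.\<close>

lemma rank_le: "d \<le> p"
proof (rule ccontr)
  assume "\<not> d \<le> p"
  then have "p < len" "Suc p \<le> d" using d_le_len by auto
  then show False
    using filt_p_le_pow_set pow_set_eq_filt filt_Suc_strict[of p] filt_antimono[of "Suc p" d] by blast
qed

text \<open>If p A = \<open>filt d\<close> had order above p, then \<open>filt (Suc d)\<close> would
  be nontrivial and contain the kernel, hence all norms. It also contains t^(p-1) A because d < p -
  1. So p w a lies in it, and cancelling w puts p A one layer too deep.\<close>

lemma card_pow_set_le:
  assumes "d < p - 1"
  shows "card pow_set \<le> p"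
proof (rule ccontr)
  assume big: "\<not> card pow_set \<le> p"
  then have "p ^ 1 < p ^ (len - d)" using card_filt[OF d_le_len] pow_set_eq_filt by simp
  then have "1 < len - d" using p_gt_1 by (simp only: power_strict_increasing_iff)
  then have lt: "Suc d < len" by simp
  have "pow_set \<subseteq> filt (Suc d)"
  proof (rule le_filt_if_act_w_le[OF pow_set_subgroup pow_set_invariant])
    fix b assume "b \<in> pow_set"
    then obtain a where a: "a \<in> carrier G" "b = a [^] int p" by (auto simp: pow_set_def)
    have "act nrm a = (t ^^ (p - 1)) a \<otimes> act w b" using a by (simp add: act_nrm act_int_pow)
    then have "act w b = inv ((t ^^ (p - 1)) a) \<otimes> act nrm a"
      using a by (simp add: inv_l_cancel)
    moreover have "act nrm a \<in> filt (Suc d)"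
      using t_act_nrm a kern_le_filt[OF filt_nontrivial[OF lt]] by (auto simp: kern_def)
    moreover have "(t ^^ (p - 1)) a \<in> filt (Suc d)"
      using a assms filt_antimono[of "Suc d" "p - 1"] by (auto simp: filt_def)
    ultimately show "act w b \<in> filt (Suc d)"
      by (metis subgroup.m_closed[OF filt_subgroup] subgroup.m_inv_closed[OF filt_subgroup])
  qed
  then show False using pow_set_eq_filt filt_Suc_strict[of d] lt by simp
qed

text \<open>If \<open>len\<close> exceeded p, then \<open>filt p\<close> would contain the kernel,
  hence all norms, and it equals p A. Then t^(p-1) a, the norm of a minus p w a, would lie in it
  too, contradicting the strict descent from \<open>filt (p - 1)\<close>.\<close>

lemma full_rank:
  assumes "d = p"
  shows "pow_set = {\<one>}" "len = p"
proof -
  have "\<not> p < len"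
  proof
    assume lt: "p < len"
    have "filt (p - 1) \<subseteq> filt p"
    proof
      fix x assume "x \<in> filt (p - 1)"
      then obtain a where a: "a \<in> carrier G" "x = (t ^^ (p - 1)) a" by (auto simp: filt_def)
      have "act nrm a \<in> filt p" using t_act_nrm a kern_le_filt_p[OF lt] by (auto simp: kern_def)
      moreover have "act w a [^] int p \<in> filt p"
        using pow_set_eq_filt assms a by (auto simp: pow_set_def)
      moreover have "x = act nrm a \<otimes> inv (act w a [^] int p)"
        using a by (simp add: act_nrm m_assoc)
      ultimately show "x \<in> filt p"
        by (metis subgroup.m_closed[OF filt_subgroup] subgroup.m_inv_closed[OF filt_subgroup])
    qed
    moreover have "p - 1 < len" using lt by simp
    ultimately show False using filt_Suc_strict[of "p - 1"] p_pos by simp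
  qed
  then show "len = p" using d_le_len assms by simp
  then show "pow_set = {\<one>}" using pow_set_eq_filt assms filt_len by simp
qed

text \<open>With p A = 0 the norm is just t^(p-1), and the kernel is the last nontrivial layer
  t^(p-1) A. This is the vanishing of the obstruction to splitting.\<close>

lemma kern_eq_norms:
  assumes "d = p" "z \<in> kern"
  shows "\<exists>b\<in>carrier G. z = act nrm b"
proof -
  obtain b where b: "b \<in> carrier G" "z = (t ^^ (p - 1)) b"
    using assms kern_eq_filt full_rank by (auto simp: filt_def)
  have "act w b [^] int p \<in> pow_set" using b by (auto simp: pow_set_def)
  then have "z = act nrm b" using b full_rank(1)[OF assms(1)] by (simp add: act_nrm)
  then show ?thesis using b by blast
qed

end

end

section \<open>Groups with \<open>|G : G'| = p\<^sup>2\<close>\<close>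

text \<open>When E is central modulo N only [a, b] can survive. Applied to G, generated by two
  elements and G', and to K, generated by two elements and \<open>\<gamma> 3\<close>.\<close>

lemma (in group) derived_generate_two_le:
  assumes N: "N \<lhd> G" and a: "a \<in> carrier G" and b: "b \<in> carrier G" and E: "E \<subseteq> carrier G"
    and ab: "commutator G a b \<in> N"
    and cen: "\<And>e x. e \<in> E \<Longrightarrow> x \<in> carrier G \<Longrightarrow> commutator G e x \<in> N"
  shows "derived G (generate G ({a, b} \<union> E)) \<subseteq> N"
proof (rule derived_generate_le[OF N])
  have sub: "subgroup N G" by (rule normal_imp_subgroup[OF N])
  show "{a, b} \<union> E \<subseteq> carrier G" using a b E by auto
  fix s t assume s: "s \<in> {a, b} \<union> E" and t: "t \<in> {a, b} \<union> E"
  then have G: "s \<in> carrier G" "t \<in> carrier G" using a b E by auto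
  have "commutator G x x \<in> N" if "x \<in> carrier G" for x
    using commutator_eq_one_iff[OF that that] subgroup.one_closed[OF sub] by simp
  moreover have "commutator G b a \<in> N"
    using subgroup.m_inv_closed[OF sub ab] a b by (simp add: inv_commutator)
  moreover have "commutator G s t \<in> N" if "s \<in> E" using cen[OF that G(2)] .
  moreover have "commutator G s t \<in> N" if "t \<in> E"
    using subgroup.m_inv_closed[OF sub cen[OF that G(1)]] G by (simp add: inv_commutator)
  ultimately show "commutator G s t \<in> N" using s t a b ab by auto
qed

lemma (in group) derived_generate_insert_le:
  assumes "N \<lhd> G" "a \<in> carrier G" "E \<subseteq> carrier G"
    and "\<And>e x. e \<in> E \<Longrightarrow> x \<in> carrier G \<Longrightarrow> commutator G e x \<in> N"
  shows "derived G (generate G (insert a E)) \<subseteq> N"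
proof -
  have "commutator G a a \<in> N"
    using commutator_eq_one_iff[OF assms(2,2)] subgroup.one_closed[OF normal_imp_subgroup[OF assms(1)]] by simp
  then have "derived G (generate G ({a, a} \<union> E)) \<subseteq> N"
    by (rule derived_generate_two_le[OF assms(1,2,2,3) _ assms(4)])
  then show ?thesis by simp
qed

lemma (in group) commutator_pow_mod_central:
  assumes N: "N \<lhd> G" and e: "e \<in> carrier G"
    and cen: "\<And>y. y \<in> carrier G \<Longrightarrow> commutator G (commutator G e x) y \<in> N"
    and x: "x \<in> carrier G"
  shows "commutator G e (x [^] (n::nat)) \<in> N \<longleftrightarrow> commutator G e x [^] n \<in> N"
proof -
  obtain Q :: "'a set monoid" and h where hom: "group_hom G Q h"
    and ker: "\<And>x. x \<in> carrier G \<Longrightarrow> h x = \<one>\<^bsub>Q\<^esub> \<longleftrightarrow> x \<in> N"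
    by (rule normal_quotientE[OF N]) (rule that)
  interpret h: group_hom G Q h by fact
  have "h (commutator G e (x [^] n)) = h (commutator G e x [^] n)"
  proof (induction n)
    case 0
    have "commutator G e \<one> = \<one>" using e by (simp add: commutator_def)
    then show ?case by simp
  next
    case (Suc n)
    have "h (commutator G e (x [^] n \<otimes> x)) = h (commutator G e (x [^] n)) \<otimes>\<^bsub>Q\<^esub> h (commutator G e x)"
      by (rule commutator_mult_mod_central[OF N e hom ker]) (use x cen in auto)
    then show ?case using Suc e x by simp
  qed
  then show ?thesis
    using ker[of "commutator G e (x [^] n)"] ker[of "commutator G e x [^] n"] e x by auto
qed

text \<open>Each exchange of a y with a later x costs one c, which commutes with both; there are
  n(n-1)/2 exchanges.\<close>

lemma (in group) mult_pow_class_two: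
  assumes x: "x \<in> carrier G" and y: "y \<in> carrier G" and c: "c = commutator G y x"
    and cx: "c \<otimes> x = x \<otimes> c" and cy: "c \<otimes> y = y \<otimes> c"
  shows "(x \<otimes> y) [^] (n::nat) = x [^] n \<otimes> y [^] n \<otimes> c [^] (n * (n - 1) div 2)"
proof (induction n)
  case (Suc n)
  have cG: "c \<in> carrier G" using c x y by simp
  have yx: "y \<otimes> x = x \<otimes> (y \<otimes> c)"
  proof -
    have "y \<otimes> x = c \<otimes> (x \<otimes> y)" using x y by (simp add: c commutator_def word_simps)
    also have "\<dots> = x \<otimes> (c \<otimes> y)" using x y cG cx by (metis m_assoc)
    finally show ?thesis by (simp add: cy)
  qed
  have ckx: "c [^] k \<otimes> x = x \<otimes> c [^] k" for k :: nat
    using group_commutes_pow[OF cx cG x] by simp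
  have cky: "c [^] k \<otimes> y = y \<otimes> c [^] k" for k :: nat
    using group_commutes_pow[OF cy cG y] by simp
  have ynx: "y [^] k \<otimes> x = x \<otimes> (y [^] k \<otimes> c [^] k)" for k :: nat
  proof (induction k)
    case (Suc k)
    have "y [^] Suc k \<otimes> x = (y [^] k \<otimes> x) \<otimes> (y \<otimes> c)" using x y cG yx by (simp add: m_assoc)
    also have "\<dots> = x \<otimes> (y [^] k \<otimes> ((c [^] k \<otimes> y) \<otimes> c))" using Suc x y cG by (simp add: m_assoc)
    also have "\<dots> = x \<otimes> (y [^] Suc k \<otimes> c [^] Suc k)" using x y cG cky by (simp add: m_assoc)
    finally show ?case .
  qed (use x in simp)
  let ?t = "n * (n - 1) div 2"
  have t: "n + ?t = Suc n * (Suc n - 1) div 2"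
    by (cases n) (simp_all add: field_simps)
  have "(x \<otimes> y) [^] Suc n = x [^] n \<otimes> (y [^] n \<otimes> ((c [^] ?t \<otimes> x) \<otimes> y))"
    using Suc x y cG by (simp add: m_assoc)
  also have "\<dots> = x [^] n \<otimes> ((y [^] n \<otimes> x) \<otimes> (c [^] ?t \<otimes> y))"
    using x y cG by (simp add: ckx m_assoc)
  also have "\<dots> = x [^] Suc n \<otimes> (y [^] n \<otimes> ((c [^] n \<otimes> c [^] ?t) \<otimes> y))"
    using x y cG by (simp add: ynx m_assoc)
  also have "c [^] n \<otimes> c [^] ?t = c [^] (n + ?t)" using cG by (simp add: nat_pow_mult)
  also have "x [^] Suc n \<otimes> (y [^] n \<otimes> (c [^] (n + ?t) \<otimes> y)) = x [^] Suc n \<otimes> y [^] Suc n \<otimes> c [^] (n + ?t)"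
    using x y cG cky by (simp add: m_assoc)
  finally show ?case unfolding t .
qed simp

context p_group
begin

lemma index_p_power_mem:
  assumes N: "N \<lhd> G" and B: "subgroup B G" "N \<subseteq> B" "card B = p * card N" and x: "x \<in> B"
  shows "x [^] p \<in> N"
proof -
  obtain Q :: "'a set monoid" and h where hom: "group_hom G Q h"
    and ker: "\<And>x. x \<in> carrier G \<Longrightarrow> h x = \<one>\<^bsub>Q\<^esub> \<longleftrightarrow> x \<in> N"
    by (rule normal_quotientE[OF N]) (rule that)
  interpret h: group_hom G Q h by fact
  have sub: "subgroup (h ` B) Q" by (rule h.subgroup_img_is_subgroup[OF B(1)])
  interpret B: group "Q\<lparr>carrier := h ` B\<rparr>" by (rule h.H.subgroup_imp_group[OF sub])
  have xG: "x \<in> carrier G" using x subgroup.subset[OF B(1)] by blast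
  have "card (h ` B) * card N = card B"
    by (rule card_hom_image[OF hom B(1) subgroup_finite[OF B(1)] ker B(2)])
  then have "card (h ` B) = p"
    using B(3) card_subgroup_pos[OF normal_imp_subgroup[OF N]] by simp
  then have "h x [^]\<^bsub>Q\<^esub> p = \<one>\<^bsub>Q\<^esub>"
    using B.pow_order_eq_1[of "h x"] x h.H.nat_pow_consistent[of "h x" p "h ` B"] by (simp add: Coset.order_def)
  then have "h (x [^] p) = \<one>\<^bsub>Q\<^esub>" using xG by (simp add: h.hom_nat_pow)
  then show ?thesis using ker xG by simp
qed

text \<open>The non-generator criterion for N = \<open>lower_central G i\<close>. It turns
  inclusions modulo the next term into exact ones.\<close>

lemma lower_central_le_normal:
  assumes "M \<lhd> G" "i \<ge> 1" "lower_central G i \<subseteq> generate G (M \<union> lower_central G (Suc i))"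
  shows "lower_central G i \<subseteq> M"
  by (rule le_normal_if_commutator_le[OF assms(1) lower_central_subset assms(3)[unfolded lower_central_Suc[OF assms(2)]]])

lemma lower_central_Suc_psubset:
  assumes "i \<ge> 1" "lower_central G i \<noteq> {\<one>}"
  shows "lower_central G (Suc i) \<subset> lower_central G i"
proof -
  have "\<not> lower_central G i \<subseteq> lower_central G (Suc i)"
  proof
    assume le: "lower_central G i \<subseteq> lower_central G (Suc i)"
    have "lower_central G i \<subseteq> {\<one>}"
      by (rule lower_central_le_normal[OF one_is_normal assms(1)])
         (use le in \<open>auto intro: generate.incl\<close>)
    then show False using assms(2) subgroup.one_closed[OF lower_central_subgroup] by blast
  qed
  then show ?thesis using lower_central_Suc_subset by blast
qed

end

text \<open>The bound on the order rules out |G| = p^2, where \<open>D\<close> would be trivial;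
  strictness of the first inclusions of the series starts from \<open>D\<close> being
  nontrivial.\<close>

locale p_group_two_gen = p_group +
  assumes index_derived: "p ^ 2 * card (derived G (carrier G)) = card (carrier G)"
    and order_ge: "p ^ 3 \<le> card (carrier G)"
begin

abbreviation "D \<equiv> derived G (carrier G)"

abbreviation "\<gamma> \<equiv> lower_central G"

lemma lower_2: "\<gamma> 2 = D"
  by (rule lower_central_2)

lemma D_normal: "D \<lhd> G"
  by (rule derived_is_normal[OF normal_self])

lemma D_subgroup: "subgroup D G"
  by (rule normal_imp_subgroup[OF D_normal])

lemma D_subset: "D \<subseteq> carrier G"
  by (rule subgroup.subset[OF D_subgroup])

lemma not_in_D:
  obtains x where "x \<in> carrier G" "x \<notin> D"
proof -
  have "card D < card (carrier G)"
    using index_derived p_gt_1 card_subgroup_pos[OF D_subgroup]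
    by (metis mult_less_cancel2 nat_mult_1 one_less_power zero_less_numeral)
  then have "D \<noteq> carrier G" by auto
  then show thesis using that D_subset by blast
qed

lemma D_nontrivial: "D \<noteq> {\<one>}"
proof
  assume "D = {\<one>}"
  then have "p ^ 3 \<le> p ^ 2" using index_derived order_ge by simp
  then show False using p_gt_1 by simp
qed

lemma commutator_D3: "x \<in> D \<Longrightarrow> y \<in> carrier G \<Longrightarrow> commutator G x y \<in> \<gamma> 3"
  "x \<in> D \<Longrightarrow> y \<in> carrier G \<Longrightarrow> commutator G y x \<in> \<gamma> 3"
  using commutator_in_lower_central[of x 2 y] by (simp_all add: lower_2 numeral_3_eq_3)

lemma commutator_34: "x \<in> \<gamma> 3 \<Longrightarrow> y \<in> carrier G \<Longrightarrow> commutator G x y \<in> \<gamma> 4"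
  "x \<in> \<gamma> 3 \<Longrightarrow> y \<in> carrier G \<Longrightarrow> commutator G y x \<in> \<gamma> 4"
  using commutator_in_lower_central[of x 3 y] by simp_all

lemma commutator_45: "x \<in> \<gamma> 4 \<Longrightarrow> y \<in> carrier G \<Longrightarrow> commutator G x y \<in> \<gamma> 5"
  "x \<in> \<gamma> 4 \<Longrightarrow> y \<in> carrier G \<Longrightarrow> commutator G y x \<in> \<gamma> 5"
  using commutator_in_lower_central[of x 4 y] by simp_all

lemma commutator_DD: "x \<in> D \<Longrightarrow> y \<in> D \<Longrightarrow> commutator G x y \<in> \<gamma> 4"
  using commutator_derived_in_lower_central[of x 2 y] by (simp add: lower_2)

lemma commutator_D_in_D: "x \<in> carrier G \<Longrightarrow> y \<in> carrier G \<Longrightarrow> commutator G x y \<in> D"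
  by (rule commutator_in_derived)

lemma lower_3_le: "\<gamma> 3 \<subseteq> D"
  using lower_central_antimono[of 2 3] by (simp add: lower_2)

lemma lower_4_le: "\<gamma> 4 \<subseteq> \<gamma> 3"
  by (rule lower_central_antimono) simp

lemma lower_3_subset: "\<gamma> 3 \<subset> D"
  using lower_central_Suc_psubset[of 2] D_nontrivial by (simp add: lower_2 numeral_3_eq_3)

text \<open>If x^p were outside \<open>D\<close>, the groups generated over \<open>D\<close> by x^p
  and by x would be two strict steps, exhausting the index p^2. Then G would be cyclic over
  \<open>D\<close>, forcing G' \<le> \<open>\<gamma> 3\<close>.\<close>

lemma power_in_D:
  assumes x: "x \<in> carrier G"
  shows "x [^] p \<in> D"
proof (rule ccontr)
  assume non: "x [^] p \<notin> D"
  let ?L = "generate G (insert (x [^] p) D)" and ?K = "generate G (insert x D)"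
  have SL: "insert (x [^] p) D \<subseteq> carrier G" and SK: "insert x D \<subseteq> carrier G"
    using x D_subset by auto
  have L: "subgroup ?L G" and K: "subgroup ?K G"
    using generate_is_subgroup SL SK by blast+
  have "x [^] p \<in> ?K" using subgroup_int_pow_closed[OF K, of x "int p"] by (simp add: int_pow_int generate.incl)
  then have LK: "?L \<subseteq> ?K" using K by (intro generate_subgroup_incl) (auto intro: generate.incl)
  have "x \<notin> D" using non subgroup_int_pow_closed[OF D_subgroup, of x "int p"] by (auto simp: int_pow_int)
  then have "x \<notin> ?L" using mem_if_mem_generate_power[OF D_normal x] by blast
  then have "?L \<subset> ?K" using LK by (auto intro: generate.incl)
  then have "p * card ?L \<le> card ?K" by (rule card_psubset[OF L K])
  moreover have "p * card D \<le> card ?L"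
    by (rule card_psubset[OF D_subgroup L]) (use non in \<open>auto intro: generate.incl\<close>)
  ultimately have "p * (p * card D) \<le> card ?K" by (meson mult_le_mono2 order_trans)
  then have "card (carrier G) \<le> card ?K" using index_derived by (simp add: power2_eq_square mult.assoc)
  then have "?K = carrier G"
    using card_seteq[OF finite_carrier subgroup.subset[OF K]] by simp
  moreover have "derived G ?K \<subseteq> \<gamma> 3"
    by (rule derived_generate_insert_le[OF lower_central_normal x D_subset commutator_D3(1)])
  ultimately show False using lower_3_subset by auto
qed

lemma maximal_subgroup_generate_D:
  assumes "x \<in> carrier G" "x \<notin> D"
  shows "maximal_subgroup (generate G (insert x D)) G"
proof -
  have S: "insert x D \<subseteq> carrier G" using assms D_subset by auto
  have K: "subgroup (generate G (insert x D)) G" by (rule generate_is_subgroup[OF S])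
  have "card (generate G (insert x D)) \<le> p * card D"
    by (rule card_generate_insert_le[OF D_normal assms(1) power_in_D[OF assms(1)] p_pos subgroup_finite[OF D_subgroup]])
  moreover have "p * card D \<le> card (generate G (insert x D))"
    by (rule card_psubset[OF D_subgroup K]) (use assms in \<open>auto intro: generate.incl\<close>)
  ultimately have "p * card (generate G (insert x D)) = card (carrier G)"
    using index_derived by (simp add: power2_eq_square mult.assoc)
  then show ?thesis by (rule maximal_subgroupI[OF K])
qed

lemma maximal_subgroupD:
  assumes "maximal_subgroup K G"
  shows "subgroup K G" "K \<lhd> G" "D \<subseteq> K" "card K = p * card D" "K \<subseteq> carrier G" "K \<noteq> carrier G"
proof -
  show "subgroup K G" "K \<lhd> G" "D \<subseteq> K" "K \<subseteq> carrier G" "K \<noteq> carrier G"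
    using assms maximal_subgroup_normal maximal_subgroup_derived_le
    by (auto simp: maximal_subgroup_def dest: subgroup.subset)
  have "p * card K = p * (p * card D)"
    using maximal_subgroup_card[OF assms] index_derived by (simp add: power2_eq_square mult.assoc)
  then show "card K = p * card D" using p_pos by simp
qed

lemma maximal_subgroup_elemE:
  assumes "maximal_subgroup K G"
  obtains k where "k \<in> K" "k \<notin> D" "k \<in> carrier G"
proof -
  have "card D < card K"
    using maximal_subgroupD(4)[OF assms] p_gt_1 card_subgroup_pos[OF D_subgroup] by simp
  then have "K \<noteq> D" by auto
  then show thesis using that maximal_subgroupD[OF assms] by blast
qed

lemma maximal_subgroup_eq_generate:
  assumes K: "maximal_subgroup K G" and "k \<in> K" "k \<notin> D"
  shows "generate G (insert k D) = K"
  by (rule index_p_generate[OF D_subgroup]) (use maximal_subgroupD[OF K] assms in auto)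

lemma maximal_subgroup_Int:
  assumes K: "maximal_subgroup K G" and L: "maximal_subgroup L G" and "K \<noteq> L"
  shows "K \<inter> L = D"
proof -
  note mK = maximal_subgroupD[OF K] and mL = maximal_subgroupD[OF L]
  have sub: "subgroup (K \<inter> L) G" by (rule subgroups_Inter_pair[OF mK(1) mL(1)])
  have "\<not> K \<subseteq> L"
    using card_subset_eq[OF subgroup_finite[OF mL(1)], of K] mK mL assms(3) by auto
  then have "p * card (K \<inter> L) \<le> p * card D"
    using card_psubset[OF sub mK(1)] mK(4) by auto
  then have "card (K \<inter> L) \<le> card D" using p_pos by simp
  then show ?thesis
    using card_seteq[OF subgroup_finite[OF sub], of D] mK mL by auto
qed

lemma other_maximal_subgroup:
  assumes K: "maximal_subgroup K G"
  obtains L where "maximal_subgroup L G" "L \<noteq> K"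
proof -
  obtain x where "x \<in> carrier G" "x \<notin> K" using maximal_subgroupD[OF K] by blast
  moreover from this have "x \<notin> D" using maximal_subgroupD[OF K] by blast
  ultimately show thesis
    using that[OF maximal_subgroup_generate_D[of x]] generate.incl[of x "insert x D" G] by blast
qed

lemma generate_two:
  assumes K: "maximal_subgroup K G" "k \<in> K" "k \<notin> D" and l: "l \<in> carrier G" "l \<notin> K"
  shows "generate G ({k, l} \<union> D) = carrier G"
proof -
  note mK = maximal_subgroupD[OF K(1)]
  have S: "{k, l} \<union> D \<subseteq> carrier G" using K l mK D_subset by auto
  have "K \<subseteq> generate G ({k, l} \<union> D)"
    unfolding maximal_subgroup_eq_generate[OF K, symmetric] by (rule mono_generate) auto
  then have "generate G (insert l K) \<subseteq> generate G ({k, l} \<union> D)"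
    by (intro generate_subgroup_incl[OF _ generate_is_subgroup[OF S]]) (auto intro: generate.incl)
  then show ?thesis
    using maximal_subgroup_generate[OF K(1) l] generate_incl[OF S] by auto
qed

text \<open>G is generated by k, l and \<open>D\<close>, and \<open>D\<close> is central modulo
  \<open>\<gamma> 3\<close>, so G' is generated by [l, k] there. Its p-th power is congruent to
  [l, k^p], which is trivial since k^p lies in \<open>D\<close>.\<close>

lemma D_eq_generate_commutator:
  assumes K: "maximal_subgroup K G" "k \<in> K" "k \<notin> D" and l: "l \<in> carrier G" "l \<notin> K"
  shows "D = generate G (insert (commutator G l k) (\<gamma> 3))"
    and "commutator G l k [^] p \<in> \<gamma> 3"
proof -
  let ?d = "commutator G l k" and ?N = "generate G (insert (commutator G l k) (\<gamma> 3))"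
  have k: "k \<in> carrier G" using K maximal_subgroupD by blast
  have d: "?d \<in> D" using k l commutator_D_in_D by blast
  have N: "?N \<lhd> G"
    using k l d commutator_D3 by (intro generate_insert_central_normal[OF lower_central_normal]) auto
  have inc: "\<gamma> 3 \<subseteq> ?N" "?d \<in> ?N" by (auto intro: generate.incl)
  have "derived G (generate G ({l, k} \<union> D)) \<subseteq> ?N"
    by (rule derived_generate_two_le[OF N l(1) k D_subset inc(2)]) (use commutator_D3(1) inc in blast)
  then have "D \<subseteq> ?N" using generate_two[OF K l] by (simp add: insert_commute)
  moreover have "?N \<subseteq> D" using d lower_3_le by (intro generate_subgroup_incl[OF _ D_subgroup]) auto
  ultimately show "D = ?N" by blast
  have "commutator G l (k [^] p) \<in> \<gamma> 3"
    using commutator_D3(2)[OF power_in_D[OF k] l(1)] .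
  then show "?d [^] p \<in> \<gamma> 3"
    using commutator_pow_mod_central[OF lower_central_normal l(1) commutator_D3(1)[OF d] k] by blast
qed

lemma D_generatorE:
  obtains d where "d \<in> D" "d \<in> carrier G" "D = generate G (insert d (\<gamma> 3))"
    "d [^] p \<in> \<gamma> 3"
proof -
  obtain x where x: "x \<in> carrier G" "x \<notin> D" by (rule not_in_D)
  let ?K = "generate G (insert x D)"
  have K: "maximal_subgroup ?K G" by (rule maximal_subgroup_generate_D[OF x])
  obtain l where l: "l \<in> carrier G" "l \<notin> ?K" using maximal_subgroupD[OF K] by blast
  have xK: "x \<in> ?K" by (auto intro: generate.incl)
  show thesis
    using that[of "commutator G l x"] D_eq_generate_commutator[OF K xK x(2) l] commutator_D_in_D x l D_subset by blast
qed

lemma card_D: "card D = p * card (\<gamma> 3)"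
proof (rule antisym)
  obtain d where d: "d \<in> carrier G" "D = generate G (insert d (\<gamma> 3))" "d [^] p \<in> \<gamma> 3"
    by (rule D_generatorE)
  show "card D \<le> p * card (\<gamma> 3)"
    unfolding d(2)
    by (rule card_generate_insert_le[OF lower_central_normal d(1,3) p_pos subgroup_finite[OF lower_central_subgroup]])
  show "p * card (\<gamma> 3) \<le> card D"
    by (rule card_psubset[OF lower_central_subgroup D_subgroup lower_3_subset])
qed

section \<open>The images of the groups K' in the third lower central factor\<close>

definition der4 :: "'a set \<Rightarrow> 'a set" where
  "der4 K = generate G (derived G K \<union> \<gamma> 4)"

lemma normal_between_34:
  assumes "subgroup N G" "\<gamma> 4 \<subseteq> N" "N \<subseteq> \<gamma> 3"
  shows "N \<lhd> G"
  by (rule normalI_commutator[OF assms(1)]) (use assms commutator_34 in blast)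

lemma derived_maximal_le:
  assumes K: "maximal_subgroup K G"
  shows "derived G K \<subseteq> \<gamma> 3"
proof -
  obtain k where k: "k \<in> K" "k \<notin> D" "k \<in> carrier G" by (rule maximal_subgroup_elemE[OF K])
  have "derived G (generate G (insert k D)) \<subseteq> \<gamma> 3"
    by (rule derived_generate_insert_le[OF lower_central_normal k(3) D_subset commutator_D3(1)])
  then show ?thesis using maximal_subgroup_eq_generate[OF K k(1,2)] by simp
qed

lemma der4_basic:
  assumes K: "maximal_subgroup K G"
  shows "subgroup (der4 K) G" "\<gamma> 4 \<subseteq> der4 K" "derived G K \<subseteq> der4 K"
    "der4 K \<subseteq> \<gamma> 3" "der4 K \<lhd> G"
proof -
  have S: "derived G K \<union> \<gamma> 4 \<subseteq> \<gamma> 3"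
    using derived_maximal_le[OF K] lower_4_le by auto
  show 1: "subgroup (der4 K) G"
    unfolding der4_def using S lower_central_subset by (intro generate_is_subgroup) blast
  show 2: "\<gamma> 4 \<subseteq> der4 K" "derived G K \<subseteq> der4 K"
    unfolding der4_def by (auto intro: generate.incl)
  show 3: "der4 K \<subseteq> \<gamma> 3"
    unfolding der4_def by (rule generate_subgroup_incl[OF S lower_central_subgroup])
  show "der4 K \<lhd> G" by (rule normal_between_34[OF 1 2(1) 3])
qed

text \<open>K is generated by k, d and the subgroup \<open>\<gamma> 3\<close>, which is central
  modulo \<open>\<gamma> 4\<close>; so [d, k] alone survives. Its p-th power is congruent to
  [d, k^p], a commutator of elements of \<open>D\<close>.\<close>

lemma der4_eq_generate:
  assumes K: "maximal_subgroup K G" and k: "k \<in> K" "k \<notin> D"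
    and d: "d \<in> D" "D = generate G (insert d (\<gamma> 3))"
  shows "der4 K = generate G (insert (commutator G d k) (\<gamma> 4))"
    and "commutator G d k [^] p \<in> \<gamma> 4"
proof -
  note mK = maximal_subgroupD[OF K]
  have kG: "k \<in> carrier G" and dG: "d \<in> carrier G" using k d mK D_subset by auto
  let ?c = "commutator G d k" and ?N = "generate G (insert (commutator G d k) (\<gamma> 4))"
  have c: "?c \<in> \<gamma> 3" using d kG commutator_D3 by blast
  have N: "?N \<lhd> G"
    using c dG kG commutator_34 by (intro generate_insert_central_normal[OF lower_central_normal]) auto
  have inc: "\<gamma> 4 \<subseteq> ?N" "?c \<in> ?N" by (auto intro: generate.incl)
  have sub: "subgroup ?N G" by (rule normal_imp_subgroup[OF N])
  let ?S = "{d, k} \<union> \<gamma> 3"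
  have S: "?S \<subseteq> carrier G" using kG dG lower_central_subset by auto
  have "D \<subseteq> generate G ?S" by (subst d(2)) (rule mono_generate, auto)
  then have "generate G (insert k D) \<subseteq> generate G ?S"
    by (intro generate_subgroup_incl[OF _ generate_is_subgroup[OF S]]) (auto intro: generate.incl)
  then have "derived G K \<subseteq> derived G (generate G ?S)"
    using maximal_subgroup_eq_generate[OF K k] by (intro mono_derived) simp
  also have "\<dots> \<subseteq> ?N"
    by (rule derived_generate_two_le[OF N dG kG lower_central_subset inc(2)])
       (use commutator_34(1) inc in blast)
  finally have "der4 K \<subseteq> ?N"
    unfolding der4_def using inc by (intro generate_subgroup_incl[OF _ sub]) auto
  moreover have "?c \<in> derived G K" using d k mK by (intro commutator_in_derived) auto
  then have "?N \<subseteq> der4 K"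
    using der4_basic[OF K] by (intro generate_subgroup_incl) auto
  ultimately show "der4 K = ?N" by blast
  have "commutator G d (k [^] p) \<in> \<gamma> 4"
    using commutator_DD[OF d(1) power_in_D[OF kG]] .
  then show "?c [^] p \<in> \<gamma> 4"
    using commutator_pow_mod_central[OF lower_central_normal dG commutator_34(1)[OF c] kG] by blast
qed

lemma card_der4_le:
  assumes K: "maximal_subgroup K G"
  shows "card (der4 K) \<le> p * card (\<gamma> 4)"
proof -
  obtain k where k: "k \<in> K" "k \<notin> D" "k \<in> carrier G" by (rule maximal_subgroup_elemE[OF K])
  obtain d where d: "d \<in> D" "d \<in> carrier G" "D = generate G (insert d (\<gamma> 3))" "d [^] p \<in> \<gamma> 3"
    by (rule D_generatorE)
  show ?thesis
    unfolding der4_eq_generate(1)[OF K k(1,2) d(1,3)]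
    by (rule card_generate_insert_le[OF lower_central_normal _ der4_eq_generate(2)[OF K k(1,2) d(1,3)] p_pos
          subgroup_finite[OF lower_central_subgroup]]) (use d k in auto)
qed

text \<open>With G generated by k, l and \<open>D\<close>, and \<open>D\<close> by d and
  \<open>\<gamma> 3\<close>, the group [D, G] is generated modulo \<open>\<gamma> 4\<close> by
  [d, k] and [d, l], one from each maximal subgroup.\<close>

lemma lower_3_eq_generate:
  assumes K: "maximal_subgroup K G" and L: "maximal_subgroup L G" and "K \<noteq> L"
  shows "\<gamma> 3 = generate G (der4 K \<union> der4 L)"
proof
  note mK = maximal_subgroupD[OF K] and mL = maximal_subgroupD[OF L]
  note bK = der4_basic[OF K] and bL = der4_basic[OF L]
  let ?N = "generate G (der4 K \<union> der4 L)"
  have S: "der4 K \<union> der4 L \<subseteq> \<gamma> 3" using bK bL by auto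
  show le: "?N \<subseteq> \<gamma> 3" by (rule generate_subgroup_incl[OF S lower_central_subgroup])
  have sub: "subgroup ?N G" using S lower_central_subset by (intro generate_is_subgroup) blast
  have inc: "der4 K \<subseteq> ?N" "der4 L \<subseteq> ?N" by (auto intro: generate.incl)
  have N: "?N \<lhd> G" using bK inc by (intro normal_between_34[OF sub _ le]) auto
  obtain k where k: "k \<in> K" "k \<notin> D" "k \<in> carrier G" by (rule maximal_subgroup_elemE[OF K])
  obtain l where l: "l \<in> L" "l \<notin> D" "l \<in> carrier G" by (rule maximal_subgroup_elemE[OF L])
  have lK: "l \<notin> K" using maximal_subgroup_Int[OF assms] l by blast
  obtain d where d: "d \<in> D" "d \<in> carrier G" "D = generate G (insert d (\<gamma> 3))" "d [^] p \<in> \<gamma> 3"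
    by (rule D_generatorE)
  have dk: "commutator G d k \<in> ?N" "commutator G d l \<in> ?N"
    using commutator_in_derived[of d K k] commutator_in_derived[of d L l] d k l mK mL bK bL inc by blast+
  have S1: "insert d (\<gamma> 3) \<subseteq> carrier G" using d lower_central_subset by auto
  have S2: "{k, l} \<union> D \<subseteq> carrier G" using k l D_subset by auto
  have "commutator_subgroup G D (carrier G) \<subseteq> ?N"
  proof (rule commutator_subgroup_leI[OF sub])
    fix a b assume a: "a \<in> D" and b: "b \<in> carrier G"
    show "commutator G a b \<in> ?N"
    proof (rule commutator_generate_mem[OF N S1 S2])
      show "a \<in> generate G (insert d (\<gamma> 3))" using a d by simp
      show "b \<in> generate G ({k, l} \<union> D)" using b generate_two[OF K k(1,2) l(3) lK] by simp
      fix s t assume s: "s \<in> insert d (\<gamma> 3)" and t: "t \<in> {k, l} \<union> D"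
      have l4: "\<gamma> 4 \<subseteq> ?N" using bK inc by blast
      show "commutator G s t \<in> ?N"
      proof (cases "s = d")
        case True
        then show ?thesis using t dk commutator_DD[OF d(1)] l4 by blast
      next
        case False
        then show ?thesis using s t S2 commutator_34 l4 by blast
      qed
    qed
  qed
  then show "\<gamma> 3 \<subseteq> ?N"
    using lower_central_Suc[of 2] by (simp add: lower_2 numeral_3_eq_3)
qed

lemma card_lower_3_le:
  assumes L: "maximal_subgroup L G"
  shows "card (\<gamma> 3) \<le> p * card (der4 L)"
proof -
  note bL = der4_basic[OF L]
  obtain K where K: "maximal_subgroup K G" "K \<noteq> L" by (rule other_maximal_subgroup[OF L])
  obtain k where k: "k \<in> K" "k \<notin> D" "k \<in> carrier G" by (rule maximal_subgroup_elemE[OF K(1)])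
  obtain d where d: "d \<in> D" "d \<in> carrier G" "D = generate G (insert d (\<gamma> 3))" "d [^] p \<in> \<gamma> 3"
    by (rule D_generatorE)
  let ?c = "commutator G d k"
  note gK = der4_eq_generate[OF K(1) k(1,2) d(1,3)]
  have c: "?c \<in> carrier G" using d k by simp
  have S: "insert ?c (der4 L) \<subseteq> carrier G" using c subgroup.subset[OF bL(1)] by auto
  have "der4 K \<subseteq> generate G (insert ?c (der4 L))"
    unfolding gK(1) using bL by (intro mono_generate) auto
  then have "\<gamma> 3 \<subseteq> generate G (insert ?c (der4 L))"
    unfolding lower_3_eq_generate[OF K(1) L K(2)]
    by (intro generate_subgroup_incl[OF _ generate_is_subgroup[OF S]]) (auto intro: generate.incl)
  then have "card (\<gamma> 3) \<le> card (generate G (insert ?c (der4 L)))"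
    by (rule card_mono[OF finite_subset[OF generate_incl[OF S]]])
  also have "\<dots> \<le> p * card (der4 L)"
    by (rule card_generate_insert_le[OF bL(5) c _ p_pos subgroup_finite[OF bL(1)]]) (use gK(2) bL in auto)
  finally show ?thesis .
qed

text \<open>K' is normal, and \<open>\<gamma> 4\<close> consists of non-generators of
  \<open>\<gamma> 3\<close>.\<close>

lemma derived_eq_lower_3:
  assumes K: "maximal_subgroup K G" and "der4 K = \<gamma> 3"
  shows "derived G K = \<gamma> 3"
proof
  have "derived G K \<lhd> G" by (rule derived_is_normal[OF maximal_subgroupD(2)[OF K]])
  then show "\<gamma> 3 \<subseteq> derived G K"
    by (rule lower_central_le_normal) (simp_all add: assms(2)[unfolded der4_def])
qed (rule derived_maximal_le[OF K])

lemma der4_eq_lower_4_iff: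
  assumes K: "maximal_subgroup K G"
  shows "der4 K = \<gamma> 4 \<longleftrightarrow> derived G K \<subseteq> \<gamma> 4"
proof
  assume "derived G K \<subseteq> \<gamma> 4"
  then have "der4 K \<subseteq> \<gamma> 4"
    unfolding der4_def by (intro generate_subgroup_incl[OF _ lower_central_subgroup]) auto
  then show "der4 K = \<gamma> 4" using der4_basic[OF K] by blast
qed (use der4_basic[OF K] in auto)

section \<open>The third lower central factor of order p^2\<close>

context
  assumes large: "card (\<gamma> 3) = p ^ 2 * card (\<gamma> 4)"
begin

text \<open>Each K' \<open>\<gamma> 4\<close> is cyclic of order at most p over
  \<open>\<gamma> 4\<close>, and a second maximal subgroup contributes at most p more; reaching p^2
  forces equality. Distinct K thus give distinct lines in a plane.\<close>

lemma card_der4: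
  assumes K: "maximal_subgroup K G"
  shows "card (der4 K) = p * card (\<gamma> 4)"
proof (rule antisym)
  have "p * (p * card (\<gamma> 4)) \<le> p * card (der4 K)"
    using card_lower_3_le[OF K] large by (simp add: power2_eq_square mult.assoc)
  then show "p * card (\<gamma> 4) \<le> card (der4 K)" using p_pos by simp
qed (rule card_der4_le[OF K])

lemma card_lower_4_less: "card (\<gamma> 4) < p * card (\<gamma> 4)"
  "p * card (\<gamma> 4) < card (\<gamma> 3)"
  using large p_gt_1 card_subgroup_pos[OF lower_central_subgroup, of 4] by (simp_all add: power2_eq_square)

lemma large_derived_ne:
  assumes K: "maximal_subgroup K G"
  shows "derived G K \<noteq> \<gamma> 3" "\<not> derived G K \<subseteq> \<gamma> 4"
proof -
  show "\<not> derived G K \<subseteq> \<gamma> 4"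
    using der4_eq_lower_4_iff[OF K] card_der4[OF K] card_lower_4_less by auto
  show "derived G K \<noteq> \<gamma> 3"
  proof
    assume "derived G K = \<gamma> 3"
    then have "der4 K = \<gamma> 3" using der4_basic[OF K] by auto
    then show False using card_der4[OF K] card_lower_4_less by simp
  qed
qed

lemma large_der4_not_le:
  assumes K: "maximal_subgroup K G" and L: "maximal_subgroup L G" and "K \<noteq> L"
  shows "\<not> der4 K \<subseteq> der4 L"
proof
  assume "der4 K \<subseteq> der4 L"
  then have "\<gamma> 3 \<subseteq> der4 L"
    unfolding lower_3_eq_generate[OF assms]
    using der4_basic[OF L] by (intro generate_subgroup_incl) auto
  then have "card (\<gamma> 3) \<le> card (der4 L)"
    by (rule card_mono[OF subgroup_finite[OF der4_basic(1)[OF L]]])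
  then show False using card_der4[OF L] card_lower_4_less by simp
qed

lemma large_derived_not_le:
  assumes K: "maximal_subgroup K G" and L: "maximal_subgroup L G" and "K \<noteq> L"
  shows "\<not> derived G K \<subseteq> derived G L"
proof
  assume "derived G K \<subseteq> derived G L"
  then have "der4 K \<subseteq> der4 L" unfolding der4_def by (intro mono_generate) auto
  then show False using large_der4_not_le[OF assms] by blast
qed

lemma large_der4_Int:
  assumes K: "maximal_subgroup K G" and L: "maximal_subgroup L G" and "K \<noteq> L"
  shows "der4 K \<inter> der4 L = \<gamma> 4"
proof -
  note bK = der4_basic[OF K] and bL = der4_basic[OF L]
  have sub: "subgroup (der4 K \<inter> der4 L) G" by (rule subgroups_Inter_pair[OF bK(1) bL(1)])
  have "der4 K \<inter> der4 L \<subset> der4 K" using large_der4_not_le[OF assms] by blast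
  then have "p * card (der4 K \<inter> der4 L) \<le> p * card (\<gamma> 4)"
    using card_psubset[OF sub bK(1)] card_der4[OF K] by simp
  then have "card (der4 K \<inter> der4 L) \<le> card (\<gamma> 4)" using p_pos by simp
  then show ?thesis
    using card_seteq[OF subgroup_finite[OF sub], of "\<gamma> 4"] bK bL by auto
qed

end

end

section \<open>The centralizer of G' modulo the fourth term, and p-th powers\<close>

context p_group_two_gen
begin

lemma lower_3_generate_4:
  assumes "\<gamma> 3 \<noteq> {\<one>}"
  shows "\<gamma> 4 \<subset> \<gamma> 3"
  using lower_central_Suc_psubset[of 3] assms by simp

context
  fixes d assumes d: "d \<in> D" "D = generate G (insert d (\<gamma> 3))"
begin

text \<open>Centralizing d modulo \<open>\<gamma> 4\<close> is the same as centralizing all of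
  \<open>D\<close>, because \<open>D\<close> is generated by d and \<open>\<gamma> 3\<close>. So C
  does not depend on the choice of d.\<close>

abbreviation "C \<equiv> centralizer_mod (\<gamma> 4) {d}"

lemma d_carrier: "d \<in> carrier G"
  using d D_subset by blast

lemma C_subgroup: "subgroup C G"
  using d_carrier by (intro centralizer_mod_subgroup[OF lower_central_normal]) simp

lemma C_D_commute:
  assumes x: "x \<in> C" and e: "e \<in> D"
  shows "commutator G e x \<in> \<gamma> 4" "commutator G x e \<in> \<gamma> 4"
proof -
  have xG: "x \<in> carrier G" using x by (simp add: centralizer_mod_def)
  have eG: "e \<in> carrier G" using e D_subset by blast
  have S: "insert d (\<gamma> 3) \<subseteq> carrier G" "{x} \<subseteq> carrier G"
    using d_carrier lower_central_subset xG by auto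
  have dx: "commutator G d x \<in> \<gamma> 4"
    using x subgroup.m_inv_closed[OF lower_central_subgroup, of "commutator G x d" 4] xG d_carrier
    by (simp add: centralizer_mod_def inv_commutator)
  show ex: "commutator G e x \<in> \<gamma> 4"
  proof (rule commutator_generate_mem[OF lower_central_normal S])
    show "e \<in> generate G (insert d (\<gamma> 3))" using e d by simp
    show "x \<in> generate G {x}" by (auto intro: generate.incl)
    fix s t assume "s \<in> insert d (\<gamma> 3)" "t \<in> {x}"
    then show "commutator G s t \<in> \<gamma> 4" using dx commutator_34(1) xG by auto
  qed
  show "commutator G x e \<in> \<gamma> 4"
    using subgroup.m_inv_closed[OF lower_central_subgroup ex] xG eG by (simp add: inv_commutator)
qed

lemma der4_eq_lower_4:
  assumes K: "maximal_subgroup K G" and k: "k \<in> K" "k \<notin> D" "k \<in> C"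
  shows "der4 K = \<gamma> 4"
proof -
  have "der4 K \<subseteq> \<gamma> 4"
    unfolding der4_eq_generate(1)[OF K k(1,2) d]
    using C_D_commute(1)[OF k(3) d(1)] by (intro generate_subgroup_incl[OF _ lower_central_subgroup]) auto
  then show ?thesis using der4_basic[OF K] by blast
qed

text \<open>Otherwise every K' would lie in \<open>\<gamma> 4\<close>, and two maximal subgroups
  already generate \<open>\<gamma> 3\<close> modulo \<open>\<gamma> 4\<close>.\<close>

lemma C_ne_carrier:
  assumes "\<gamma> 3 \<noteq> {\<one>}"
  shows "C \<noteq> carrier G"
proof
  assume C: "C = carrier G"
  obtain x where x: "x \<in> carrier G" "x \<notin> D" by (rule not_in_D)
  have K: "maximal_subgroup (generate G (insert x D)) G" by (rule maximal_subgroup_generate_D[OF x])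
  obtain L where L: "maximal_subgroup L G" "L \<noteq> generate G (insert x D)"
    by (rule other_maximal_subgroup[OF K])
  have "der4 M = \<gamma> 4" if M: "maximal_subgroup M G" for M
  proof -
    obtain m where m: "m \<in> M" "m \<notin> D" "m \<in> carrier G" by (rule maximal_subgroup_elemE[OF M])
    then show ?thesis using der4_eq_lower_4[OF M m(1,2)] C by simp
  qed
  then have "\<gamma> 3 \<subseteq> \<gamma> 4"
    unfolding lower_3_eq_generate[OF L(1) K L(2)] using L K
    by (intro generate_subgroup_incl[OF _ lower_central_subgroup]) auto
  then show False using lower_3_generate_4[OF assms] by blast
qed

lemma power_in_lower_3:
  assumes x: "x \<in> carrier G" "x \<notin> C"
  shows "x [^] p \<in> \<gamma> 3"
proof (rule ccontr)
  assume non: "x [^] p \<notin> \<gamma> 3"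
  have gen: "generate G (insert (x [^] p) (\<gamma> 3)) = D"
    by (rule index_p_generate[OF lower_central_subgroup D_subgroup lower_3_le _ power_in_D[OF x(1)] non])
       (simp add: card_D)
  have S: "insert (x [^] p) (\<gamma> 3) \<subseteq> carrier G" "{x} \<subseteq> carrier G"
    using x lower_central_subset by auto
  have one: "\<one> \<in> \<gamma> 4" by (rule subgroup.one_closed[OF lower_central_subgroup])
  have "x [^] p \<otimes> x = x \<otimes> x [^] p" using x by (simp add: nat_pow_comm[of x p 1, simplified])
  then have xx: "commutator G (x [^] p) x = \<one>" using x by (simp add: commutator_eq_one_iff)
  have "commutator G d x \<in> \<gamma> 4"
  proof (rule commutator_generate_mem[OF lower_central_normal S])
    show "d \<in> generate G (insert (x [^] p) (\<gamma> 3))" using gen d by simp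
    show "x \<in> generate G {x}" by (auto intro: generate.incl)
    fix s t assume "s \<in> insert (x [^] p) (\<gamma> 3)" "t \<in> {x}"
    then show "commutator G s t \<in> \<gamma> 4" using xx one commutator_34(1) x by auto
  qed
  then have "x \<in> C"
    using subgroup.m_inv_closed[OF lower_central_subgroup, of "commutator G d x" 4] x d_carrier
    by (simp add: centralizer_mod_def inv_commutator)
  then show False using x by simp
qed

text \<open>For x in C choose y outside C; then y and x y are both outside C and their p-th powers
  are known. The class-two formula in G/\<open>\<gamma> 3\<close> isolates x^p.\<close>

lemma odd_power_in_lower_3:
  assumes "\<gamma> 3 \<noteq> {\<one>}" and p2: "p \<noteq> 2" and x: "x \<in> carrier G"
  shows "x [^] p \<in> \<gamma> 3"
proof (cases "x \<in> C")
  case True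
  obtain y where y: "y \<in> carrier G" "y \<notin> C"
    using C_ne_carrier[OF assms(1)] subgroup.subset[OF C_subgroup] by blast
  have xy: "x \<otimes> y \<notin> C"
  proof
    assume "x \<otimes> y \<in> C"
    then have "inv x \<otimes> (x \<otimes> y) \<in> C"
      using True subgroup.m_inv_closed[OF C_subgroup] subgroup.m_closed[OF C_subgroup] by blast
    then show False using x y by (simp add: inv_l_cancel)
  qed
  obtain Q :: "'a set monoid" and h where hom: "group_hom G Q h"
    and ker: "\<And>x. x \<in> carrier G \<Longrightarrow> h x = \<one>\<^bsub>Q\<^esub> \<longleftrightarrow> x \<in> \<gamma> 3"
    by (rule normal_quotientE[OF lower_central_normal[of 3]]) (rule that)
  interpret h: group_hom G Q h by fact
  let ?c = "commutator G y x"
  have cD: "?c \<in> D" and cG: "?c \<in> carrier G" using commutator_D_in_D x y by auto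
  have comm: "h ?c \<otimes>\<^bsub>Q\<^esub> h g = h g \<otimes>\<^bsub>Q\<^esub> h ?c" if "g \<in> carrier G" for g
    using commutator_mod_iff[OF lower_central_normal hom ker cG that] commutator_D3(1)[OF cD that] by simp
  have "?c [^] p \<in> \<gamma> 3"
    by (rule index_p_power_mem[OF lower_central_normal D_subgroup lower_3_le card_D cD])
  then have cp: "h ?c [^]\<^bsub>Q\<^esub> p = \<one>\<^bsub>Q\<^esub>"
    using ker[of "?c [^] p"] cG by (simp add: h.hom_nat_pow)
  have "odd p" using prime p2 prime_odd_nat p_gt_1 by (metis le_neq_implies_less Suc_1 Suc_leI)
  then obtain q where q: "p = 2 * q + 1" by (elim oddE)
  \<comment> \<open>Here p must be odd: only then is p(p-1)/2 a multiple of p, so that the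
    commutator term disappears.\<close>
  have "p * (p - 1) div 2 = p * q" using q by simp
  then have ct: "h ?c [^]\<^bsub>Q\<^esub> (p * (p - 1) div 2) = \<one>\<^bsub>Q\<^esub>"
    using cp cG h.H.nat_pow_pow[of "h ?c" p q] by simp
  have "(h x \<otimes>\<^bsub>Q\<^esub> h y) [^]\<^bsub>Q\<^esub> p
      = h x [^]\<^bsub>Q\<^esub> p \<otimes>\<^bsub>Q\<^esub> h y [^]\<^bsub>Q\<^esub> p \<otimes>\<^bsub>Q\<^esub> h ?c [^]\<^bsub>Q\<^esub> (p * (p - 1) div 2)"
    by (rule h.H.mult_pow_class_two) (use x y comm in \<open>simp_all add: h.hom_commutator\<close>)
  then have "h ((x \<otimes> y) [^] p) = h (x [^] p) \<otimes>\<^bsub>Q\<^esub> h (y [^] p)"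
    using ct x y by (simp add: h.hom_nat_pow)
  moreover have "h ((x \<otimes> y) [^] p) = \<one>\<^bsub>Q\<^esub>" "h (y [^] p) = \<one>\<^bsub>Q\<^esub>"
    using ker power_in_lower_3 x y xy by auto
  ultimately have "h (x [^] p) = \<one>\<^bsub>Q\<^esub>" using x by simp
  then show ?thesis using ker x by simp
next
  case False
  then show ?thesis using power_in_lower_3[OF x] by simp
qed

section \<open>The third lower central factor of order p\<close>

context
  assumes small: "card (\<gamma> 3) = p * card (\<gamma> 4)"
begin

lemma small_lower_3_ne: "\<gamma> 4 \<subset> \<gamma> 3"
proof -
  have "card (\<gamma> 4) < card (\<gamma> 3)"
    using small p_gt_1 card_subgroup_pos[OF lower_central_subgroup, of 4] by simp
  then have "\<gamma> 4 \<noteq> \<gamma> 3" by auto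
  then show ?thesis using lower_4_le by blast
qed

lemma small_nontrivial: "\<gamma> 3 \<noteq> {\<one>}"
  using small_lower_3_ne subgroup.one_closed[OF lower_central_subgroup, of 4] by auto

lemma small_der4:
  assumes K: "maximal_subgroup K G" and "\<not> derived G K \<subseteq> \<gamma> 4"
  shows "der4 K = \<gamma> 3"
proof -
  note bK = der4_basic[OF K]
  have "\<gamma> 4 \<subset> der4 K" using bK assms(2) by blast
  then have "card (\<gamma> 3) \<le> card (der4 K)"
    using card_psubset[OF lower_central_subgroup bK(1)] small by simp
  then show ?thesis using card_seteq[OF subgroup_finite[OF lower_central_subgroup] bK(4)] by blast
qed

text \<open>C is the kernel of x \<mapsto> [d, x] from G to a group of order p, so its index is at
  most p, and C is not all of G.\<close>

lemma C_maximal: "maximal_subgroup C G"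
proof (rule maximal_subgroupI[OF C_subgroup])
  have nz: "\<gamma> 3 \<noteq> {\<one>}" by (rule small_nontrivial)
  have "C \<subset> carrier G" using C_ne_carrier[OF nz] subgroup.subset[OF C_subgroup] by blast
  then have 1: "p * card C \<le> card (carrier G)" by (rule card_psubset[OF C_subgroup subgroup_self])
  obtain Q :: "'a set monoid" and h where hom: "group_hom G Q h"
    and ker: "\<And>x. x \<in> carrier G \<Longrightarrow> h x = \<one>\<^bsub>Q\<^esub> \<longleftrightarrow> x \<in> \<gamma> 4"
    by (rule normal_quotientE[OF lower_central_normal[of 4]]) (rule that)
  interpret h: group_hom G Q h by fact
  define f where "f x = h (commutator G d x)" for x
  have cen: "commutator G (commutator G d x) y \<in> \<gamma> 4" if "x \<in> carrier G" "y \<in> carrier G" for x y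
    using commutator_34(1)[OF commutator_D3(1)[OF d(1) that(1)] that(2)] .
  have "f (x \<otimes> y) = f x \<otimes>\<^bsub>Q\<^esub> f y" if "x \<in> carrier G" "y \<in> carrier G" for x y
    unfolding f_def
    by (rule commutator_mult_mod_central[OF lower_central_normal d_carrier hom ker]) (use that cen in auto)
  then have fhom: "group_hom G Q f"
    unfolding group_hom_def group_hom_axioms_def
    using d_carrier by (auto simp: hom_def f_def)
  have "card (f ` carrier G) * card C = card (carrier G)"
  proof (rule card_hom_image[OF fhom subgroup_self finite_carrier])
    fix x assume x: "x \<in> carrier G"
    have "f x = \<one>\<^bsub>Q\<^esub> \<longleftrightarrow> commutator G d x \<in> \<gamma> 4" using ker x d_carrier by (simp add: f_def)
    also have "\<dots> \<longleftrightarrow> commutator G x d \<in> \<gamma> 4"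
      using subgroup.m_inv_closed[OF lower_central_subgroup, of _ 4] x d_carrier by (metis inv_commutator)
    finally show "f x = \<one>\<^bsub>Q\<^esub> \<longleftrightarrow> x \<in> C" using x by (simp add: centralizer_mod_def)
  qed (use subgroup.subset[OF C_subgroup] in auto)
  moreover have "card (f ` carrier G) \<le> p"
  proof -
    have "card (h ` \<gamma> 3) * card (\<gamma> 4) = card (\<gamma> 3)"
      by (rule card_hom_image[OF hom lower_central_subgroup subgroup_finite[OF lower_central_subgroup] ker lower_4_le])
    then have "card (h ` \<gamma> 3) = p"
      using small card_subgroup_pos[OF lower_central_subgroup, of 4] by simp
    moreover have "f ` carrier G \<subseteq> h ` \<gamma> 3"
      using commutator_D3(1)[OF d(1)] by (auto simp: f_def)
    ultimately show ?thesis
      using card_mono[OF finite_imageI[OF subgroup_finite[OF lower_central_subgroup, of 3]]] by metis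
  qed
  ultimately have "card (carrier G) \<le> p * card C" by (metis mult_le_mono1)
  then show "p * card C = card (carrier G)" using 1 by simp
qed

text \<open>K' \<open>\<gamma> 4\<close> is either \<open>\<gamma> 4\<close> or
  \<open>\<gamma> 3\<close>. It is \<open>\<gamma> 4\<close> for C, and a second such subgroup would
  collapse \<open>\<gamma> 3\<close> to \<open>\<gamma> 4\<close>.\<close>

lemma C_exceptional:
  assumes K: "maximal_subgroup K G"
  shows "derived G K \<noteq> \<gamma> 3 \<longleftrightarrow> K = C"
proof
  assume ne: "derived G K \<noteq> \<gamma> 3"
  have CM: "maximal_subgroup C G" by (rule C_maximal)
  show "K = C"
  proof (rule ccontr)
    assume KC: "K \<noteq> C"
    have "derived G K \<subseteq> \<gamma> 4"
      using small_der4[OF K] derived_eq_lower_3[OF K] ne by blast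
    then have "der4 K = \<gamma> 4" using der4_eq_lower_4_iff[OF K] by simp
    moreover obtain m where m: "m \<in> C" "m \<notin> D" "m \<in> carrier G" by (rule maximal_subgroup_elemE[OF CM])
    have "der4 C = \<gamma> 4" by (rule der4_eq_lower_4[OF CM m(1,2,1)])
    ultimately have "\<gamma> 3 \<subseteq> \<gamma> 4"
      unfolding lower_3_eq_generate[OF K CM KC]
      by (intro generate_subgroup_incl[OF _ lower_central_subgroup]) auto
    then show False using small_lower_3_ne by blast
  qed
next
  assume "K = C"
  obtain m where m: "m \<in> K" "m \<notin> D" "m \<in> carrier G" by (rule maximal_subgroup_elemE[OF K])
  have "der4 K = \<gamma> 4" using der4_eq_lower_4[OF K m(1,2)] m \<open>K = C\<close> by simp
  then show "derived G K \<noteq> \<gamma> 3"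
    using der4_basic[OF K] small_lower_3_ne by auto
qed

text \<open>An elementwise three subgroups argument for \<open>G'\<close>, \<open>G\<close> and \<open>C\<close>.\<close>

lemma commutator_3_C:
  assumes u: "u \<in> \<gamma> 3" and m: "m \<in> C"
  shows "commutator G u m \<in> \<gamma> 5"
proof -
  have mG: "m \<in> carrier G" using m by (simp add: centralizer_mod_def)
  obtain Q :: "'a set monoid" and h where hom: "group_hom G Q h"
    and ker: "\<And>x. x \<in> carrier G \<Longrightarrow> h x = \<one>\<^bsub>Q\<^esub> \<longleftrightarrow> x \<in> \<gamma> 5"
    by (rule normal_quotientE[OF lower_central_normal[of 5]]) (rule that)
  interpret h: group_hom G Q h by fact
  note iff = commutator_mod_iff[OF lower_central_normal hom ker]
  have S: "insert d (\<gamma> 3) \<subseteq> carrier G"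
    using d_carrier lower_central_subset by auto
  have c35: "commutator G s t \<in> \<gamma> 5" if "s \<in> \<gamma> 3" "t \<in> D" for s t
    using commutator_derived_in_lower_central[OF that] by simp
  have inc5: "commutator G t s \<in> \<gamma> 5" if "commutator G s t \<in> \<gamma> 5" "s \<in> carrier G" "t \<in> carrier G" for s t
    using subgroup.m_inv_closed[OF lower_central_subgroup that(1)] that by (simp add: inv_commutator)
  \<comment> \<open>G' is cyclic over \<open>\<gamma> 3\<close>, so [d, d] contributes nothing and
    only [\<open>\<gamma> 3\<close>, D] \<le> \<open>\<gamma> 5\<close> remains. This is one step
    better than the general inclusion in \<open>\<gamma> 4\<close>.\<close>
  have DD: "commutator G a b \<in> \<gamma> 5" if "a \<in> D" "b \<in> D" for a b
  proof (rule commutator_generate_mem[OF lower_central_normal S S])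
    show "a \<in> generate G (insert d (\<gamma> 3))" "b \<in> generate G (insert d (\<gamma> 3))"
      using that d by auto
    fix s t assume st: "s \<in> insert d (\<gamma> 3)" "t \<in> insert d (\<gamma> 3)"
    have dd: "commutator G d d \<in> \<gamma> 5"
      using commutator_eq_one_iff[OF d_carrier d_carrier] subgroup.one_closed[OF lower_central_subgroup] by simp
    have stD: "s \<in> D" "t \<in> D" using st d lower_3_le by auto
    have stG: "s \<in> carrier G" "t \<in> carrier G" using st S by auto
    show "commutator G s t \<in> \<gamma> 5"
    proof (cases "s \<in> \<gamma> 3")
      case True
      then show ?thesis using c35 stD by blast
    next
      case False
      then have "s = d" using st by blast
      then show ?thesis using st dd inc5[OF c35[OF _ stD(1)] stG(2,1)] by blast
    qed
  qed
  have base: "commutator G (commutator G e g) m \<in> \<gamma> 5" if e: "e \<in> D" and g: "g \<in> carrier G" for e g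
  proof -
    have eG: "e \<in> carrier G" using e D_subset by blast
    let ?z = "commutator G m e" and ?f = "commutator G m g" and ?u = "commutator G e g"
    have uD: "?u \<in> D" using commutator_D3(1)[OF e g] lower_3_le by blast
    have fD: "?f \<in> D" using commutator_D_in_D mG g by blast
    have z4: "?z \<in> \<gamma> 4" by (rule C_D_commute(2)[OF m e])
    have zc: "h ?z \<otimes>\<^bsub>Q\<^esub> h x = h x \<otimes>\<^bsub>Q\<^esub> h ?z" if "x \<in> carrier G" for x
      using iff[of ?z x] commutator_45(1)[OF z4 that] that mG eG by simp
    have fe: "h ?f \<otimes>\<^bsub>Q\<^esub> h e = h e \<otimes>\<^bsub>Q\<^esub> h ?f"
      using iff[of ?f e] DD[OF fD e] mG eG g by simp
    have fu: "h ?f \<otimes>\<^bsub>Q\<^esub> h ?u = h ?u \<otimes>\<^bsub>Q\<^esub> h ?f"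
      using iff[of ?f ?u] DD[OF fD uD] mG eG g by simp
    \<comment> \<open>Conjugation by m turns e into z e and g into f g. Modulo
      \<open>\<gamma> 5\<close> the element z is central and f commutes with e and with [e, g], so
      the commutator is unchanged.\<close>
    have "m \<otimes> ?u \<otimes> inv m = commutator G (?z \<otimes> e) (?f \<otimes> g)"
      by (simp only: conj_commutator[OF mG eG g] conj_eq_commutator_mult[OF mG eG] conj_eq_commutator_mult[OF mG g])
    also have "\<dots> = ?z \<otimes> (e \<otimes> ?f \<otimes> g \<otimes> inv e \<otimes> inv ?z) \<otimes> inv g \<otimes> inv ?f"
      using mG eG g by (simp add: commutator_def[of G "?z \<otimes> e"] word_simps)
    finally have "h (m \<otimes> ?u \<otimes> inv m) = h (?z \<otimes> (e \<otimes> ?f \<otimes> g \<otimes> inv e \<otimes> inv ?z) \<otimes> inv g \<otimes> inv ?f)" by simp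
    also have "\<dots> = (h ?z \<otimes>\<^bsub>Q\<^esub> h (e \<otimes> ?f \<otimes> g \<otimes> inv e \<otimes> inv ?z)) \<otimes>\<^bsub>Q\<^esub> h (inv g \<otimes> inv ?f)"
      using mG eG g by (simp add: h.H.m_assoc)
    also have "\<dots> = (h (e \<otimes> ?f \<otimes> g \<otimes> inv e \<otimes> inv ?z) \<otimes>\<^bsub>Q\<^esub> h ?z) \<otimes>\<^bsub>Q\<^esub> h (inv g \<otimes> inv ?f)"
      using zc[of "e \<otimes> ?f \<otimes> g \<otimes> inv e \<otimes> inv ?z"] mG eG g by simp
    also have "\<dots> = h (e \<otimes> ?f) \<otimes>\<^bsub>Q\<^esub> h (g \<otimes> inv e \<otimes> inv g \<otimes> inv ?f)"
      using mG eG g by (simp add: h.H.m_assoc h.H.inv_l_cancel)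
    also have "h (e \<otimes> ?f) = h (?f \<otimes> e)" using fe mG eG g by simp
    also have "h (?f \<otimes> e) \<otimes>\<^bsub>Q\<^esub> h (g \<otimes> inv e \<otimes> inv g \<otimes> inv ?f) = h ?f \<otimes>\<^bsub>Q\<^esub> h ?u \<otimes>\<^bsub>Q\<^esub> inv\<^bsub>Q\<^esub> h ?f"
      using mG eG g by (simp add: commutator_def[of G e g] h.H.m_assoc)
    also have "\<dots> = h ?u \<otimes>\<^bsub>Q\<^esub> h ?f \<otimes>\<^bsub>Q\<^esub> inv\<^bsub>Q\<^esub> h ?f" by (simp only: fu)
    also have "\<dots> = h ?u" using mG eG g by (simp add: h.H.m_assoc)
    finally have "h m \<otimes>\<^bsub>Q\<^esub> h ?u \<otimes>\<^bsub>Q\<^esub> inv\<^bsub>Q\<^esub> h m = h ?u" using mG eG g by simp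
    then have "h m \<otimes>\<^bsub>Q\<^esub> h ?u = h ?u \<otimes>\<^bsub>Q\<^esub> h m"
      using mG eG g h.H.inv_solve_right'[of "h ?u" "h m \<otimes>\<^bsub>Q\<^esub> h ?u" "h m"] by simp
    then show ?thesis using iff[of ?u m] mG eG g by simp
  qed
  have "\<gamma> 3 \<subseteq> centralizer_mod (\<gamma> 5) {m}"
  proof -
    have "commutator_subgroup G D (carrier G) \<subseteq> centralizer_mod (\<gamma> 5) {m}"
      by (rule commutator_subgroup_leI[OF centralizer_mod_subgroup[OF lower_central_normal]])
         (use base mG D_subset in \<open>auto simp: centralizer_mod_def subset_iff\<close>)
    then show ?thesis using lower_central_Suc[of 2] by (simp add: lower_2 numeral_3_eq_3)
  qed
  then show ?thesis using u by (auto simp: centralizer_mod_def)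
qed

text \<open>\<open>\<gamma> 3\<close> is generated by c = [d, y] and \<open>\<gamma> 4\<close>, and
  G by y and C. As [c, C] \<le> \<open>\<gamma> 5\<close>, the single commutator [y, c] generates
  \<open>\<gamma> 4\<close> over \<open>\<gamma> 5\<close>, and its p-th power is congruent to
  [y, c^p]. Nontriviality of \<open>\<gamma> 4\<close> makes the index exactly p.\<close>

lemma small_card_4_5:
  assumes "\<gamma> 4 \<noteq> {\<one>}"
  shows "card (\<gamma> 4) = p * card (\<gamma> 5)"
proof -
  have CM: "maximal_subgroup C G" by (rule C_maximal)
  obtain K where K: "maximal_subgroup K G" "K \<noteq> C" by (rule other_maximal_subgroup[OF CM])
  obtain y where y: "y \<in> K" "y \<notin> D" "y \<in> carrier G" by (rule maximal_subgroup_elemE[OF K(1)])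
  have yC: "y \<notin> C" using maximal_subgroup_Int[OF K(1) CM K(2)] y by blast
  let ?c = "commutator G d y"
  have c3: "?c \<in> \<gamma> 3" by (rule commutator_D3(1)[OF d(1) y(3)])
  then have cG: "?c \<in> carrier G" using lower_central_subset by blast
  have "derived G K = \<gamma> 3" using C_exceptional[OF K(1)] K by blast
  then have "der4 K = \<gamma> 3" using der4_basic[OF K(1)] by auto
  then have g3: "\<gamma> 3 = generate G (insert ?c (\<gamma> 4))"
    and cp: "?c [^] p \<in> \<gamma> 4"
    using der4_eq_generate[OF K(1) y(1,2) d] by auto
  let ?b = "commutator G y ?c"
  have b4: "?b \<in> \<gamma> 4" by (rule commutator_34(2)[OF c3 y(3)])
  then have bG: "?b \<in> carrier G" using lower_central_subset by blast
  let ?N = "generate G (insert ?b (\<gamma> 5))"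
  have N: "?N \<lhd> G"
    by (rule generate_insert_central_normal[OF lower_central_normal bG commutator_45(1)[OF b4]])
  have sub: "subgroup ?N G" by (rule normal_imp_subgroup[OF N])
  have inc: "?b \<in> ?N" "\<gamma> 5 \<subseteq> ?N" by (auto intro: generate.incl)
  have S1: "insert y C \<subseteq> carrier G" using y subgroup.subset[OF C_subgroup] by auto
  have S2: "insert ?c (\<gamma> 4) \<subseteq> carrier G" using cG lower_central_subset by auto
  have "commutator G v u \<in> ?N" if u: "u \<in> carrier G" and v: "v \<in> \<gamma> 3" for u v
  proof (rule commutator_generate_mem[OF N S2 S1])
    show "v \<in> generate G (insert ?c (\<gamma> 4))" using v g3 by simp
    show "u \<in> generate G (insert y C)"
      using maximal_subgroup_generate[OF CM y(3) yC] u by simp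
    fix s t assume s: "s \<in> insert ?c (\<gamma> 4)" and t: "t \<in> insert y C"
    have cy: "commutator G ?c y \<in> ?N"
      using subgroup.m_inv_closed[OF sub inc(1)] cG y by (simp add: inv_commutator)
    have tG: "t \<in> carrier G" using t S1 by blast
    show "commutator G s t \<in> ?N"
    proof (cases "s \<in> \<gamma> 4")
      case True
      then show ?thesis using commutator_45(1)[OF True tG] inc by blast
    next
      case False
      then have "s = ?c" using s by blast
      then show ?thesis using t cy commutator_3_C[OF c3] inc by blast
    qed
  qed
  then have "commutator_subgroup G (\<gamma> 3) (carrier G) \<subseteq> ?N"
    by (intro commutator_subgroup_leI[OF sub])
  then have le: "\<gamma> 4 \<subseteq> ?N"
    using lower_central_Suc[of 3] by simp
  have "commutator G y (?c [^] p) \<in> \<gamma> 5" by (rule commutator_45(2)[OF cp y(3)])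
  then have "?b [^] p \<in> \<gamma> 5"
    using commutator_pow_mod_central[OF lower_central_normal y(3) commutator_45(1)[OF b4] cG] by blast
  then have "card ?N \<le> p * card (\<gamma> 5)"
    by (intro card_generate_insert_le[OF lower_central_normal bG _ p_pos subgroup_finite[OF lower_central_subgroup]])
  then have "card (\<gamma> 4) \<le> p * card (\<gamma> 5)"
    using card_mono[OF subgroup_finite[OF sub] le] by simp
  moreover have "\<gamma> 5 \<subset> \<gamma> 4"
    using lower_central_Suc_psubset[of 4] assms by simp
  then have "p * card (\<gamma> 5) \<le> card (\<gamma> 4)"
    by (rule card_psubset[OF lower_central_subgroup lower_central_subgroup])
  ultimately show ?thesis by simp
qed

end

end

text \<open>When the factor has order p^2, no element outside \<open>D\<close> centralizes
  \<open>D\<close> modulo \<open>\<gamma> 4\<close>, so all their p-th powers lie in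
  \<open>\<gamma> 3\<close>. For p = 2 this makes G/\<open>\<gamma> 3\<close> abelian.\<close>

lemma prime_2_not_large:
  assumes large: "card (\<gamma> 3) = p ^ 2 * card (\<gamma> 4)"
  shows "p \<noteq> 2"
proof
  assume p2: "p = 2"
  obtain d where d: "d \<in> D" "d \<in> carrier G" "D = generate G (insert d (\<gamma> 3))" "d [^] p \<in> \<gamma> 3"
    by (rule D_generatorE)
  obtain k where k: "k \<in> carrier G" "k \<notin> D" by (rule not_in_D)
  define K where "K = generate G (insert k D)"
  have K: "maximal_subgroup K G" unfolding K_def by (rule maximal_subgroup_generate_D[OF k])
  have kK: "k \<in> K" unfolding K_def by (auto intro: generate.incl)
  obtain L where L: "maximal_subgroup L G" "L \<noteq> K" by (rule other_maximal_subgroup[OF K])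
  obtain l where l: "l \<in> L" "l \<notin> D" "l \<in> carrier G" by (rule maximal_subgroup_elemE[OF L(1)])
  have lK: "l \<notin> K" using maximal_subgroup_Int[OF L(1) K L(2)] l by blast
  text \<open>Now \<open>G/\<gamma>\<^sub>3(G)\<close> is generated by two involutions whose product is an involution.\<close>
  have sq: "x [^] p \<in> \<gamma> 3" if x: "x \<in> carrier G" "x \<notin> D" for x
  proof (rule power_in_lower_3[OF d(1,3) x(1)])
    let ?X = "generate G (insert x D)"
    have X: "maximal_subgroup ?X G" by (rule maximal_subgroup_generate_D[OF x])
    have xX: "x \<in> ?X" by (auto intro: generate.incl)
    show "x \<notin> centralizer_mod (\<gamma> 4) {d}"
    proof
      assume "x \<in> centralizer_mod (\<gamma> 4) {d}"
      then have "der4 ?X = \<gamma> 4"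
        by (rule der4_eq_lower_4[OF d(1,3) X xX x(2)])
      then show False using card_der4[OF large X] card_lower_4_less[OF large] by simp
    qed
  qed
  have lkD: "l \<otimes> k \<notin> D"
  proof
    assume "l \<otimes> k \<in> D"
    then have "(l \<otimes> k) \<otimes> inv k \<in> K"
      using kK maximal_subgroupD[OF K] by (meson subgroup.m_closed subgroup.m_inv_closed subsetD)
    then show False using lK k l by (simp add: m_assoc)
  qed
  obtain Q :: "'a set monoid" and h where hom: "group_hom G Q h"
    and ker: "\<And>x. x \<in> carrier G \<Longrightarrow> h x = \<one>\<^bsub>Q\<^esub> \<longleftrightarrow> x \<in> \<gamma> 3"
    by (rule normal_quotientE[OF lower_central_normal[of 3]]) (rule that)
  interpret h: group_hom G Q h by fact
  have inv: "inv\<^bsub>Q\<^esub> h x = h x" if x: "x \<in> carrier G" "x \<notin> D" for x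
  proof (rule h.H.inv_equality)
    have "x \<otimes> x \<in> \<gamma> 3" using sq[OF x] p2 x by (simp add: numeral_2_eq_2)
    then show "h x \<otimes>\<^bsub>Q\<^esub> h x = \<one>\<^bsub>Q\<^esub>" using ker[of "x \<otimes> x"] x by simp
  qed (use x in auto)
  have "h l \<otimes>\<^bsub>Q\<^esub> h k = inv\<^bsub>Q\<^esub> (h l \<otimes>\<^bsub>Q\<^esub> h k)" using inv[OF _ lkD] l k by simp
  also have "\<dots> = h k \<otimes>\<^bsub>Q\<^esub> h l" using inv l k by (simp add: h.H.inv_mult_group)
  finally have "commutator G l k \<in> \<gamma> 3"
    using commutator_mod_iff[OF lower_central_normal hom ker l(3) k(1)] by simp
  then have "generate G (insert (commutator G l k) (\<gamma> 3)) \<subseteq> \<gamma> 3"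
    by (intro generate_subgroup_incl[OF _ lower_central_subgroup]) simp
  then show False
    using D_eq_generate_commutator(1)[OF K kK k(2) l(3) lK] lower_3_subset by blast
qed

text \<open>The assumptions on p-th powers make H elementary abelian modulo \<open>der4 H\<close>,
  whose index in H is p^3.\<close>

lemma two_generator_maximal:
  assumes large: "card (\<gamma> 3) = p ^ 2 * card (\<gamma> 4)"
    and H: "maximal_subgroup H G" and K: "maximal_subgroup K G" and L: "maximal_subgroup L G"
    and ne: "K \<noteq> H" "L \<noteq> H" "K \<noteq> L"
    and pK: "\<And>y. y \<in> carrier G \<Longrightarrow> y \<in> D \<or> y \<notin> K \<Longrightarrow> y [^] p \<in> der4 K"
    and pL: "\<And>y. y \<in> carrier G \<Longrightarrow> y \<in> D \<or> y \<notin> L \<Longrightarrow> y [^] p \<in> der4 L"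
  shows "min_gens (G\<lparr>carrier := H\<rparr>) > 2"
proof -
  note mH = maximal_subgroupD[OF H] and bH = der4_basic[OF H]
  interpret HG: p_group "G\<lparr>carrier := H\<rparr>" p by (rule subgroup_p_group[OF mH(1)])
  have NH: "der4 H \<subseteq> H" using bH(4) lower_3_le mH(3) by blast
  interpret HG: p_group_frattini "G\<lparr>carrier := H\<rparr>" p "der4 H"
  proof (intro p_group_frattini.intro p_group_frattini_axioms.intro)
    show "p_group (G\<lparr>carrier := H\<rparr>) p" by (rule HG.p_group_axioms)
    show "subgroup (der4 H) (G\<lparr>carrier := H\<rparr>)" by (rule subgroup_incl[OF bH(1) mH(1) NH])
    show "derived (G\<lparr>carrier := H\<rparr>) (carrier (G\<lparr>carrier := H\<rparr>)) \<subseteq> der4 H"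
      using derived_consistent[of H H] mH bH by simp
    fix x assume "x \<in> carrier (G\<lparr>carrier := H\<rparr>)"
    then have x: "x \<in> H" "x \<in> carrier G" using mH by auto
    \<comment> \<open>Distinct maximal subgroups meet in \<open>D\<close>, so every element of H
      falls under both power hypotheses.\<close>
    have "x \<in> D \<or> x \<notin> K" "x \<in> D \<or> x \<notin> L"
      using maximal_subgroup_Int[OF K H ne(1)] maximal_subgroup_Int[OF L H ne(2)] x by blast+
    then have "x [^] p \<in> der4 K \<inter> der4 L" using pK pL x by blast
    then have "x [^] p \<in> der4 H" using large_der4_Int[OF large K L ne(3)] bH by blast
    then show "x [^]\<^bsub>G\<lparr>carrier := H\<rparr>\<^esub> p \<in> der4 H"
      using x nat_pow_consistent[of x p H] by simp
  qed
  have "card H \<le> p ^ min_gens (G\<lparr>carrier := H\<rparr>) * (p * card (\<gamma> 4))"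
    using HG.card_le_min_gens card_der4[OF large H] by simp
  moreover have "card H = p ^ 3 * (p * card (\<gamma> 4))"
    using mH(4) card_D large by (simp add: power2_eq_square power3_eq_cube mult_ac)
  ultimately have "p ^ 3 \<le> p ^ min_gens (G\<lparr>carrier := H\<rparr>)"
    using p_pos card_subgroup_pos[OF lower_central_subgroup, of 4] by simp
  then show ?thesis using p_gt_1 by simp
qed

end

section \<open>Abelian maximal subgroups\<close>

lemma (in comm_monoid) hom_finprod_endo:
  assumes "\<phi> \<in> hom G G" "\<phi> \<one> = \<one>" "f \<in> Z \<rightarrow> carrier G"
  shows "\<phi> (finprod G f Z) = finprod G (\<lambda>i. \<phi> (f i)) Z"
  using assms(3)
proof (induction Z rule: infinite_finite_induct)
  case (insert z Z)
  have "\<phi> \<in> carrier G \<rightarrow> carrier G" using assms(1) by (simp add: hom_def)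
  then have "(\<lambda>i. \<phi> (f i)) \<in> insert z Z \<rightarrow> carrier G" using insert.prems by auto
  then show ?case
    using insert assms(1) by (simp add: finprod_insert Pi_def hom_mult)
qed (use assms(2) in auto)

lemma (in group) comm_group_if_derived_trivial:
  assumes "subgroup A G" "derived G A = {\<one>}"
  shows "comm_group (G\<lparr>carrier := A\<rparr>)"
proof -
  interpret A: group "G\<lparr>carrier := A\<rparr>" by (rule subgroup_imp_group[OF assms(1)])
  have "x \<otimes> y = y \<otimes> x" if "x \<in> A" "y \<in> A" for x y
    using commutator_in_derived[OF that] assms(2) commutator_eq_one_iff that subgroup.mem_carrier[OF assms(1)]
    by blast
  then show ?thesis by (intro A.group_comm_groupI) simp
qed

text \<open>The situation of G/H' with its abelian maximal subgroup H/H'; q is the acting element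
  outside it.\<close>

locale abelian_maximal = p_group_two_gen +
  fixes A q
  assumes A_maximal: "maximal_subgroup A G" and A_abelian: "derived G A = {\<one>}"
    and q: "q \<in> carrier G" "q \<notin> A"
begin

lemmas A_subgroup = maximal_subgroupD(1)[OF A_maximal]
  and A_normal = maximal_subgroupD(2)[OF A_maximal]
  and D_le_A = maximal_subgroupD(3)[OF A_maximal]
  and card_A = maximal_subgroupD(4)[OF A_maximal]
  and A_subset = maximal_subgroupD(5)[OF A_maximal]

abbreviation "B \<equiv> G\<lparr>carrier := A\<rparr>"

lemma A_carrier: "a \<in> A \<Longrightarrow> a \<in> carrier G"
  using A_subset by blast

lemma A_comm:
  assumes "a \<in> A" "b \<in> A"
  shows "a \<otimes> b = b \<otimes> a"
  using commutator_in_derived[OF assms] A_abelian commutator_eq_one_iff A_carrier assms by blast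

lemma B_comm_group: "comm_group B"
  by (rule comm_group_if_derived_trivial[OF A_subgroup A_abelian])

lemma A_mult: "a \<in> A \<Longrightarrow> b \<in> A \<Longrightarrow> a \<otimes> b \<in> A"
  by (rule subgroup.m_closed[OF A_subgroup])

lemma A_inv: "a \<in> A \<Longrightarrow> inv a \<in> A"
  by (rule subgroup.m_inv_closed[OF A_subgroup])

lemma A_conj: "x \<in> carrier G \<Longrightarrow> a \<in> A \<Longrightarrow> x \<otimes> a \<otimes> inv x \<in> A"
  by (rule normal.inv_op_closed2[OF A_normal])

lemma conj_hom:
  assumes "x \<in> carrier G"
  shows "(\<lambda>a. x \<otimes> a \<otimes> inv x) \<in> hom B B"
proof (rule homI)
  fix a b assume "a \<in> carrier B" "b \<in> carrier B"
  then show "x \<otimes> (a \<otimes>\<^bsub>B\<^esub> b) \<otimes> inv x = (x \<otimes> a \<otimes> inv x) \<otimes>\<^bsub>B\<^esub> (x \<otimes> b \<otimes> inv x)"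
    using assms A_carrier by (simp add: word_simps)
qed (use assms A_conj in simp)

text \<open>A is abelian, so the action of an element on A depends only on its coset. This lets q be
  replaced by b q without changing t.\<close>

lemma conj_A:
  assumes "b \<in> A" "x \<in> carrier G" "a \<in> A"
  shows "(b \<otimes> x) \<otimes> a \<otimes> inv (b \<otimes> x) = x \<otimes> a \<otimes> inv x"
proof -
  have "(b \<otimes> x) \<otimes> a \<otimes> inv (b \<otimes> x) = b \<otimes> (x \<otimes> a \<otimes> inv x) \<otimes> inv b"
    using assms A_carrier by (simp add: word_simps)
  also have "\<dots> = (x \<otimes> a \<otimes> inv x) \<otimes> b \<otimes> inv b"
    using A_comm[OF assms(1) A_conj[OF assms(2,3)]] by simp
  finally show ?thesis using assms A_carrier by (simp add: m_assoc)
qed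

definition t :: "'a \<Rightarrow> 'a" where "t = commutator G q"

lemma t_eq: "a \<in> A \<Longrightarrow> t a = (q \<otimes> a \<otimes> inv q) \<otimes> inv a"
  using q A_carrier by (simp add: t_def commutator_def)

lemma t_mult_self: "a \<in> A \<Longrightarrow> t a \<otimes> a = q \<otimes> a \<otimes> inv q"
  using q A_carrier by (simp add: t_eq m_assoc)

lemma t_in_A: "a \<in> A \<Longrightarrow> t a \<in> A"
  using A_conj[OF q(1)] A_inv A_mult by (simp add: t_eq)

lemma t_hom_B: "t \<in> hom B B"
proof (rule homI)
  fix a b assume "a \<in> carrier B" "b \<in> carrier B"
  then have ab: "a \<in> A" "b \<in> A" by auto
  have G: "a \<in> carrier G" "b \<in> carrier G" using ab A_carrier by auto
  have "t (a \<otimes> b) = (q \<otimes> a \<otimes> inv q) \<otimes> ((q \<otimes> b \<otimes> inv q \<otimes> inv b) \<otimes> inv a)"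
    using ab A_mult G q by (simp add: t_eq word_simps)
  also have "(q \<otimes> b \<otimes> inv q \<otimes> inv b) \<otimes> inv a = inv a \<otimes> (q \<otimes> b \<otimes> inv q \<otimes> inv b)"
    by (rule A_comm) (use ab A_conj[OF q(1)] A_inv A_mult in auto)
  finally show "t (a \<otimes>\<^bsub>B\<^esub> b) = t a \<otimes>\<^bsub>B\<^esub> t b"
    using ab G q by (simp add: t_eq m_assoc)
qed (use t_in_A in simp)

sublocale C: comm_group_endo B t
  using B_comm_group t_hom_B by (simp add: comm_group_endo_def comm_group_endo_axioms_def)

lemma t_image_subgroup:
  assumes "subgroup F G" "F \<subseteq> A"
  shows "subgroup (t ` F) G"
proof -
  have "subgroup F B" by (rule subgroup_incl[OF assms(1) A_subgroup assms(2)])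
  then have "subgroup (t ` F) B" by (rule group_hom.subgroup_img_is_subgroup[OF C.t_hom])
  then show ?thesis by (rule incl_subgroup[OF A_subgroup])
qed

lemma carrier_eq_generate: "generate G (insert q A) = carrier G"
  by (rule maximal_subgroup_generate[OF A_maximal q])

lemma decompose:
  assumes "x \<in> carrier G"
  obtains b i where "b \<in> A" "x = b \<otimes> q [^] (i::nat)"
proof -
  have "q [^] p \<in> A" using power_in_D[OF q(1)] D_le_A by blast
  then show thesis
    using assms that generate_insert_power[OF A_normal q(1) _ p_pos] carrier_eq_generate by auto
qed

text \<open>For g = b q^i the factor b acts trivially. Along i, with k_i the conjugate of k by q^i,
  one has [q^(i+1), k] = t(k_i) [q^i, k], and each k_i stays in F.\<close>

lemma commutator_t_image:
  assumes F: "subgroup F G" "F \<subseteq> A" "t ` F \<subseteq> F" and g: "g \<in> carrier G" and k: "k \<in> F"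
  shows "commutator G g k \<in> t ` F"
proof -
  note sub = t_image_subgroup[OF F(1,2)]
  have kA: "k \<in> A" and kG: "k \<in> carrier G" using k F A_carrier by auto
  have conjF: "q [^] i \<otimes> k \<otimes> inv (q [^] i) \<in> F \<and> commutator G (q [^] i) k \<in> t ` F" for i :: nat
  proof (induction i)
    case 0
    have "commutator G \<one> k = \<one>" using kG by (simp add: commutator_def)
    then show ?case using k kG subgroup.one_closed[OF sub] by simp
  next
    case (Suc i)
    let ?k = "q [^] i \<otimes> k \<otimes> inv (q [^] i)"
    have kF: "?k \<in> F" using Suc by blast
    then have kA': "?k \<in> A" using F by blast
    have com: "q [^] i \<otimes> q = q \<otimes> q [^] i"
      using q(1) by (metis nat_pow_Suc nat_pow_Suc2)
    have "q [^] Suc i \<otimes> k \<otimes> inv (q [^] Suc i) = q \<otimes> ?k \<otimes> inv q"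
      using q kG by (simp add: com) (simp add: word_simps)
    also have "\<dots> = t ?k \<otimes> ?k" by (rule t_mult_self[OF kA', symmetric])
    finally have 1: "q [^] Suc i \<otimes> k \<otimes> inv (q [^] Suc i) = t ?k \<otimes> ?k" .
    have "t ?k \<in> F" using F(3) kF by blast
    then have "t ?k \<otimes> ?k \<in> F" by (rule subgroup.m_closed[OF F(1) _ kF])
    moreover have "commutator G (q [^] Suc i) k = t ?k \<otimes> commutator G (q [^] i) k"
    proof -
      have "commutator G (q [^] Suc i) k = (q [^] Suc i \<otimes> k \<otimes> inv (q [^] Suc i)) \<otimes> inv k"
        by (simp add: commutator_def)
      also have "\<dots> = (t ?k \<otimes> ?k) \<otimes> inv k" by (simp only: 1)
      also have "\<dots> = t ?k \<otimes> (?k \<otimes> inv k)"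
        using t_in_A[OF kA'] kG q by (intro m_assoc) (auto intro: A_carrier)
      finally show ?thesis by (simp add: commutator_def)
    qed
    moreover have "t ?k \<otimes> commutator G (q [^] i) k \<in> t ` F"
      using kF Suc by (intro subgroup.m_closed[OF sub]) auto
    ultimately show ?case using 1 by simp
  qed
  obtain b i where b: "b \<in> A" "g = b \<otimes> q [^] (i::nat)" by (rule decompose[OF g])
  have "commutator G g k = (g \<otimes> k \<otimes> inv g) \<otimes> inv k" by (simp add: commutator_def)
  also have "\<dots> = (q [^] i \<otimes> k \<otimes> inv (q [^] i)) \<otimes> inv k"
    using conj_A[OF b(1) _ kA, of "q [^] i"] b q by simp
  also have "\<dots> = commutator G (q [^] i) k" by (simp add: commutator_def)
  finally show ?thesis using conjF[of i] by simp
qed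

text \<open>\<open>t\<close> applied to A gives a normal subgroup modulo which q centralizes the
  abelian group A; since these generate G, the quotient is abelian.\<close>

lemma t_image_A: "t ` A = D"
proof
  show "t ` A \<subseteq> D" using commutator_D_in_D q A_carrier by (auto simp: t_def)
  have sub: "subgroup (t ` A) G" by (rule t_image_subgroup[OF A_subgroup subset_refl])
  have com: "commutator G g k \<in> t ` A" if "g \<in> carrier G" "k \<in> A" for g k
    by (rule commutator_t_image[OF A_subgroup subset_refl _ that]) (use t_in_A in auto)
  have N: "t ` A \<lhd> G"
    by (rule normalI_commutator[OF sub]) (use com t_in_A in auto)
  have "derived G (generate G (insert q A)) \<subseteq> t ` A"
  proof (rule derived_generate_insert_le[OF N q(1) A_subset])
    fix e x assume "e \<in> A" "x \<in> carrier G"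
    then show "commutator G e x \<in> t ` A"
      using subgroup.m_inv_closed[OF sub com[of x e]] A_carrier by (simp add: inv_commutator)
  qed
  then show "D \<subseteq> t ` A" by (simp add: carrier_eq_generate)
qed

text \<open>Conjugation by q is 1 + t, so polynomial identities in 1 + t speak about powers of
  q.\<close>

lemma act_linear_power:
  assumes a: "a \<in> A"
  shows "poly_act B t ([:1, 1:] ^ k) a = q [^] k \<otimes> a \<otimes> inv (q [^] k)"
proof (induction k)
  case 0
  then show ?case using a C.act_1[of a] A_carrier by simp
next
  case (Suc k)
  let ?x = "q [^] k \<otimes> a \<otimes> inv (q [^] k)"
  have x: "?x \<in> A" by (rule A_conj) (use q a in auto)
  have com: "q [^] k \<otimes> q = q \<otimes> q [^] k"
    using q(1) by (metis nat_pow_Suc nat_pow_Suc2)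
  have "poly_act B t ([:1, 1:] ^ Suc k) a = poly_act B t [:1, 1:] ?x"
    using Suc a C.act_mult[of a "[:1, 1:]" "[:1, 1:] ^ k"] by simp
  also have "\<dots> = ?x \<otimes> t ?x"
    using C.act_pCons[of ?x 1 "[:1:]"] C.act_pCons[of ?x 1 0] x C.t_closed[of ?x] C.t_one A_carrier[OF x] A_carrier[OF t_in_A[OF x]]
      C.int_pow_1[of ?x] by simp
  also have "\<dots> = t ?x \<otimes> ?x" using x t_in_A A_comm by blast
  also have "\<dots> = q \<otimes> ?x \<otimes> inv q" by (rule t_mult_self[OF x])
  also have "\<dots> = q [^] Suc k \<otimes> a \<otimes> inv (q [^] Suc k)"
    using q A_carrier[OF a] by (simp add: com) (simp add: word_simps)
  finally show ?case .
qed

lemma power_p_in_A: "q [^] p \<in> A"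
  using power_in_D[OF q(1)] D_le_A by blast

text \<open>The unipotence condition holds because q^p lies in the abelian group A and so acts
  trivially on it.\<close>

sublocale M: cyclic_operator B t p
proof (intro cyclic_operator.intro cyclic_operator_axioms.intro)
  show "comm_group_endo B t" by (rule C.comm_group_endo_axioms)
  show "p_group B p" by (rule subgroup_p_group[OF A_subgroup])
  show "p * card (t ` carrier B) = card (carrier B)" using t_image_A card_A by simp
  fix a assume "a \<in> carrier B"
  then have a: "a \<in> A" by simp
  have "q [^] p \<otimes> a = a \<otimes> q [^] p" by (rule A_comm[OF power_p_in_A a])
  then have "q [^] p \<otimes> a \<otimes> inv (q [^] p) = a"
    using a q A_carrier by (simp add: m_assoc)
  then show "poly_act B t ([:1, 1:] ^ p) a = a" by (simp add: act_linear_power[OF a])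
qed

lemma filt_subgroup_G: "subgroup (C.filt i) G"
  by (rule incl_subgroup[OF A_subgroup C.filt_subgroup])

lemma filt_le_A: "C.filt i \<subseteq> A"
  using C.filt_subset[of i] by simp

text \<open>The identification starts at \<open>\<gamma> 2\<close>, since \<open>filt 0\<close> is A
  while \<open>\<gamma> 1\<close> is G; this explains both offsets.\<close>

lemma lower_central_eq_filt: "\<gamma> (i + 2) = C.filt (i + 1)"
proof (induction i)
  case 0
  have "C.filt 1 = t ` A" using C.filt_Suc[of 0] by (simp add: C.filt_0)
  then show ?case using lower_2 t_image_A by (simp only: add_0)
next
  case (Suc i)
  have eq: "\<gamma> (Suc i + 2) = commutator_subgroup G (C.filt (i + 1)) (carrier G)"
    using lower_central_Suc[of "i + 2"] Suc by simp
  have F: "C.filt (Suc (i + 1)) = t ` C.filt (i + 1)" by (rule C.filt_Suc)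
  have inv: "t ` C.filt (i + 1) \<subseteq> C.filt (i + 1)" by (rule C.filt_invariant)
  show ?case
  proof
    show "\<gamma> (Suc i + 2) \<subseteq> C.filt (Suc i + 1)"
      unfolding eq
    proof (rule commutator_subgroup_leI[OF filt_subgroup_G])
      fix a g assume a: "a \<in> C.filt (i + 1)" and g: "g \<in> carrier G"
      have "commutator G g a \<in> C.filt (Suc (i + 1))"
        unfolding F by (rule commutator_t_image[OF filt_subgroup_G filt_le_A inv g a])
      then have "inv (commutator G g a) \<in> C.filt (Suc (i + 1))"
        by (rule subgroup.m_inv_closed[OF filt_subgroup_G])
      moreover have "a \<in> carrier G" using a filt_le_A A_carrier by blast
      ultimately show "commutator G a g \<in> C.filt (Suc i + 1)" using g by (simp add: inv_commutator)
    qed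
    show "C.filt (Suc i + 1) \<subseteq> \<gamma> (Suc i + 2)"
    proof
      fix x assume "x \<in> C.filt (Suc i + 1)"
      then obtain a where a: "a \<in> C.filt (i + 1)" "x = commutator G q a" using F by (auto simp: t_def)
      then have "a \<in> \<gamma> (i + 2)" using Suc by simp
      from commutator_in_lower_central(2)[OF this q(1)] show "x \<in> \<gamma> (Suc i + 2)"
        using a by simp
    qed
  qed
qed

lemma lower_central_filt: "i \<ge> 1 \<Longrightarrow> \<gamma> (Suc i) = C.filt i"
  using lower_central_eq_filt[of "i - 1"] by simp

lemma card_A_len: "card A = p ^ M.len"
  using M.card_carrier by simp

lemma order_len: "card (carrier G) = p ^ (M.len + 1)"
  using card_A_len maximal_subgroup_card[OF A_maximal] by simp

lemma len_ge_2: "M.len \<ge> 2"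
proof -
  have "p ^ 3 \<le> p ^ (M.len + 1)" using order_ge order_len by simp
  then show ?thesis using p_gt_1 by (simp only: power_increasing_iff)
qed

text \<open>The chain descends strictly and becomes trivial exactly at \<open>M.len\<close>, while
  |G| = p^(\<open>M.len\<close> + 1).\<close>

lemma maximal_class_G: "maximal_class p G"
  unfolding maximal_class_def has_nilpotency_class_def
proof (intro conjI exI[of _ "M.len + 1"] allI impI)
  show "group G" by (rule is_group)
  show "3 \<le> M.len + 1" using len_ge_2 by simp
  show "Coset.order G = p ^ (M.len + 1)" using order_len by (simp add: Coset.order_def)
  show "\<gamma> (Suc (M.len + 1 - 1)) = {\<one>}"
    using lower_central_filt[of M.len] M.filt_len[of M.len] len_ge_2 by simp
  fix j assume j: "j < M.len + 1 - 1"
  show "\<gamma> (Suc j) \<noteq> {\<one>}"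
  proof (cases "j = 0")
    case True
    have "card (carrier G) \<noteq> 1" using order_len p_gt_1 by simp
    then show ?thesis using True by auto
  next
    case False
    then show ?thesis using lower_central_filt[of j] M.filt_nontrivial[of j] j by simp
  qed
qed

lemma int_pow_B: "a \<in> A \<Longrightarrow> a [^]\<^bsub>B\<^esub> (k::int) = a [^] k"
  using int_pow_consistent[OF A_subgroup] by simp

lemma pow_B: "a \<in> A \<Longrightarrow> a [^]\<^bsub>B\<^esub> int p = a [^] p"
  using int_pow_B[of a "int p"] by (simp only: int_pow_int)

lemma power_in_kern: "q [^] p \<in> M.kern"
proof -
  have "q \<otimes> q [^] p = q [^] p \<otimes> q"
    using q(1) by (metis nat_pow_Suc nat_pow_Suc2)
  then have "t (q [^] p) = \<one>" using q(1) by (simp add: t_def commutator_eq_one_iff)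
  then show ?thesis using power_p_in_A by (simp add: M.kern_def)
qed

text \<open>q^p commutes with q, so it lies in the kernel of t; when A is longer than p steps, the
  kernel lies inside \<open>filt p\<close>.\<close>

lemma power_outside:
  assumes "p < M.len"
  shows "q [^] p \<in> \<gamma> (Suc p)"
  using power_in_kern M.kern_le_filt_p[OF assms] lower_central_filt[of p] p_gt_1 by auto

lemma power_D:
  assumes "a \<in> D"
  shows "a [^] p \<in> \<gamma> (Suc p)"
proof -
  have "C.filt 1 = D" using C.filt_Suc[of 0] t_image_A by (simp add: C.filt_0)
  then have "a [^]\<^bsub>B\<^esub> int p \<in> C.filt p" using M.pow_filt_1[of a] assms by simp
  then show ?thesis using pow_B assms D_le_A lower_central_filt[of p] p_gt_1 by auto
qed

lemma pow_set_eq: "M.pow_set = {a [^] p | a. a \<in> A}"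
  unfolding M.pow_set_def using pow_B by (auto simp: image_def)

text \<open>Collecting the factors x on the left yields the product of their conjugates by 1, q,
  ..., q^(k-1). For k = p this is the norm of x.\<close>

lemma mult_power:
  assumes x: "x \<in> A"
  shows "(x \<otimes> q) [^] (k::nat) = poly_act B t (\<Sum>j<k. [:1, 1:] ^ j) x \<otimes> q [^] k"
proof (induction k)
  case (Suc k)
  let ?y = "poly_act B t (\<Sum>j<k. [:1, 1:] ^ j) x" and ?z = "q [^] k \<otimes> x \<otimes> inv (q [^] k)"
  have y: "?y \<in> carrier G" using C.act_closed[of x] x A_carrier by simp
  have xG: "x \<in> carrier G" using x A_carrier by simp
  have "poly_act B t (\<Sum>j<Suc k. [:1, 1:] ^ j) x = ?y \<otimes> ?z"
    using C.act_add[of x] x by (simp add: act_linear_power)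
  moreover have "(x \<otimes> q) [^] Suc k = ?y \<otimes> ?z \<otimes> q [^] Suc k"
    using Suc y xG q by (simp add: word_simps)
  ultimately show ?case by simp
qed (use x A_carrier q in simp)

section \<open>Full rank: splitting and the wreath product\<close>

context
  assumes rank: "p ^ p * card M.pow_set = card A"
begin

lemma rank_B: "p ^ p * card M.pow_set = card (carrier B)"
  using rank by simp

lemma A_exponent: "a \<in> A \<Longrightarrow> a [^] p = \<one>"
  using M.full_rank(1)[OF rank_B refl] pow_set_eq by auto

lemma len_eq: "M.len = p"
  by (rule M.full_rank(2)[OF rank_B refl])

text \<open>Since \<open>q\<^sup>p\<close> is fixed by \<open>q\<close>, it is a norm, and dividing \<open>q\<close> by a preimage splits the extension.\<close>

lemma splitting:
  obtains s where "s \<in> carrier G" "s \<notin> A" "s [^] p = \<one>"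
    "\<And>a. a \<in> A \<Longrightarrow> s \<otimes> a \<otimes> inv s = q \<otimes> a \<otimes> inv q"
proof -
  obtain b where b: "b \<in> A" "q [^] p = poly_act B t M.nrm b"
    using M.kern_eq_norms[OF rank_B refl power_in_kern] by auto
  let ?s = "inv b \<otimes> q"
  have bG: "b \<in> carrier G" and ib: "inv b \<in> A" using b A_carrier A_inv by auto
  have nG: "poly_act B t M.nrm b \<in> A" using C.act_closed[of b] b by simp
  show thesis
  proof (rule that[of ?s])
    show "?s \<in> carrier G" using bG q by simp
    show "?s \<notin> A"
    proof
      assume "?s \<in> A"
      then have "b \<otimes> (inv b \<otimes> q) \<in> A" using b A_mult by blast
      then show False using bG q by (simp add: inv_r_cancel)
    qed
    have "?s [^] p = poly_act B t M.nrm (inv b) \<otimes> q [^] p"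
      using mult_power[OF ib] by (simp add: M.nrm_def)
    also have "poly_act B t M.nrm (inv b) = inv (poly_act B t M.nrm b)"
    proof -
      have "poly_act B t M.nrm (b [^]\<^bsub>B\<^esub> (-1::int)) = poly_act B t M.nrm b [^]\<^bsub>B\<^esub> (-1::int)"
        using b by (intro C.act_int_pow) simp
      then show ?thesis
        using int_pow_B[OF b(1), of "-1"] int_pow_B[OF nG, of "-1"] bG A_carrier[OF nG]
        by (simp add: int_pow_neg)
    qed
    finally show "?s [^] p = \<one>" using b(2) A_carrier[OF nG] by simp
    fix a assume a: "a \<in> A"
    show "?s \<otimes> a \<otimes> inv ?s = q \<otimes> a \<otimes> inv q" by (rule conj_A[OF ib q(1) a])
  qed
qed

text \<open>Point functions in the base group go to conjugates of a module generator a of A under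
  the complement generated by s. The image meets A in an invariant subgroup containing a, hence in
  A, and contains s, so the map is onto; equality of orders gives injectivity.\<close>

lemma wreath_iso: "G \<cong> regular_wreath (integer_mod_group p) (integer_mod_group p)"
proof -
  obtain s where s: "s \<in> carrier G" "s \<notin> A" "s [^] p = \<one>"
    and sq: "\<And>a. a \<in> A \<Longrightarrow> s \<otimes> a \<otimes> inv s = q \<otimes> a \<otimes> inv q"
    by (rule splitting) (rule that)
  obtain a where a: "a \<in> A"
    and gen: "\<And>F. subgroup F B \<Longrightarrow> t ` F \<subseteq> F \<Longrightarrow> a \<in> F \<Longrightarrow> F = A"
    using M.generator by auto
  have aG: "a \<in> carrier G" by (rule A_carrier[OF a])
  \<comment> \<open>The inverse matches the right translation in the wreath product: s^b must move
    \<open>\<tau> i\<close> to \<open>\<tau> (i - b)\<close>, so the conjugates are taken along r =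
    s^-1 and b is sent to r^(-b).\<close>
  define r where "r = inv s"
  have r: "r \<in> carrier G" using s by (simp add: r_def)
  have rp: "r [^] (int p * k) = \<one>" for k :: int
  proof -
    have "r [^] int p = \<one>" using s by (simp add: r_def int_pow_int nat_pow_inv)
    then show ?thesis using r by (simp add: int_pow_pow[symmetric])
  qed
  have rmod: "r [^] (i mod int p) = r [^] i" for i :: int
  proof -
    have "r [^] i = r [^] (int p * (i div int p) + i mod int p)" by simp
    also have "\<dots> = r [^] (i mod int p)" using r rp by (simp only: int_pow_mult[OF r]) simp
    finally show ?thesis by simp
  qed
  define \<tau> where "\<tau> i = r [^] i \<otimes> a \<otimes> inv (r [^] i)" for i :: int
  have \<tau>A: "\<tau> i \<in> A" for i unfolding \<tau>_def by (rule A_conj) (use r a in auto)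
  have \<tau>mod: "\<tau> (i mod int p) = \<tau> i" for i unfolding \<tau>_def rmod ..
  have \<tau>conj: "r [^] k \<otimes> \<tau> i \<otimes> inv (r [^] k) = \<tau> (k + i)" for k i :: int
    unfolding \<tau>_def using r aG by (simp add: word_simps int_pow_mult)
  have Apow: "x [^] (int p * k) = \<one>" if "x \<in> A" for x and k :: int
  proof -
    have "x [^] int p = \<one>" using A_exponent[OF that] by (simp only: int_pow_int)
    then show ?thesis using A_carrier[OF that] by (simp add: int_pow_pow[symmetric])
  qed
  have Apowmod: "x [^] (k mod int p) = x [^] k" if x: "x \<in> A" for x and k :: int
  proof -
    have "x [^] k = x [^] (int p * (k div int p) + k mod int p)" by simp
    also have "\<dots> = x [^] (k mod int p)" using x Apow A_carrier by (simp only: int_pow_mult[OF A_carrier[OF x]]) simp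
    finally show ?thesis by simp
  qed
  have powA: "x [^] (k::int) \<in> A" if "x \<in> A" for x k by (rule subgroup_int_pow_closed[OF A_subgroup that])
  let ?Z = "{0..<int p}"
  let ?W = "regular_wreath (integer_mod_group p) (integer_mod_group p)"
  define F where "F f = finprod B (\<lambda>i. \<tau> i [^] (f i :: int)) ?Z" for f
  have \<tau>f: "(\<lambda>i. \<tau> (g i) [^] (f i :: int)) \<in> ?Z \<rightarrow> carrier B" for f g
    using powA \<tau>A by simp
  have FA: "F f \<in> A" for f using C.finprod_closed[OF \<tau>f[of "\<lambda>i. i" f]] by (simp add: F_def)
  have FG: "F f \<in> carrier G" for f by (rule A_carrier[OF FA])
  define \<Phi> where "\<Phi> = (\<lambda>(f, b). F f \<otimes> r [^] (- b :: int))"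
  have ppos: "int p > 0" using p_pos by simp
  have carW: "carrier ?W = (?Z \<rightarrow>\<^sub>E ?Z) \<times> ?Z"
    using p_pos by (simp add: regular_wreath_def carrier_integer_mod_group)
  have gW: "group ?W" by (rule group_regular_wreath) simp_all
  interpret W: group ?W by (rule gW)
  \<comment> \<open>Substituting i = (x + b) mod p turns the shifted conjugates back into
    \<open>\<tau> x\<close> and moves the shift into the argument of g, as the wreath multiplication
    requires.\<close>
  have conjF: "r [^] (- b) \<otimes> F g \<otimes> inv (r [^] (- b)) = finprod B (\<lambda>x. \<tau> x [^] g ((x + b) mod int p)) ?Z" for b :: int and g
  proof -
    let ?\<kappa> = "\<lambda>x. r [^] (- b) \<otimes> x \<otimes> inv (r [^] (- b))"
    have kh: "?\<kappa> \<in> hom B B" by (rule conj_hom) (use r in simp)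
    have "?\<kappa> (F g) = finprod B (\<lambda>i. ?\<kappa> (\<tau> i [^] g i)) ?Z"
      unfolding F_def by (rule C.hom_finprod_endo[OF kh _ \<tau>f]) (use r in simp)
    also have "\<dots> = finprod B (\<lambda>i. \<tau> (i - b) [^] g i) ?Z"
    proof (rule C.finprod_cong')
      fix i assume "i \<in> ?Z"
      have "?\<kappa> (\<tau> i [^]\<^bsub>B\<^esub> g i) = ?\<kappa> (\<tau> i) [^]\<^bsub>B\<^esub> g i"
        using group_hom.hom_int_pow[of B B ?\<kappa> "\<tau> i" "g i"] kh \<tau>A
        by (simp add: group_hom_def group_hom_axioms_def C.is_group)
      then show "?\<kappa> (\<tau> i [^] g i) = \<tau> (i - b) [^] g i"
        using \<tau>A \<tau>conj[of "- b" i] by (simp add: int_pow_B)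
    qed (use \<tau>f in simp_all)
    also have "\<dots> = finprod B (\<lambda>i. \<tau> (i - b) [^] g i) ((\<lambda>x. (x + b) mod int p) ` ?Z)"
    proof -
      have "(\<lambda>x. (x + b) mod int p) ` ?Z = ?Z"
      proof
        show "?Z \<subseteq> (\<lambda>x. (x + b) mod int p) ` ?Z"
        proof
          fix y assume "y \<in> ?Z"
          then have "y = ((y - b) mod int p + b) mod int p" by (simp add: mod_simps)
          then show "y \<in> (\<lambda>x. (x + b) mod int p) ` ?Z" using ppos by (intro image_eqI[of _ _ "(y - b) mod int p"]) auto
        qed
      qed (use ppos in auto)
      then show ?thesis by simp
    qed
    also have "\<dots> = finprod B (\<lambda>x. \<tau> ((x + b) mod int p - b) [^] g ((x + b) mod int p)) ?Z"
    proof (rule C.finprod_reindex)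
      show "inj_on (\<lambda>x. (x + b) mod int p) ?Z"
      proof (rule inj_onI)
        fix x y assume xy: "x \<in> ?Z" "y \<in> ?Z" "(x + b) mod int p = (y + b) mod int p"
        then have "(x + b - b) mod int p = (y + b - b) mod int p" by (intro mod_diff_cong refl)
        then show "x = y" using xy by simp
      qed
    qed (use powA \<tau>A in auto)
    also have "\<dots> = finprod B (\<lambda>x. \<tau> x [^] g ((x + b) mod int p)) ?Z"
    proof (rule C.finprod_cong')
      fix x assume "x \<in> ?Z"
      have "((x + b) mod int p - b) mod int p = x mod int p" by (simp add: mod_simps)
      then have "\<tau> ((x + b) mod int p - b) = \<tau> x" by (metis \<tau>mod)
      then show "\<tau> ((x + b) mod int p - b) [^] g ((x + b) mod int p) = \<tau> x [^] g ((x + b) mod int p)" by simp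
    qed (use \<tau>f[of "\<lambda>i. i"] in simp_all)
    finally show ?thesis .
  qed
  have hom: "\<Phi> \<in> hom ?W G"
  proof (rule homI)
    fix x assume "x \<in> carrier ?W"
    then show "\<Phi> x \<in> carrier G" using FG r by (auto simp: \<Phi>_def split: prod.split)
  next
    fix x y assume "x \<in> carrier ?W" "y \<in> carrier ?W"
    then obtain f b g c where xy: "x = (f, b)" "y = (g, c)" "f \<in> ?Z \<rightarrow>\<^sub>E ?Z" "g \<in> ?Z \<rightarrow>\<^sub>E ?Z" "b \<in> ?Z" "c \<in> ?Z"
      unfolding carW by auto
    let ?g = "\<lambda>x. g ((x + b) mod int p)"
    let ?fg = "\<lambda>x\<in>?Z. (f x + ?g x) mod int p"
    have prod: "x \<otimes>\<^bsub>?W\<^esub> y = (?fg, (b + c) mod int p)"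
      using xy p_pos by (simp add: regular_wreath_def carrier_integer_mod_group)
    have "F ?fg = finprod B (\<lambda>i. (\<tau> i [^] f i) \<otimes>\<^bsub>B\<^esub> (\<tau> i [^] ?g i)) ?Z"
      unfolding F_def
    proof (rule C.finprod_cong')
      fix i assume "i \<in> ?Z"
      then show "\<tau> i [^] ?fg i = (\<tau> i [^] f i) \<otimes>\<^bsub>B\<^esub> (\<tau> i [^] ?g i)"
        using Apowmod[OF \<tau>A] A_carrier[OF \<tau>A] by (simp add: int_pow_mult)
    qed (use powA \<tau>A A_mult in auto)
    also have "\<dots> = finprod B (\<lambda>i. \<tau> i [^] f i) ?Z \<otimes>\<^bsub>B\<^esub> finprod B (\<lambda>i. \<tau> i [^] ?g i) ?Z"
      by (rule C.finprod_multf) (use powA \<tau>A in auto)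
    also have "\<dots> = F f \<otimes> (r [^] (- b) \<otimes> F g \<otimes> inv (r [^] (- b)))"
      by (simp add: conjF) (simp add: F_def)
    finally have 1: "F ?fg = F f \<otimes> (r [^] (- b) \<otimes> F g \<otimes> inv (r [^] (- b)))" .
    have "r [^] (- ((b + c) mod int p)) = r [^] (- b) \<otimes> r [^] (- c)"
    proof -
      have "r [^] (- ((b + c) mod int p)) = r [^] (- b + - c)"
        using int_pow_neg[OF r, of "(b + c) mod int p"] int_pow_neg[OF r, of "b + c"] rmod[of "b + c"] by simp
      then show ?thesis by (simp only: int_pow_mult[OF r])
    qed
    then have "\<Phi> (x \<otimes>\<^bsub>?W\<^esub> y) = F f \<otimes> (r [^] (- b) \<otimes> F g \<otimes> inv (r [^] (- b))) \<otimes> (r [^] (- b) \<otimes> r [^] (- c))"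
      unfolding prod \<Phi>_def by (simp add: 1)
    also have "\<dots> = \<Phi> x \<otimes> \<Phi> y"
      unfolding xy \<Phi>_def using FG r by (simp add: m_assoc inv_l_cancel)
    finally show "\<Phi> (x \<otimes>\<^bsub>?W\<^esub> y) = \<Phi> x \<otimes> \<Phi> y" .
  qed
  have ghom: "group_hom ?W G \<Phi>"
    using gW hom by (simp add: group_hom_def group_hom_axioms_def is_group)
  let ?I = "\<Phi> ` carrier ?W"
  have I: "subgroup ?I G" by (rule group_hom.img_is_subgroup[OF ghom])
  have F0: "F (\<lambda>x\<in>?Z. 0) = \<one>"
  proof -
    have "F (\<lambda>x\<in>?Z. 0) = finprod B (\<lambda>i. \<one>\<^bsub>B\<^esub>) ?Z"
      unfolding F_def by (rule C.finprod_cong') (use subgroup.one_closed[OF A_subgroup] in auto)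
    also have "\<dots> = \<one>\<^bsub>B\<^esub>" by (rule C.finprod_one)
    finally show ?thesis by simp
  qed
  have sI: "s \<in> ?I"
  proof (rule image_eqI)
    show "(\<lambda>x\<in>?Z. 0, 1) \<in> carrier ?W" unfolding carW using p_gt_1 by auto
    have "r [^] (- 1 :: int) = s" using s r by (simp add: r_def int_pow_neg)
    then show "s = \<Phi> (\<lambda>x\<in>?Z. 0, 1)" using s by (simp only: \<Phi>_def F0 prod.case) simp
  qed
  have aI: "a \<in> ?I"
  proof (rule image_eqI)
    let ?f = "\<lambda>x\<in>?Z. if x = 0 then 1 else (0::int)"
    show "(?f, 0) \<in> carrier ?W" unfolding carW using p_gt_1 by auto
    have "F ?f = finprod B (\<lambda>i. if 0 = i then \<tau> i else \<one>\<^bsub>B\<^esub>) ?Z"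
      unfolding F_def using A_carrier[OF \<tau>A] \<tau>A subgroup.one_closed[OF A_subgroup] by (intro C.finprod_cong') auto
    also have "\<dots> = \<tau> 0" by (rule C.finprod_singleton) (use ppos \<tau>A in auto)
    also have "\<tau> 0 = a" using aG by (simp add: \<tau>_def)
    finally show "a = \<Phi> (?f, 0)" using aG by (simp only: \<Phi>_def prod.case) simp
  qed
  have "?I \<inter> A = A"
  proof (rule gen)
    have "subgroup (?I \<inter> A) G" by (rule subgroups_Inter_pair[OF I A_subgroup])
    then show "subgroup (?I \<inter> A) B" by (rule subgroup_incl[OF _ A_subgroup]) simp
    show "a \<in> ?I \<inter> A" using a aI by simp
    have "t x \<in> ?I \<inter> A" if x: "x \<in> ?I" "x \<in> A" for x
    proof -
      have "t x = s \<otimes> x \<otimes> inv s \<otimes> inv x" using x sq t_eq by simp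
      moreover have "s \<otimes> x \<otimes> inv s \<otimes> inv x \<in> ?I"
        using sI x by (intro subgroup.m_closed[OF I] subgroup.m_inv_closed[OF I])
      ultimately show ?thesis using t_in_A[OF x(2)] by simp
    qed
    then show "t ` (?I \<inter> A) \<subseteq> ?I \<inter> A" by blast
  qed
  then have "insert s A \<subseteq> ?I" using sI by blast
  then have "generate G (insert s A) \<subseteq> ?I" by (rule generate_subgroup_incl[OF _ I])
  then have surj: "?I = carrier G"
    using maximal_subgroup_generate[OF A_maximal s(1,2)] subgroup.subset[OF I] by blast
  have "card (carrier ?W) = card (carrier G)"
    using order_regular_wreath_integer_mod_group[OF p_pos] order_len len_eq by (simp add: Coset.order_def)
  moreover have "finite (carrier ?W)" unfolding carW by (intro finite_cartesian_product finite_PiE) auto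
  ultimately have "inj_on \<Phi> (carrier ?W)" using surj by (intro eq_card_imp_inj_on) auto
  then have "\<Phi> \<in> iso ?W G" using hom surj by (simp add: iso_iff)
  then have "?W \<cong> G" by (rule is_isoI)
  then show ?thesis by (rule W.iso_sym)
qed

end

end

section \<open>The quotient by the commutator subgroup of a maximal subgroup\<close>

context p_group_two_gen
begin

lemma quotient_abelian_maximal:
  assumes H: "maximal_subgroup H G" and g: "g \<in> carrier G" "g \<notin> H"
  shows "abelian_maximal (G Mod derived G H) p ((\<lambda>x. derived G H #> x) ` H) (derived G H #> g)"
proof -
  note mH = maximal_subgroupD[OF H]
  have N: "derived G H \<lhd> G" by (rule derived_is_normal[OF mH(2)])
  have subN: "subgroup (derived G H) G" by (rule normal_imp_subgroup[OF N])
  obtain Q :: "'a set monoid" and h where Q: "Q = G Mod derived G H" and h: "h = (\<lambda>x. derived G H #> x)"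
    and hom: "group_hom G Q h" and surj: "h ` carrier G = carrier Q"
    and ker: "\<And>x. x \<in> carrier G \<Longrightarrow> h x = \<one>\<^bsub>Q\<^esub> \<longleftrightarrow> x \<in> derived G H"
    by (rule normal_quotientE[OF N]) (rule that)
  interpret h: group_hom G Q h by fact
  interpret Q: p_group Q p unfolding Q by (rule quotient_p_group[OF N])
  let ?c = "card (derived G H)"
  have c: "?c > 0" by (rule card_subgroup_pos[OF subN])
  have leH: "derived G H \<subseteq> H" using derived_maximal_le[OF H] lower_3_le mH(3) by blast
  have cG: "card (carrier Q) * ?c = card (carrier G)"
    using card_hom_image[OF hom subgroup_self finite_carrier ker subgroup.subset[OF subN]] surj by simp
  have cH: "card (h ` H) * ?c = card H"
    by (rule card_hom_image[OF hom mH(1) subgroup_finite[OF mH(1)] ker leH])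
  have leD: "derived G H \<subseteq> D" using derived_maximal_le[OF H] lower_3_le by blast
  have cD: "card (h ` D) * ?c = card D"
    by (rule card_hom_image[OF hom D_subgroup subgroup_finite[OF D_subgroup] ker leD])
  have D: "derived Q (carrier Q) = h ` D"
    using h.derived_img[of "carrier G"] surj by simp
  have "p ^ 2 * card (h ` D) * ?c = card (carrier Q) * ?c"
    using cD cG index_derived by (simp add: mult.assoc)
  then have 1: "p ^ 2 * card (h ` D) = card (carrier Q)" using c by simp
  \<comment> \<open>H' \<le> \<open>\<gamma> 3\<close> keeps the quotient large: |G :
    \<open>\<gamma> 3\<close>| = p^3, so the order bound of the locale survives.\<close>
  have "?c \<le> card (\<gamma> 3)"
    by (rule card_mono[OF subgroup_finite[OF lower_central_subgroup] derived_maximal_le[OF H]])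
  then have "p ^ 3 * ?c \<le> p ^ 2 * (p * card (\<gamma> 3))"
    by (simp add: power2_eq_square power3_eq_cube mult_ac)
  also have "\<dots> = card (carrier Q) * ?c" using index_derived card_D cG by simp
  finally have 2: "p ^ 3 \<le> card (carrier Q)" using c by simp
  have sub: "subgroup (h ` H) Q" by (rule h.subgroup_img_is_subgroup[OF mH(1)])
  have "p * card (h ` H) * ?c = card (carrier Q) * ?c"
    using cH cG maximal_subgroup_card[OF H] by (simp add: mult.assoc)
  then have max: "maximal_subgroup (h ` H) Q" using c by (intro Q.maximal_subgroupI[OF sub]) simp
  have der: "derived Q (h ` H) = {\<one>\<^bsub>Q\<^esub>}"
  proof -
    have "h x = \<one>\<^bsub>Q\<^esub>" if "x \<in> derived G H" for x
      using ker[OF subgroup.mem_carrier[OF subN that]] that by simp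
    then have "h ` derived G H = {\<one>\<^bsub>Q\<^esub>}" using subgroup.one_closed[OF subN] by force
    then show ?thesis using h.derived_img[OF mH(5)] by simp
  qed
  have "h g \<notin> h ` H"
  proof
    assume "h g \<in> h ` H"
    then obtain x where x: "x \<in> H" "h g = h x" by blast
    then have xG: "x \<in> carrier G" using mH by blast
    have "h (g \<otimes> inv x) = \<one>\<^bsub>Q\<^esub>" using x xG g by simp
    then have "g \<otimes> inv x \<in> H" using ker[of "g \<otimes> inv x"] g xG leH by auto
    then have "(g \<otimes> inv x) \<otimes> x \<in> H" using subgroup.m_closed[OF mH(1)] x by blast
    then show False using g xG by (simp add: m_assoc)
  qed
  then have "abelian_maximal Q p (h ` H) (h g)"
    using 1 2 D max der g
    by (intro abelian_maximal.intro p_group_two_gen.intro p_group_two_gen_axioms.intro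
        abelian_maximal_axioms.intro Q.p_group_axioms) auto
  then show ?thesis by (simp add: Q h)
qed

text \<open>In G/K' the power y^p lies in \<open>lower_central Q (Suc p)\<close>: for y in
  \<open>D\<close> because p t A \<le> \<open>filt p\<close>, and for y outside K because y itself
  may serve as q. Pulling back costs only K'.\<close>

lemma power_in_der4:
  assumes K: "maximal_subgroup K G" and p2: "p \<noteq> 2" and big: "p ^ (p + 1) * card (derived G K) \<le> card K"
    and y: "y \<in> carrier G" "y \<in> D \<or> y \<notin> K"
  shows "y [^] p \<in> der4 K"
proof -
  note mK = maximal_subgroupD[OF K] and bK = der4_basic[OF K]
  have N: "derived G K \<lhd> G" by (rule derived_is_normal[OF mK(2)])
  have subN: "subgroup (derived G K) G" by (rule normal_imp_subgroup[OF N])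
  obtain Q :: "'a set monoid" and h where Q: "Q = G Mod derived G K" and h: "h = (\<lambda>x. derived G K #> x)"
    and hom: "group_hom G Q h" and surj: "h ` carrier G = carrier Q"
    and ker: "\<And>x. x \<in> carrier G \<Longrightarrow> h x = \<one>\<^bsub>Q\<^esub> \<longleftrightarrow> x \<in> derived G K"
    by (rule normal_quotientE[OF N]) (rule that)
  interpret h: group_hom G Q h by fact
  have am: "abelian_maximal Q p (h ` K) (h g)" if "g \<in> carrier G" "g \<notin> K" for g
    unfolding Q h by (rule quotient_abelian_maximal[OF K that])
  have leK: "derived G K \<subseteq> K" using derived_maximal_le[OF K] lower_3_le mK(3) by blast
  have "h (y [^] p) \<in> lower_central Q (Suc p)"
  proof (cases "y \<in> D")
    case True
    obtain g where g: "g \<in> carrier G" "g \<notin> K" using mK by blast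
    interpret A: abelian_maximal Q p "h ` K" "h g" by (rule am[OF g])
    have "h y \<in> derived Q (carrier Q)"
      using h.derived_img[of "carrier G"] surj True by auto
    from A.power_D[OF this] show ?thesis using y by (simp add: h.hom_nat_pow)
  next
    case False
    then have yK: "y \<notin> K" using y by blast
    interpret A: abelian_maximal Q p "h ` K" "h y" by (rule am[OF y(1) yK])
    have "card (h ` K) * card (derived G K) = card K"
      by (rule card_hom_image[OF hom mK(1) subgroup_finite[OF mK(1)] ker leK])
    then have "p ^ (p + 1) * card (derived G K) \<le> p ^ A.M.len * card (derived G K)"
      using big A.card_A_len by simp
    then have "p ^ (p + 1) \<le> p ^ A.M.len" using card_subgroup_pos[OF subN] by simp
    then have "p < A.M.len" using p_gt_1 by (simp only: power_increasing_iff)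
    from A.power_outside[OF this] show ?thesis using y by (simp add: h.hom_nat_pow)
  qed
  then have "h (y [^] p) \<in> h ` \<gamma> (Suc p)" using h.lower_central_img[OF surj] by simp
  then obtain u where u: "u \<in> \<gamma> (Suc p)" "h (y [^] p) = h u" by blast
  \<comment> \<open>A prime other than 2 is at least 3.\<close>
  have "\<gamma> (Suc p) \<subseteq> \<gamma> 4"
    using p_gt_1 p2 by (intro lower_central_antimono) simp
  then have u4: "u \<in> der4 K" and uG: "u \<in> carrier G" using u bK lower_central_subset[of "Suc p"] by auto
  have "h (y [^] p \<otimes> inv u) = \<one>\<^bsub>Q\<^esub>" using u uG y by simp
  then have "y [^] p \<otimes> inv u \<in> der4 K" using ker[of "y [^] p \<otimes> inv u"] y uG bK by auto
  then have "(y [^] p \<otimes> inv u) \<otimes> u \<in> der4 K" by (rule subgroup.m_closed[OF bK(1) _ u4])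
  then show ?thesis using y uG by (simp add: m_assoc)
qed

text \<open>All assertions are read off from H/H'. The bridge is d(H) = rank of A/pA, obtained by
  counting along the preimage F of pA.\<close>

lemma maximal_subgroup_quotient:
  assumes H: "maximal_subgroup H G"
  defines "d \<equiv> min_gens (G\<lparr>carrier := H\<rparr>)"
  shows "maximal_class p (G Mod derived G H)" "d \<le> p"
    "d < p - 1 \<Longrightarrow> sub_index G (frattini (G\<lparr>carrier := H\<rparr>)) (derived G H) \<le> p"
    "d < p - 1 \<Longrightarrow> sub_index G H (derived G H) = p ^ (d + 1) \<or> sub_index G H (derived G H) = p ^ d"
    "d = p \<Longrightarrow> G Mod derived G H \<cong> regular_wreath (integer_mod_group p) (integer_mod_group p)"
    "d = p \<Longrightarrow> elementary_abelian p (G\<lparr>carrier := H\<rparr> Mod derived G H)"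
    "d = p \<Longrightarrow> order (G\<lparr>carrier := H\<rparr> Mod derived G H) = p ^ p"
proof -
  note mH = maximal_subgroupD[OF H]
  have N: "derived G H \<lhd> G" by (rule derived_is_normal[OF mH(2)])
  have subN: "subgroup (derived G H) G" by (rule normal_imp_subgroup[OF N])
  obtain Q :: "'a set monoid" and h where Q: "Q = G Mod derived G H" and h: "h = (\<lambda>x. derived G H #> x)"
    and hom: "group_hom G Q h" and surj: "h ` carrier G = carrier Q"
    and ker: "\<And>x. x \<in> carrier G \<Longrightarrow> h x = \<one>\<^bsub>Q\<^esub> \<longleftrightarrow> x \<in> derived G H"
    by (rule normal_quotientE[OF N]) (rule that)
  interpret h: group_hom G Q h by fact
  obtain g where g: "g \<in> carrier G" "g \<notin> H" using mH by blast
  interpret A: abelian_maximal Q p "h ` H" "h g"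
    unfolding Q h by (rule quotient_abelian_maximal[OF H g])
  interpret HG: p_group "G\<lparr>carrier := H\<rparr>" p by (rule subgroup_p_group[OF mH(1)])
  have leH: "derived G H \<subseteq> H" using derived_maximal_le[OF H] lower_3_le mH(3) by blast
  let ?c = "card (derived G H)"
  have c: "?c > 0" by (rule card_subgroup_pos[OF subN])
  have cH: "card (h ` H) * ?c = card H"
    by (rule card_hom_image[OF hom mH(1) subgroup_finite[OF mH(1)] ker leH])
  have HGD: "derived (G\<lparr>carrier := H\<rparr>) (carrier (G\<lparr>carrier := H\<rparr>)) = derived G H"
    using derived_consistent[of H H] mH by simp
  have HGpow: "x [^]\<^bsub>G\<lparr>carrier := H\<rparr>\<^esub> p = x [^] p" for x
    using nat_pow_consistent[of x p H] by simp
  define P where "P = A.M.pow_set"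
  have P: "P = {h y [^]\<^bsub>Q\<^esub> p | y. y \<in> H}" unfolding P_def A.pow_set_eq by auto
  have subP: "subgroup P Q"
    unfolding P_def by (rule h.H.incl_subgroup[OF A.A_subgroup A.M.pow_set_subgroup])
  have PH: "P \<subseteq> h ` H" unfolding P_def using subgroup.subset[OF A.M.pow_set_subgroup] by simp
  \<comment> \<open>F = H^p H' contains H' and all p-th powers, and lies in every maximal subgroup
    of H; so it qualifies for the basis theorem and has index p^d in H.\<close>
  define F where "F = {x \<in> H. h x \<in> P}"
  have hF: "h ` F = P" using PH by (auto simp: F_def)
  have FG: "F \<subseteq> carrier G" using mH by (auto simp: F_def)
  have subF: "subgroup F G"
  proof (rule subgroupI)
    show "F \<noteq> {}" using subgroup.one_closed[OF subP] subgroup.one_closed[OF mH(1)] by (auto simp: F_def)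
  next
    fix x assume x: "x \<in> F"
    then have "inv\<^bsub>Q\<^esub> h x \<in> P" by (intro subgroup.m_inv_closed[OF subP]) (simp add: F_def)
    then show "inv x \<in> F"
      using x FG subgroup.m_inv_closed[OF mH(1)] by (auto simp: F_def)
  next
    fix x y assume xy: "x \<in> F" "y \<in> F"
    then have "h x \<otimes>\<^bsub>Q\<^esub> h y \<in> P" by (intro subgroup.m_closed[OF subP]) (simp_all add: F_def)
    moreover have "x \<in> carrier G" "y \<in> carrier G" using xy FG by auto
    ultimately show "x \<otimes> y \<in> F"
      using xy subgroup.m_closed[OF mH(1)] by (simp add: F_def)
  qed (rule FG)
  have FH: "F \<subseteq> H" by (auto simp: F_def)
  have leF: "derived G H \<subseteq> F"
  proof
    fix x assume x: "x \<in> derived G H"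
    then have "h x = \<one>\<^bsub>Q\<^esub>" using ker leH mH(5) by blast
    then show "x \<in> F" using x leH subgroup.one_closed[OF subP] by (auto simp: F_def)
  qed
  interpret HG: p_group_frattini "G\<lparr>carrier := H\<rparr>" p F
  proof (intro p_group_frattini.intro p_group_frattini_axioms.intro)
    show "p_group (G\<lparr>carrier := H\<rparr>) p" by (rule HG.p_group_axioms)
    show "subgroup F (G\<lparr>carrier := H\<rparr>)" by (rule subgroup_incl[OF subF mH(1) FH])
    show "derived (G\<lparr>carrier := H\<rparr>) (carrier (G\<lparr>carrier := H\<rparr>)) \<subseteq> F"
      unfolding HGD by (rule leF)
    fix x assume "x \<in> carrier (G\<lparr>carrier := H\<rparr>)"
    then have x: "x \<in> H" "x \<in> carrier G" using mH by auto
    have "h (x [^] p) \<in> P" using x P by (auto simp: h.hom_nat_pow)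
    moreover have "x [^] p \<in> H"
      using subgroup_int_pow_closed[OF mH(1) x(1), of "int p"] by (simp add: int_pow_int)
    ultimately show "x [^]\<^bsub>G\<lparr>carrier := H\<rparr>\<^esub> p \<in> F" by (simp add: F_def HGpow)
  qed
  have frat: "F \<subseteq> M" if M: "maximal_subgroup M (G\<lparr>carrier := H\<rparr>)" for M
  proof
    fix x assume "x \<in> F"
    then obtain y where y: "y \<in> H" "h x = h y [^]\<^bsub>Q\<^esub> p" and xH: "x \<in> H" using P by (auto simp: F_def)
    have G: "x \<in> carrier G" "y \<in> carrier G" using xH y mH by auto
    have subM: "subgroup M (G\<lparr>carrier := H\<rparr>)" using M by (simp add: maximal_subgroup_def)
    have "h (x \<otimes> inv (y [^] p)) = \<one>\<^bsub>Q\<^esub>" using y G by (simp add: h.hom_nat_pow)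
    then have "x \<otimes> inv (y [^] p) \<in> derived G H" using ker[of "x \<otimes> inv (y [^] p)"] G by simp
    then have "x \<otimes> inv (y [^] p) \<in> M" using HG.maximal_subgroup_derived_le[OF M] HGD by auto
    moreover have "y [^] p \<in> M" using HG.maximal_subgroup_power_mem[OF M, of y] y HGpow by simp
    ultimately have "(x \<otimes> inv (y [^] p)) \<otimes> y [^] p \<in> M"
      using subgroup.m_closed[OF subM, of "x \<otimes> inv (y [^] p)" "y [^] p"] by simp
    then show "x \<in> M" using G by (simp add: m_assoc)
  qed
  have cF: "card P * ?c = card F"
    using card_hom_image[OF hom subF subgroup_finite[OF subF] ker leF] hF by simp
  have "p ^ d * card F = card H"
    using HG.min_gens_card[OF frat] by (simp add: d_def)
  then have "p ^ d * card P * ?c = card (h ` H) * ?c" using cF cH by (simp add: mult.assoc)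
  then have rank: "p ^ d * card A.M.pow_set = card (h ` H)" using c by (simp add: P_def)
  then have rankB: "p ^ d * card A.M.pow_set = card (carrier (Q\<lparr>carrier := h ` H\<rparr>))" by simp
  have "sub_index G H (derived G H) * ?c = card (h ` H) * ?c"
    using sub_index_mult_card[OF mH(1) subN leH] cH by simp
  then have index: "sub_index G H (derived G H) = card (h ` H)" using c by simp
  show "maximal_class p (G Mod derived G H)" using A.maximal_class_G by (simp add: Q)
  show "d \<le> p" by (rule A.M.rank_le[OF rankB])
  show "sub_index G (frattini (G\<lparr>carrier := H\<rparr>)) (derived G H) \<le> p" if "d < p - 1"
  proof -
    have "sub_index G F (derived G H) * ?c = card P * ?c"
      using sub_index_mult_card[OF subF subN leF] cF by simp
    then have "sub_index G F (derived G H) \<le> p"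
      using A.M.card_pow_set_le[OF rankB that] c by (simp add: P_def)
    \<comment> \<open>The cosets of H' by elements of the Frattini subgroup are among those by
      elements of F, so the inclusion suffices for the upper bound.\<close>
    moreover have "sub_index G (frattini (G\<lparr>carrier := H\<rparr>)) (derived G H) \<le> sub_index G F (derived G H)"
      unfolding sub_index_def
    proof (rule card_mono)
      show "finite (rcosets\<^bsub>G\<lparr>carrier := F\<rparr>\<^esub> derived G H)"
        using subgroup_finite[OF subF] by (simp add: RCOSETS_def)
      show "rcosets\<^bsub>G\<lparr>carrier := frattini (G\<lparr>carrier := H\<rparr>)\<rparr>\<^esub> derived G H
        \<subseteq> rcosets\<^bsub>G\<lparr>carrier := F\<rparr>\<^esub> derived G H"
        using HG.frattini_le by (auto simp: RCOSETS_def)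
    qed
    ultimately show ?thesis by simp
  qed
  show "sub_index G H (derived G H) = p ^ (d + 1) \<or> sub_index G H (derived G H) = p ^ d" if "d < p - 1"
  proof -
    obtain k where k: "card P = p ^ k" using A.card_subgroup[OF subP] by blast
    have "p ^ k \<le> p ^ 1" using A.M.card_pow_set_le[OF rankB that] k by (simp add: P_def)
    then have "k \<le> 1" using p_gt_1 by (simp only: power_increasing_iff)
    moreover have "sub_index G H (derived G H) = p ^ (d + k)"
      using index rank k by (simp add: P_def power_add)
    ultimately show ?thesis by (cases k) auto
  qed
  assume dp: "d = p"
  have rankp: "p ^ p * card A.M.pow_set = card (h ` H)" using rank dp by simp
  show "G Mod derived G H \<cong> regular_wreath (integer_mod_group p) (integer_mod_group p)"
    using A.wreath_iso[OF rankp] by (simp add: Q)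
  show "elementary_abelian p (G\<lparr>carrier := H\<rparr> Mod derived G H)"
    unfolding elementary_abelian_def
  proof (intro conjI ballI)
    show "comm_group (G\<lparr>carrier := H\<rparr> Mod derived G H)"
      by (rule derived_quot_of_subgroup_is_comm_group[OF mH(1)])
    interpret NH: normal "derived G H" "G\<lparr>carrier := H\<rparr>"
      by (rule derived_subgroup_is_normal[OF mH(1)])
    fix x assume "x \<in> carrier (G\<lparr>carrier := H\<rparr> Mod derived G H)"
    then obtain y where y: "y \<in> H" "x = derived G H #>\<^bsub>G\<lparr>carrier := H\<rparr>\<^esub> y"
      by (auto simp: carrier_FactGroup)
    have yG: "y \<in> carrier G" using y mH by blast
    have "h (y [^] p) = \<one>\<^bsub>Q\<^esub>"
      using A.A_exponent[OF rankp, of "h y"] y yG by (simp add: h.hom_nat_pow)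
    then have "y [^] p \<in> derived G H" using ker yG by simp
    moreover have "x [^]\<^bsub>G\<lparr>carrier := H\<rparr> Mod derived G H\<^esub> p = derived G H #>\<^bsub>G\<lparr>carrier := H\<rparr>\<^esub> (y [^] p)"
      using NH.FactGroup_pow[of y p] y HGpow by simp
    ultimately show "x [^]\<^bsub>G\<lparr>carrier := H\<rparr> Mod derived G H\<^esub> p = \<one>\<^bsub>G\<lparr>carrier := H\<rparr> Mod derived G H\<^esub>"
      using coset_join2[OF _ subN, of "y [^] p"] yG by simp
  qed
  have "order (G\<lparr>carrier := H\<rparr> Mod derived G H) = sub_index G H (derived G H)"
    by (simp add: sub_index_def order_def FactGroup_def)
  then show "order (G\<lparr>carrier := H\<rparr> Mod derived G H) = p ^ p"
    using index A.card_A_len A.len_eq[OF rankp] by simp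
qed

section \<open>Translation of indices and assembly of the parts\<close>

lemma sub_index_eq_iff:
  assumes "subgroup S G" "subgroup T G" "T \<subseteq> S"
  shows "sub_index G S T = k \<longleftrightarrow> card S = k * card T"
  using sub_index_mult_card[OF assms] card_subgroup_pos[OF assms(2)] by auto

lemma lower_index_iff:
  "sub_index G (\<gamma> i) (\<gamma> (Suc i)) = k
    \<longleftrightarrow> card (\<gamma> i) = k * card (\<gamma> (Suc i))"
  by (rule sub_index_eq_iff[OF lower_central_subgroup lower_central_subgroup lower_central_Suc_subset])

lemma part_d:
  assumes "card (\<gamma> 3) = p * card (\<gamma> 4)"
  shows "\<exists>!M. maximal_subgroup M G \<and> derived G M \<noteq> \<gamma> 3"
    "\<gamma> 4 \<noteq> {\<one>} \<Longrightarrow> card (\<gamma> 4) = p * card (\<gamma> 5)"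
proof -
  obtain d where d: "d \<in> D" "d \<in> carrier G" "D = generate G (insert d (\<gamma> 3))" "d [^] p \<in> \<gamma> 3"
    by (rule D_generatorE)
  show "\<exists>!M. maximal_subgroup M G \<and> derived G M \<noteq> \<gamma> 3"
  proof (rule ex1I)
    show "maximal_subgroup (centralizer_mod (\<gamma> 4) {d}) G \<and>
        derived G (centralizer_mod (\<gamma> 4) {d}) \<noteq> \<gamma> 3"
      using C_maximal[OF d(1,3) assms] C_exceptional[OF d(1,3) assms] by blast
  next
    fix M assume "maximal_subgroup M G \<and> derived G M \<noteq> \<gamma> 3"
    then show "M = centralizer_mod (\<gamma> 4) {d}"
      using C_exceptional[OF d(1,3) assms, of M] by blast
  qed
  show "\<gamma> 4 \<noteq> {\<one>} \<Longrightarrow> card (\<gamma> 4) = p * card (\<gamma> 5)"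
    by (rule small_card_4_5[OF d(1,3) assms])
qed

text \<open>The order of \<open>\<gamma> 3\<close> over \<open>\<gamma> 4\<close> is 1, p or p^2.
  The first two values leave at most one maximal subgroup M with M' different from
  \<open>\<gamma> 3\<close>; for the third, H would need three generators.\<close>

lemma part_f:
  assumes H: "maximal_subgroup H G" and dH: "min_gens (G\<lparr>carrier := H\<rparr>) \<le> 2"
    and K: "maximal_subgroup K G" "K \<noteq> H" "p ^ (p + 1) \<le> sub_index G K (derived G K)"
    and L: "maximal_subgroup L G" "L \<noteq> H" "p ^ (p + 1) \<le> sub_index G L (derived G L)"
  shows "K = L"
proof (rule ccontr)
  assume KL: "K \<noteq> L"
  have big: "p ^ (p + 1) * card (derived G M) \<le> card M" if M: "maximal_subgroup M G" "p ^ (p + 1) \<le> sub_index G M (derived G M)" for M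
  proof -
    have "sub_index G M (derived G M) * card (derived G M) = card M"
      using derived_maximal_le[OF M(1)] lower_3_le maximal_subgroupD[OF M(1)]
      by (intro sub_index_mult_card derived_is_subgroup) auto
    then show ?thesis using M(2) by (metis mult_le_mono1)
  qed
  \<comment> \<open>|M : \<open>\<gamma> 3\<close>| is only p^2, which is less than p^(p+1).\<close>
  have ne3: "derived G M \<noteq> \<gamma> 3" if M: "maximal_subgroup M G" "p ^ (p + 1) \<le> sub_index G M (derived G M)" for M
  proof
    assume "derived G M = \<gamma> 3"
    then have "p ^ (p + 1) * card (\<gamma> 3) \<le> p ^ 2 * card (\<gamma> 3)"
      using big[OF M] maximal_subgroupD(4)[OF M(1)] card_D by (simp add: power2_eq_square)
    then have "p ^ (p + 1) \<le> p ^ 2" using card_subgroup_pos[OF lower_central_subgroup, of 3] by simp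
    then have "p + 1 \<le> 2" using p_gt_1 by (simp only: power_increasing_iff)
    then show False using p_gt_1 by simp
  qed
  obtain a b where a: "card (\<gamma> 3) = p ^ a" and b: "card (\<gamma> 4) = p ^ b"
    using card_subgroup[OF lower_central_subgroup] by metis
  have "p ^ b \<le> p ^ a"
    using a b card_mono[OF subgroup_finite[OF lower_central_subgroup] lower_4_le] by simp
  then have ba: "b \<le> a" using p_gt_1 by (simp only: power_increasing_iff)
  have "card (\<gamma> 3) \<le> p * (p * card (\<gamma> 4))"
    using card_lower_3_le[OF H] card_der4_le[OF H] by (meson mult_le_mono2 order_trans)
  then have "p ^ a \<le> p ^ (b + 2)" using a b by (simp add: power_add power2_eq_square mult_ac)
  then have "a \<le> b + 2" using p_gt_1 by (simp only: power_increasing_iff)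
  then consider "a = b" | "a = b + 1" | "a = b + 2" using ba by linarith
  then show False
  proof cases
    case 1
    \<comment> \<open>Equal orders are possible only for the trivial group, since the series
      descends strictly. Then K' is trivial as well, against K' being different from
      \<open>\<gamma> 3\<close>.\<close>
    have "\<gamma> 3 = {\<one>}"
    proof (rule ccontr)
      assume "\<gamma> 3 \<noteq> {\<one>}"
      then have "card (\<gamma> 4) < card (\<gamma> 3)"
        by (intro psubset_card_mono[OF subgroup_finite[OF lower_central_subgroup] lower_3_generate_4])
      then show False using a b 1 by simp
    qed
    moreover have "derived G K \<subseteq> \<gamma> 3" by (rule derived_maximal_le[OF K(1)])
    moreover have "\<one> \<in> derived G K"
      using maximal_subgroupD(5)[OF K(1)] by (intro subgroup.one_closed derived_is_subgroup)
    ultimately have "derived G K = \<gamma> 3" by auto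
    then show False using ne3[OF K(1,3)] by simp
  next
    case 2
    then have "card (\<gamma> 3) = p * card (\<gamma> 4)" using a b by simp
    then obtain M where M: "\<And>M'. maximal_subgroup M' G \<and> derived G M' \<noteq> \<gamma> 3 \<Longrightarrow> M' = M"
      using part_d(1) by (metis (no_types, lifting))
    have "K = M" "L = M" using M[OF conjI[OF K(1) ne3[OF K(1,3)]]] M[OF conjI[OF L(1) ne3[OF L(1,3)]]] .
    then show False using KL by simp
  next
    case 3
    then have large: "card (\<gamma> 3) = p ^ 2 * card (\<gamma> 4)"
      using a b by (simp add: power2_eq_square)
    have p2: "p \<noteq> 2" by (rule prime_2_not_large[OF large])
    have "min_gens (G\<lparr>carrier := H\<rparr>) > 2"
    proof (rule two_generator_maximal[OF large H K(1) L(1) K(2) L(2) KL])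
      show "y [^] p \<in> der4 K" if "y \<in> carrier G" "y \<in> D \<or> y \<notin> K" for y
        by (rule power_in_der4[OF K(1) p2 big[OF K(1,3)] that])
      show "y [^] p \<in> der4 L" if "y \<in> carrier G" "y \<in> D \<or> y \<notin> L" for y
        by (rule power_in_der4[OF L(1) p2 big[OF L(1,3)] that])
    qed
    then show False using dH by simp
  qed
qed

lemma part_g:
  assumes "\<gamma> 3 \<noteq> {\<one>}" "p \<noteq> 2"
  shows "power_subgroup G p \<subseteq> \<gamma> 3"
proof -
  obtain d where d: "d \<in> D" "d \<in> carrier G" "D = generate G (insert d (\<gamma> 3))" "d [^] p \<in> \<gamma> 3"
    by (rule D_generatorE)
  show ?thesis
    unfolding power_subgroup_def
    by (rule generate_subgroup_incl[OF _ lower_central_subgroup])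
       (use odd_power_in_lower_3[OF d(1,3) assms] in blast)
qed

end

text \<open>The guard in (d) is forced: in class 3 with |\<open>\<gamma> 3\<close>| = p both
  \<open>\<gamma> 4\<close> and \<open>\<gamma> 5\<close> are trivial. So is p \<noteq> 2 in (g): in
  the dihedral group of order 16 the squares generate G', of order 4, while
  \<open>\<gamma> 3\<close> has order 2. "All save one" is read as the existence of exactly one
  exception.\<close>

theorem theorem4:
  fixes G :: "('a, 'b) monoid_scheme" and p n :: nat and H :: "'a set"
  assumes "Factorial_Ring.prime p"
    and "group G" and "order G = p ^ n" and "order G \<ge> p ^ 3"
    and "sub_index G (carrier G) (derived G (carrier G)) = p ^ 2"
    and "maximal_subgroup H G"
  shows
    \<comment> \<open>(a)\<close>
   "(maximal_class p (G Mod derived G H) \<and> min_gens (G\<lparr>carrier := H\<rparr>) \<le> p) \<and>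
    \<comment> \<open>(b)\<close>
    (min_gens (G\<lparr>carrier := H\<rparr>) < p - 1 \<longrightarrow>
       sub_index G (frattini (G\<lparr>carrier := H\<rparr>)) (derived G H) \<le> p \<and>
       (sub_index G H (derived G H) = p ^ (min_gens (G\<lparr>carrier := H\<rparr>) + 1) \<or>
        sub_index G H (derived G H) = p ^ min_gens (G\<lparr>carrier := H\<rparr>))) \<and>
    \<comment> \<open>(c)\<close>
    (min_gens (G\<lparr>carrier := H\<rparr>) = p \<longrightarrow>
       G Mod derived G H \<cong> regular_wreath (integer_mod_group p) (integer_mod_group p) \<and>
       elementary_abelian p (G\<lparr>carrier := H\<rparr> Mod derived G H) \<and>
       order (G\<lparr>carrier := H\<rparr> Mod derived G H) = p ^ p) \<and>
    \<comment> \<open>(d)\<close>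
    (sub_index G (lower_central G 3) (lower_central G 4) = p \<longrightarrow>
       (lower_central G 4 \<noteq> {\<one>\<^bsub>G\<^esub>} \<longrightarrow>
          sub_index G (lower_central G 4) (lower_central G 5) = p) \<and>
       (\<exists>!M. maximal_subgroup M G \<and> derived G M \<noteq> lower_central G 3)) \<and>
    \<comment> \<open>(e)\<close>
    (sub_index G (lower_central G 3) (lower_central G 4) = p ^ 2 \<longrightarrow>
       derived G H \<noteq> lower_central G 3 \<and> \<not> derived G H \<subseteq> lower_central G 4 \<and>
       (\<forall>K. maximal_subgroup K G \<and> K \<noteq> H \<longrightarrow>
          \<not> derived G H \<subseteq> derived G K \<and> derived G H \<noteq> derived G K)) \<and>
    \<comment> \<open>(f)\<close>
    (min_gens (G\<lparr>carrier := H\<rparr>) \<le> 2 \<longrightarrow>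
       metacyclic (G\<lparr>carrier := H\<rparr>) \<or>
       (\<exists>\<^sub>\<le>\<^sub>1 K. maximal_subgroup K G \<and> K \<noteq> H \<and> sub_index G K (derived G K) \<ge> p ^ (p + 1))) \<and>
    \<comment> \<open>(g)\<close>
    (lower_central G 3 \<noteq> {\<one>\<^bsub>G\<^esub>} \<and> p \<noteq> 2 \<longrightarrow>
       power_subgroup G p \<subseteq> lower_central G 3)"
proof -
  interpret group G by fact
  have pg: "p_group G p" using assms(1-3) by (auto simp: p_group_def p_group_axioms_def)
  have "p ^ 2 * card (derived G (carrier G)) = card (carrier G)"
    using sub_index_mult_card[OF subgroup_self derived_is_subgroup[OF subset_refl] derived_in_carrier[OF subset_refl]] assms(5)
    by simp
  then interpret p_group_two_gen G p
    using pg assms(4) by (simp add: p_group_two_gen_def p_group_two_gen_axioms_def order_def)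
  note H = assms(6)
  note quot = maximal_subgroup_quotient[OF H]
  have i34: "sub_index G (lower_central G 3) (lower_central G 4) = k
      \<longleftrightarrow> card (lower_central G 3) = k * card (lower_central G 4)" for k
    using lower_index_iff[of 3 k] by simp
  have i45: "sub_index G (lower_central G 4) (lower_central G 5) = k
      \<longleftrightarrow> card (lower_central G 4) = k * card (lower_central G 5)" for k
    using lower_index_iff[of 4 k] by simp
  show ?thesis
  proof (intro conjI impI allI)
    assume "min_gens (G\<lparr>carrier := H\<rparr>) \<le> 2"
    then show "metacyclic (G\<lparr>carrier := H\<rparr>) \<or>
       (\<exists>\<^sub>\<le>\<^sub>1 K. maximal_subgroup K G \<and> K \<noteq> H \<and> sub_index G K (derived G K) \<ge> p ^ (p + 1))"
      using part_f[OF H] by (intro disjI2 Uniq_I) blast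
  next
    assume l: "sub_index G (lower_central G 3) (lower_central G 4) = p ^ 2"
    then have large: "card (lower_central G 3) = p ^ 2 * card (lower_central G 4)" by (simp only: i34)
    show "derived G H \<noteq> lower_central G 3" "\<not> derived G H \<subseteq> lower_central G 4"
      using large_derived_ne[OF large H] by blast+
    fix K assume K: "maximal_subgroup K G \<and> K \<noteq> H"
    then show "\<not> derived G H \<subseteq> derived G K" "derived G H \<noteq> derived G K"
      using large_derived_not_le[OF large H, of K] by auto
  next
    assume "sub_index G (lower_central G 3) (lower_central G 4) = p"
    then have small: "card (lower_central G 3) = p * card (lower_central G 4)" by (simp only: i34)
    show "\<exists>!M. maximal_subgroup M G \<and> derived G M \<noteq> lower_central G 3" by (rule part_d(1)[OF small])
    assume "lower_central G 4 \<noteq> {\<one>\<^bsub>G\<^esub>}"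
    then show "sub_index G (lower_central G 4) (lower_central G 5) = p"
      unfolding i45 by (rule part_d(2)[OF small])
  qed (use quot part_g in blast)+
qed

end
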